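(* Let $(V,E,F)$ be a triangulation of a closed oriented torus $S_1$, $n=|V|$, and let $\Theta:E\to[0,\pi)$ be any Delaunay angle structure. Let $\tilde f:P(\Theta)\to\operatorname{Teich}(S_{1,n})$, $X\mapsto|X|$, be the embedding of the space of circle patterns into the Teichmüller space of the $n$-punctured torus $S_{1,n}=S_1-V$ (in shear/cross ratio coordinates), let $\omega_P$ be the Weil–Petersson symplectic form on $\operatorname{Teich}(S_{1,n})$, and let $X^\dagger\in P(\Theta)$ be the unique cross ratio system that induces a Euclidean torus. Then the pullback $\tilde f^*\omega_P$ is non-degenerate on $P(\Theta)-\{X^\dagger\}$, i.e. for every $X\in P(\Theta)$ with $X\ne X^\dagger$, the bilinear form $\tilde f^*\omega_P$ on $T_XP(\Theta)$ is non-degenerate.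
   Context: **Cross ratio systems.** $V,E,F$ are the vertices, (unoriented) edges and faces of a triangulation of the closed oriented torus $S_1$; edges around a vertex are counted in the universal cover. A cross ratio system is a function $X:E\to\mathbb{C}$, $X_{ij}=X_{ji}$, such that for every vertex $i$, with adjacent vertices (in the universal cover) numbered $1,\dots,r$ in clockwise order around $i$, $$\prod_{j=1}^r X_{ij}=1,\qquad X_{i1}+X_{i1}X_{i2}+\dots+X_{i1}X_{i2}\cdots X_{ir}=0.$$ **Delaunay angle structure.** A function $\Theta:E\to[0,\pi)$, $\Theta_{ij}=\Theta_{ji}$, such that (i) for every vertex $i$, $\sum_j\Theta_{ij}=2\pi$, the sum being over the neighbours of $i$ in the universal cover; (ii) for any collection of edges $(e_0,e_1,\dots,e_r=e_0)$ whose dual edges form a simple closed contractible path on the surface, $\sum_{i=1}^r\Theta_{e_i}>2\pi$, unless the path encloses exactly one vertex of the triangulation. **The space $P(\Theta)$.** $P(\Theta)$ is the set of cross ratio systems $X$ with $\operatorname{Im}(\log X)=\Theta$ (i.e. $X_{ij}\ne0$ has argument $\Theta_{ij}$). Each $X\in P(\Theta)$ determines a map $z:\tilde V\to\mathbb{C}\cup\{\infty\}$ on the vertices of the lifted triangulation of the universal cover, unique up to Möbius transformations, with $X_{ij}=-\frac{(z_k-z_i)(z_l-z_j)}{(z_i-z_l)(z_j-z_k)}$ for each edge $ij$ with positively oriented adjacent triangles $ijk$, $jil$, and a holonomy representation $\rho:\pi_1(S_1)\to PSL(2,\mathbb{C})$ with $z\circ\gamma=\rho(\gamma)\circ z$.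 It induces a complex projective structure on $S_1$ with holonomy $\rho$ (by gluing the circumdisks of the triangles). $X$ induces a Euclidean torus if, after a Möbius normalization, $\rho$ consists of translations; $X^\dagger$ is the unique such element of $P(\Theta)$. For $X\neq X^\dagger$, one can normalize so that $\rho(\gamma_r)(z)=\alpha_rz$ for generators $\gamma_1,\gamma_2$ of $\pi_1(S_1)$, and it is known (Rivin) that $A_r=\log|\alpha_r|$, $r=1,2$, can be any pair $(A_1,A_2)\in\mathbb{R}^2\setminus\{(0,0)\}$ and that this pair, up to $(A_1,A_2)\sim(-A_1,-A_2)$, parametrizes $P(\Theta)-\{X^\dagger\}$; thus $P(\Theta)-\{X^\dagger\}$ is a smooth surface with local coordinates $(A_1,A_2)$. **Teichmüller space of the punctured torus.** $\operatorname{Teich}(S_{1,n})$ is the space of marked complete hyperbolic metrics with cusps at the $n$ punctures. Using the ideal triangulation $(V,E,F)$, it is identified with the set of functions $Y:E\to\mathbb{R}_{>0}$ such that $\prod_jY_{ij}=1$ around every vertex $i$ ($\log Y_{ij}$ being the shear coordinate). Tangent vectors are identified with logarithmic derivatives $x=\frac{d}{dt}\log Y^{(t)}|_{t=0}$, so that $$T_Y\operatorname{Teich}(S_{1,n})\cong W:=\{x\in\mathbb{R}^E:\ \sum_jx_{ij}=0\ \ \forall i\in V\}.$$ Via $\tilde f(X)=|X|$ (where $|X|_{ij}=|X_{ij}|$), $T_XP(\Theta)$ is a 2-dimensional subspace of $W$ for $X\neq X^\dagger$. **Weil–Petersson form.** The linear map $h:\mathbb{R}^E\to W$, $h(a)_{ij}=a_{ki}-a_{il}+a_{lj}-a_{jk}$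 (where $ijk$, $jil$ are the positively oriented triangles sharing the edge $ij$) is surjective. For $x,\tilde x\in W$, choose $a\in h^{-1}(x)$, $\tilde a\in h^{-1}(\tilde x)$; then (Penner) $$\omega_P(x,\tilde x)=-2\sum_{ijk\in F}\Big(a_{ij}(\tilde a_{jk}-\tilde a_{ki})+a_{jk}(\tilde a_{ki}-\tilde a_{ij})+a_{ki}(\tilde a_{ij}-\tilde a_{jk})\Big),$$ with faces $ijk$ listed consistently with the orientation; this is independent of the choices of $a,\tilde a$. The pullback is $\tilde f^*\omega_P(x,\tilde x)=\omega_P(x,\tilde x)$ for $x,\tilde x\in T_XP(\Theta)\subset W$. *)

theory Defs
  imports "HOL-Analysis.Analysis" "HOL-Combinatorics.Orbits"
begin

section \<open>Triangulated surfaces as maps on darts\<close>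

text \<open>
  A dart is an oriented edge. A dart \<open>d\<close> from \<open>i\<close> to \<open>j\<close> lies in the boundary of the positively
  oriented triangle \<open>ijk\<close> on its left: \<open>nxt M d\<close> is the dart from \<open>j\<close> to \<open>k\<close> of that triangle,
  and \<open>opp M d\<close> is the same edge traversed from \<open>j\<close> to \<open>i\<close>. Loops and multiple edges are allowed.
  If \<open>jil\<close> is the triangle on the right of \<open>d\<close>, then \<open>nxt M (opp M d)\<close> goes from \<open>i\<close> to \<open>l\<close>, so it
  follows \<open>d\<close> in clockwise order around \<open>i\<close>.
\<close>

record 'd dart_map =
  nxt :: "'d \<Rightarrow> 'd"
  opp :: "'d \<Rightarrow> 'd"

definition cw :: "'d dart_map \<Rightarrow> 'd \<Rightarrow> 'd" where
  "cw M d = nxt M (opp M d)"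

text \<open>
  A vertex is represented by the set of darts emanating from it, a face by the set of its three
  boundary darts, an unoriented edge by its two darts. The darts at a vertex of the surface
  correspond to the edges at any lift of it to the universal cover, so sums and products over a
  vertex count a loop twice.
\<close>

definition org :: "'d dart_map \<Rightarrow> 'd \<Rightarrow> 'd set" where
  "org M d = orbit (cw M) d"

definition tgt :: "'d dart_map \<Rightarrow> 'd \<Rightarrow> 'd set" where
  "tgt M d = org M (opp M d)"

definition face :: "'d dart_map \<Rightarrow> 'd \<Rightarrow> 'd set" where
  "face M d = orbit (nxt M) d"

definition edge :: "'d dart_map \<Rightarrow> 'd \<Rightarrow> 'd set" where
  "edge M d = {d, opp M d}"

definition verts :: "'d dart_map \<Rightarrow> 'd set set" where
  "verts M = range (org M)"

definition faces :: "'d dart_map \<Rightarrow> 'd set set" where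
  "faces M = range (face M)"

definition edges :: "'d dart_map \<Rightarrow> 'd set set" where
  "edges M = range (edge M)"

text \<open>
  Gluing the triangles along the edges gives a closed oriented surface; it is the torus iff it is
  connected with Euler characteristic 0.
\<close>

definition torus_triangulation :: "'d::finite dart_map \<Rightarrow> bool" where
  "torus_triangulation M \<longleftrightarrow>
     (\<forall>d. opp M (opp M d) = d \<and> opp M d \<noteq> d) \<and>
     (\<forall>d. nxt M (nxt M (nxt M d)) = d \<and> nxt M d \<noteq> d) \<and>
     (\<forall>d d'. (d, d') \<in> ({(e, nxt M e) | e. True} \<union> {(e, opp M e) | e. True})\<^sup>*) \<and>
     int (card (verts M)) - int (card (edges M)) + int (card (faces M)) = 0"

text \<open>Functions on unoriented edges are functions on darts with \<open>f\<^sub>i\<^sub>j = f\<^sub>j\<^sub>i\<close>.\<close>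

definition edge_functions :: "'d dart_map \<Rightarrow> ('d \<Rightarrow> 'a) set" where
  "edge_functions M = {f. \<forall>d. f (opp M d) = f d}"


section \<open>Edge paths, fundamental group and universal cover\<close>

primrec path_from :: "'d dart_map \<Rightarrow> 'd set \<Rightarrow> 'd list \<Rightarrow> bool" where
  "path_from M v [] \<longleftrightarrow> True"
| "path_from M v (d # p) \<longleftrightarrow> org M d = v \<and> path_from M (tgt M d) p"

primrec path_end :: "'d dart_map \<Rightarrow> 'd set \<Rightarrow> 'd list \<Rightarrow> 'd set" where
  "path_end M v [] = v"
| "path_end M v (d # p) = path_end M (tgt M d) p"

text \<open>
  Edge-path homotopy, for paths starting at the base vertex \<open>org M b\<close>: removing or inserting
  a backtracking pair or the boundary of a triangle.
\<close>

inductive elementary_homotopy :: "'d dart_map \<Rightarrow> 'd \<Rightarrow> 'd list \<Rightarrow> 'd list \<Rightarrow> bool"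
  for M b where
  backtrack: "path_from M (org M b) (p @ [d, opp M d] @ q) \<Longrightarrow>
     elementary_homotopy M b (p @ [d, opp M d] @ q) (p @ q)"
| triangle: "path_from M (org M b) (p @ [d, nxt M d, nxt M (nxt M d)] @ q) \<Longrightarrow>
     elementary_homotopy M b (p @ [d, nxt M d, nxt M (nxt M d)] @ q) (p @ q)"

definition homotopic_paths_from :: "'d dart_map \<Rightarrow> 'd \<Rightarrow> 'd list \<Rightarrow> 'd list \<Rightarrow> bool" where
  "homotopic_paths_from M b =
     (\<lambda>p q. elementary_homotopy M b p q \<or> elementary_homotopy M b q p)\<^sup>*\<^sup>*"

definition hclass :: "'d dart_map \<Rightarrow> 'd \<Rightarrow> 'd list \<Rightarrow> 'd list set" where
  "hclass M b p = {q. homotopic_paths_from M b p q}"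

definition based_loops :: "'d dart_map \<Rightarrow> 'd \<Rightarrow> 'd list set" where
  "based_loops M b = {g. path_from M (org M b) g \<and> path_end M (org M b) g = org M b}"

text \<open>
  The universal cover: its vertices are the homotopy classes of edge paths starting at the base
  vertex, and the lifted dart \<open>(c, d)\<close> starts at \<open>c\<close> and projects to \<open>d\<close>. The loop \<open>g\<close> acts as a
  deck transformation by sending the class of \<open>p\<close> to the class of \<open>g @ p\<close>.
\<close>

definition lifted_verts :: "'d dart_map \<Rightarrow> 'd \<Rightarrow> 'd list set set" where
  "lifted_verts M b = {hclass M b p | p. path_from M (org M b) p}"

definition lifted_darts :: "'d dart_map \<Rightarrow> 'd \<Rightarrow> ('d list set \<times> 'd) set" where
  "lifted_darts M b =
     {(hclass M b p, d) | p d. path_from M (org M b) p \<and> path_end M (org M b) p = org M d}"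

definition class_snoc :: "'d dart_map \<Rightarrow> 'd \<Rightarrow> 'd list set \<Rightarrow> 'd \<Rightarrow> 'd list set" where
  "class_snoc M b c d = (\<Union>p\<in>c. hclass M b (p @ [d]))"

definition universal_cover :: "'d dart_map \<Rightarrow> 'd \<Rightarrow> ('d list set \<times> 'd) dart_map" where
  "universal_cover M b =
     \<lparr> nxt = (\<lambda>(c, d). (class_snoc M b c d, nxt M d)),
       opp = (\<lambda>(c, d). (class_snoc M b c d, opp M d)) \<rparr>"


section \<open>Delaunay angle structures\<close>

text \<open>
  A closed dual path is given by the darts it crosses: the dual edge of \<open>d\<close> goes from the face on
  the left of \<open>d\<close> to the face on its right. It is simple if it visits no face and no dual edge twice.
\<close>

definition closed_dual_path :: "'d dart_map \<Rightarrow> 'd list \<Rightarrow> bool" where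
  "closed_dual_path M p \<longleftrightarrow> p \<noteq> [] \<and>
     (\<forall>i<length p. face M (opp M (p ! i)) = face M (p ! (Suc i mod length p)))"

definition simple_closed_dual_path :: "'d dart_map \<Rightarrow> 'd list \<Rightarrow> bool" where
  "simple_closed_dual_path M p \<longleftrightarrow>
     closed_dual_path M p \<and> distinct (map (face M) p) \<and> distinct (map (edge M) p)"

text \<open>A closed dual path is contractible iff it has a closed lift to the universal cover.\<close>

definition closed_lift :: "'d dart_map \<Rightarrow> 'd \<Rightarrow> 'd list \<Rightarrow> ('d list set \<times> 'd) list \<Rightarrow> bool" where
  "closed_lift M b p P \<longleftrightarrow>
     set P \<subseteq> lifted_darts M b \<and> map snd P = p \<and> closed_dual_path (universal_cover M b) P"

text \<open>
  The lift is a simple closed curve in the plane. It crosses each edge at most once, so the edges it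
  crosses are exactly those joining an enclosed vertex to a vertex that is not enclosed. Since the
  plane has infinitely many lifted vertices, this determines the finite set of enclosed vertices.
\<close>

definition encloses ::
    "'d dart_map \<Rightarrow> 'd \<Rightarrow> ('d list set \<times> 'd) list \<Rightarrow> 'd list set set \<Rightarrow> bool" where
  "encloses M b P U \<longleftrightarrow> finite U \<and> U \<subseteq> lifted_verts M b \<and>
     (\<forall>e\<in>lifted_darts M b.
        edge (universal_cover M b) e \<in> edge (universal_cover M b) ` set P \<longleftrightarrow>
        (fst e \<in> U) \<noteq> (fst (opp (universal_cover M b) e) \<in> U))"

definition delaunay_angle_structure :: "'d::finite dart_map \<Rightarrow> 'd \<Rightarrow> ('d \<Rightarrow> real) \<Rightarrow> bool" where
  "delaunay_angle_structure M b \<Theta> \<longleftrightarrow>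
     \<Theta> \<in> edge_functions M \<and>
     (\<forall>d. 0 \<le> \<Theta> d \<and> \<Theta> d < pi) \<and>
     (\<forall>v\<in>verts M. (\<Sum>d\<in>v. \<Theta> d) = 2 * pi) \<and>
     (\<forall>p P. simple_closed_dual_path M p \<and> closed_lift M b p P \<and>
        \<not> (\<exists>U. encloses M b P U \<and> card U = 1) \<longrightarrow>
        (\<Sum>d\<leftarrow>p. \<Theta> d) > 2 * pi)"


section \<open>Cross ratio systems and their developing maps\<close>

text \<open>
  The edges around the origin of \<open>d\<close> in clockwise order, starting with \<open>d\<close>, are
  \<open>(cw M ^^ j) d\<close> for \<open>j < r\<close>; every edge is allowed as starting point of the numbering.
\<close>

definition cross_ratio_system :: "'d::finite dart_map \<Rightarrow> ('d \<Rightarrow> complex) \<Rightarrow> bool" where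
  "cross_ratio_system M X \<longleftrightarrow>
     X \<in> edge_functions M \<and>
     (\<forall>d. (let r = card (org M d); x = (\<lambda>j. X ((cw M ^^ j) d)) in
        (\<Prod>j<r. x j) = 1 \<and> (\<Sum>m<r. \<Prod>j\<le>m. x j) = 0))"

text \<open>The space \<open>P(\<Theta>)\<close>.\<close>

definition circle_patterns :: "'d::finite dart_map \<Rightarrow> ('d \<Rightarrow> real) \<Rightarrow> ('d \<Rightarrow> complex) set" where
  "circle_patterns M \<Theta> =
     {X. cross_ratio_system M X \<and> (\<forall>d. X d \<noteq> 0 \<and> Im (Ln (X d)) = \<Theta> d)}"

text \<open>
  The Riemann sphere, with \<open>None\<close> as the point at infinity. In homogeneous coordinates
  \<open>[z : 1]\<close> and \<open>[1 : 0]\<close> the difference \<open>z - w\<close> becomes a \<open>2 \<times> 2\<close> determinant. Each point occurs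
  once in the numerator and once in the denominator of the cross ratio, so the cross ratio is
  independent of the scaling of the homogeneous coordinates.
\<close>

type_synonym sphere = "complex option"

fun homog :: "sphere \<Rightarrow> complex \<times> complex" where
  "homog (Some z) = (z, 1)"
| "homog None = (1, 0)"

definition of_homog :: "complex \<times> complex \<Rightarrow> sphere" where
  "of_homog u = (if snd u = 0 then None else Some (fst u / snd u))"

definition sphere_diff :: "sphere \<Rightarrow> sphere \<Rightarrow> complex" where
  "sphere_diff p q = fst (homog p) * snd (homog q) - fst (homog q) * snd (homog p)"

definition moebius :: "(sphere \<Rightarrow> sphere) \<Rightarrow> bool" where
  "moebius m \<longleftrightarrow> (\<exists>a b c d. a * d - b * c \<noteq> 0 \<and>
     m = (\<lambda>p. of_homog (a * fst (homog p) + b * snd (homog p),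
                         c * fst (homog p) + d * snd (homog p))))"

definition translation :: "complex \<Rightarrow> sphere \<Rightarrow> sphere" where
  "translation c = map_option (\<lambda>z. z + c)"

definition edge_cross_ratio :: "sphere \<Rightarrow> sphere \<Rightarrow> sphere \<Rightarrow> sphere \<Rightarrow> complex" where
  "edge_cross_ratio zi zj zk zl =
     - (sphere_diff zk zi * sphere_diff zl zj) / (sphere_diff zi zl * sphere_diff zj zk)"

text \<open>
  For nonzero \<open>X\<close> the equation below forces all four differences to be nonzero, since
  \<open>x / 0 = 0\<close>.
\<close>

definition developing_map ::
    "'d dart_map \<Rightarrow> 'd \<Rightarrow> ('d \<Rightarrow> complex) \<Rightarrow> ('d list set \<Rightarrow> sphere) \<Rightarrow> bool" where
  "developing_map M b X z \<longleftrightarrow>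
     (\<forall>p d. path_from M (org M b) p \<and> path_end M (org M b) p = org M d \<longrightarrow>
        X d = edge_cross_ratio
                (z (hclass M b p)) (z (hclass M b (p @ [d])))
                (z (hclass M b (p @ [d, nxt M d]))) (z (hclass M b (p @ [nxt M (opp M d)]))))"

definition holonomy ::
    "'d dart_map \<Rightarrow> 'd \<Rightarrow> ('d list set \<Rightarrow> sphere) \<Rightarrow> ('d list set \<Rightarrow> sphere \<Rightarrow> sphere) \<Rightarrow> bool" where
  "holonomy M b z \<rho> \<longleftrightarrow>
     (\<forall>g\<in>based_loops M b. moebius (\<rho> (hclass M b g)) \<and>
        (\<forall>p. path_from M (org M b) p \<longrightarrow>
           z (hclass M b (g @ p)) = \<rho> (hclass M b g) (z (hclass M b p))))"

definition induces_euclidean_torus :: "'d dart_map \<Rightarrow> 'd \<Rightarrow> ('d \<Rightarrow> complex) \<Rightarrow> bool" where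
  "induces_euclidean_torus M b X \<longleftrightarrow>
     (\<exists>z \<rho> m. developing_map M b X z \<and> holonomy M b z \<rho> \<and> moebius m \<and>
        (\<forall>g\<in>based_loops M b. \<exists>c. m \<circ> \<rho> (hclass M b g) \<circ> inv m = translation c))"

definition is_euclidean_point ::
    "'d::finite dart_map \<Rightarrow> 'd \<Rightarrow> ('d \<Rightarrow> real) \<Rightarrow> ('d \<Rightarrow> complex) \<Rightarrow> bool" where
  "is_euclidean_point M b \<Theta> X\<^sub>0 \<longleftrightarrow>
     X\<^sub>0 \<in> circle_patterns M \<Theta> \<and> induces_euclidean_torus M b X\<^sub>0 \<and>
     (\<forall>Y\<in>circle_patterns M \<Theta>. induces_euclidean_torus M b Y \<longrightarrow> Y = X\<^sub>0)"


section \<open>Teichmueller space and the Weil-Petersson form\<close>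

definition Teich :: "'d::finite dart_map \<Rightarrow> ('d \<Rightarrow> real) set" where
  "Teich M = {Y \<in> edge_functions M. (\<forall>d. Y d > 0) \<and> (\<forall>v\<in>verts M. (\<Prod>d\<in>v. Y d) = 1)}"

definition Teich_tangent :: "'d::finite dart_map \<Rightarrow> ('d \<Rightarrow> real) set" where
  "Teich_tangent M = {x \<in> edge_functions M. \<forall>v\<in>verts M. (\<Sum>d\<in>v. x d) = 0}"

definition abs_embedding :: "('d \<Rightarrow> complex) \<Rightarrow> 'd \<Rightarrow> real" where
  "abs_embedding X = (\<lambda>d. cmod (X d))"

text \<open>
  Tangent vectors of \<open>P(\<Theta>)\<close> at \<open>X\<close>, viewed inside \<^term>\<open>Teich_tangent M\<close> via \<open>X \<mapsto> \<bar>X\<bar>\<close>: velocities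
  (logarithmic derivatives) at time 0 of curves in \<open>P(\<Theta>)\<close> through \<open>X\<close>.
\<close>

definition pattern_tangent ::
    "'d::finite dart_map \<Rightarrow> ('d \<Rightarrow> real) \<Rightarrow> ('d \<Rightarrow> complex) \<Rightarrow> ('d \<Rightarrow> real) set" where
  "pattern_tangent M \<Theta> X =
     {x. \<exists>\<gamma> :: real \<Rightarrow> 'd \<Rightarrow> complex. (\<forall>t. \<gamma> t \<in> circle_patterns M \<Theta>) \<and> \<gamma> 0 = X \<and>
        (\<forall>d. ((\<lambda>t. ln (abs_embedding (\<gamma> t) d)) has_real_derivative x d) (at 0))}"

text \<open>The map \<open>X \<mapsto> \<bar>X\<bar>\<close> takes values in Teichmueller space, and its differential in the tangent space:\<close>

lemma bij_betw_cw_org: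
  fixes M :: "'d::finite dart_map"
  assumes "torus_triangulation M"
  shows "bij_betw (\<lambda>j. (cw M ^^ j) d) {..<card (org M d)} (org M d)"
proof -
  have opp: "opp M (opp M e) = e" and nxt: "nxt M (nxt M (nxt M e)) = e" for e
    using assms by (auto simp: torus_triangulation_def)
  have "inj (cw M)"
    by (rule injI) (metis cw_def opp nxt)
  then have "permutation (cw M)"
    by (simp add: permutation finite_UNIV_inj_surj bij_def)
  then have self: "d \<in> orbit (cw M) d"
    by (rule permutation_self_in_orbit)
  let ?r = "funpow_dist1 (cw M) d d"
  have "bij_betw (\<lambda>j. (cw M ^^ j) d) {..<?r} (org M d)"
    unfolding bij_betw_def org_def lessThan_atLeast0
    using inj_on_funpow_dist1[OF self] orbit_conv_funpow_dist1[OF self] by simp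
  moreover from this have "card (org M d) = ?r"
    using bij_betw_same_card by fastforce
  ultimately show ?thesis by simp
qed

lemma abs_embedding_in_Teich:
  fixes M :: "'d::finite dart_map"
  assumes "torus_triangulation M" and "X \<in> circle_patterns M \<Theta>"
  shows "abs_embedding X \<in> Teich M"
proof -
  have X: "cross_ratio_system M X" and nz: "X d \<noteq> 0" for d
    using assms(2) by (auto simp: circle_patterns_def)
  have "(\<Prod>e\<in>org M d. cmod (X e)) = 1" for d
  proof -
    have "(\<Prod>e\<in>org M d. X e) = (\<Prod>j<card (org M d). X ((cw M ^^ j) d))"
      by (rule prod.reindex_bij_betw[OF bij_betw_cw_org[OF assms(1)], symmetric])
    also have "\<dots> = 1"
      using X by (simp add: cross_ratio_system_def Let_def)
    finally show ?thesis
      by (metis norm_one prod_norm)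
  qed
  with X nz show ?thesis
    by (auto simp: Teich_def abs_embedding_def verts_def cross_ratio_system_def edge_functions_def)
qed

lemma pattern_tangent_subset:
  fixes M :: "'d::finite dart_map"
  assumes "torus_triangulation M"
  shows "pattern_tangent M \<Theta> X \<subseteq> Teich_tangent M"
proof
  fix x assume "x \<in> pattern_tangent M \<Theta> X"
  then obtain \<gamma> where g: "\<And>t::real. \<gamma> t \<in> circle_patterns M \<Theta>"
    and D: "\<And>d. ((\<lambda>t. ln (abs_embedding (\<gamma> t) d)) has_real_derivative x d) (at 0)"
    unfolding pattern_tangent_def by blast
  have T: "abs_embedding (\<gamma> t) \<in> Teich M" for t
    using abs_embedding_in_Teich[OF assms g] .
  have "x (opp M d) = x d" for d
  proof -
    have "(\<lambda>t. ln (abs_embedding (\<gamma> t) (opp M d))) = (\<lambda>t. ln (abs_embedding (\<gamma> t) d))"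
      using T by (auto simp: Teich_def edge_functions_def)
    then show ?thesis using D[of d] D[of "opp M d"] DERIV_unique by metis
  qed
  moreover have "(\<Sum>d\<in>v. x d) = 0" if v: "v \<in> verts M" for v
  proof -
    have "(\<Sum>d\<in>v. ln (abs_embedding (\<gamma> t) d)) = 0" for t
    proof -
      have "abs_embedding (\<gamma> t) d \<noteq> 0" for d
        using T[of t] by (simp add: Teich_def less_imp_neq[THEN not_sym])
      then show ?thesis
        using T[of t] v by (subst ln_prod[symmetric]) (simp_all add: Teich_def)
    qed
    moreover have "((\<lambda>t. \<Sum>d\<in>v. ln (abs_embedding (\<gamma> t) d)) has_real_derivative (\<Sum>d\<in>v. x d)) (at 0)"
      by (intro DERIV_sum D)
    ultimately show ?thesis
      using DERIV_unique[OF _ DERIV_const] by fastforce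
  qed
  ultimately show "x \<in> Teich_tangent M"
    by (auto simp: Teich_tangent_def edge_functions_def)
qed

text \<open>With \<open>d\<close> the dart \<open>ij\<close>, the four terms are \<open>a\<^sub>k\<^sub>i\<close>, \<open>a\<^sub>i\<^sub>l\<close>, \<open>a\<^sub>l\<^sub>j\<close>, \<open>a\<^sub>j\<^sub>k\<close>.\<close>

definition penner_h :: "'d dart_map \<Rightarrow> ('d \<Rightarrow> real) \<Rightarrow> 'd \<Rightarrow> real" where
  "penner_h M a d =
     a (nxt M (nxt M d)) - a (nxt M (opp M d)) + a (nxt M (nxt M (opp M d))) - a (nxt M d)"

text \<open>The inner sum runs over the three edges of a face and gives the three terms of the face.\<close>

definition penner_form :: "'d::finite dart_map \<Rightarrow> ('d \<Rightarrow> real) \<Rightarrow> ('d \<Rightarrow> real) \<Rightarrow> real" where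
  "penner_form M a a' =
     - 2 * (\<Sum>f\<in>faces M. \<Sum>d\<in>f. a d * (a' (nxt M d) - a' (nxt M (nxt M d))))"

definition weil_petersson :: "'d::finite dart_map \<Rightarrow> ('d \<Rightarrow> real) \<Rightarrow> ('d \<Rightarrow> real) \<Rightarrow> real" where
  "weil_petersson M x x' =
     penner_form M (SOME a. a \<in> edge_functions M \<and> penner_h M a = x)
                   (SOME a. a \<in> edge_functions M \<and> penner_h M a = x')"

definition nondegenerate_on :: "('d \<Rightarrow> real) set \<Rightarrow> (('d \<Rightarrow> real) \<Rightarrow> ('d \<Rightarrow> real) \<Rightarrow> real) \<Rightarrow> bool" where
  "nondegenerate_on T \<omega> \<longleftrightarrow> (\<forall>x\<in>T. (\<forall>y\<in>T. \<omega> x y = 0) \<longrightarrow> x = (\<lambda>_. 0))"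

end

theory Submission
  imports Defs
begin

text \<open>
  A fixed point of the holonomy of \<open>X\<close>, seen from the triangles, is a flat section \<open>Q\<close> of the sphere
  bundle over the faces. A count of angles (Gauss-Bonnet) puts it strictly outside all closed
  circumdisks, so that \<open>X\<close> comes from an affine structure in which the triangle on the left of \<open>d\<close>
  has the angle \<open>Arg (Q d)\<close> opposite to \<open>d\<close>. It exists because the fundamental group is abelian:
  cutting the torus open leaves a single relation between two generators. The Euclidean point enters
  here through its area form, which rules out the pairing of sides of a sphere, and through its
  angles, which rule out degenerate triangles.

  Tangent vectors of \<open>P(\<Theta>)\<close> then correspond to closed forms \<open>\<beta>\<close>, the variations of the angles, that
  are harmonic for the cotangent weights. Let \<open>\<sigma>\<close> be the closed form given by the variation of the
  scale at the vertices and write \<open>\<langle>\<cdot>, \<cdot>\<rangle>\<close> for the intersection pairing. Up to constants, the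
  Weil-Petersson form is \<open>\<langle>\<beta>, \<beta>'\<rangle> - \<langle>\<sigma>, \<sigma>'\<rangle>\<close>, while the cotangent energy is
  \<open>E(\<beta>, \<beta>') = \<langle>\<sigma>, \<beta>'\<rangle>\<close>. As the first cohomology is two-dimensional, the Pluecker relation turns
  \<open>\<omega> = 0\<close> into \<open>\<langle>\<beta>, \<beta>'\<rangle>\<^sup>2 = E(\<beta>, \<beta>) E(\<beta>', \<beta>') - E(\<beta>, \<beta>')\<^sup>2\<close>. This is the equality case of the
  inequality between area and Dirichlet energy of a piecewise linear map, so a suitable complex
  combination of \<open>\<beta>\<close> and \<open>\<beta>'\<close> is complex linear on every triangle. It integrates to a developing map
  whose holonomy consists of translations, whence \<open>X = X\<^sup>\<dagger>\<close>.
\<close>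

text \<open>Two commuting elements of PSL(2,C) need not share a fixed point: they may generate a
  Klein four-group. So the holonomy of a pattern \<open>Y\<close> is first lifted to linear maps of
  C^2, where commuting does give a common eigenvector. The lift is built from antisymmetric complex
  edge lengths with cross ratios \<open>Y\<close>. At the Euclidean point the edge vectors
  \<open>F\<close> are such lengths. All patterns in P(\<Theta>) have the same arguments, so
  \<open>Y\<close> differs from the Euclidean pattern by a positive factor, and surjectivity of
  \<open>penner_h\<close> turns it into positive factors on \<open>F\<close>.

  The fixed point need not be unique, and a curve representing a tangent vector is only assumed
  differentiable at time 0. Compactness of the sphere and difference quotients along sequences
  replace a smooth choice of fixed points.

  Cotangents are negative at obtuse angles, so the energy may be indefinite on functions of darts.
  Positivity arguments go through closed forms, where every triangle contributes a nonnegative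
  Dirichlet energy.\<close>

lemma sum_over_classes:
  fixes g :: "'a::finite \<Rightarrow> 'a set" and f :: "'a \<Rightarrow> 'b::comm_monoid_add"
  assumes self: "\<And>x. x \<in> g x" and eq: "\<And>x y. y \<in> g x \<Longrightarrow> g y = g x"
  shows "(\<Sum>A\<in>range g. \<Sum>x\<in>A. f x) = (\<Sum>x\<in>UNIV. f x)"
proof -
  have "\<Union> (range g) = UNIV" using self by auto
  moreover have "sum f (\<Union> (range g)) = (\<Sum>A\<in>range g. \<Sum>x\<in>A. f x)"
    by (subst sum.Union_disjoint) (auto, (metis eq)+)
  ultimately show ?thesis by simp
qed

lemma card_classes:
  fixes g :: "'a::finite \<Rightarrow> 'a set"
  assumes self: "\<And>x. x \<in> g x" and eq: "\<And>x y. y \<in> g x \<Longrightarrow> g y = g x"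
    and card: "\<And>x. card (g x) = k"
  shows "CARD('a) = k * card (range g)"
proof -
  have "CARD('a) = (\<Sum>A\<in>range g. \<Sum>x\<in>A. 1)"
    using sum_over_classes[of g "\<lambda>_. 1::nat", OF self eq] by simp
  also have "\<dots> = (\<Sum>A\<in>range g. k)"
    by (rule sum.cong) (auto simp: card)
  finally show ?thesis by simp
qed

section \<open>Darts, vertices and faces of a triangulated torus\<close>

locale torus =
  fixes M :: "'d::finite dart_map"
  assumes torus: "torus_triangulation M"
begin

abbreviation nx :: "'d \<Rightarrow> 'd" where "nx \<equiv> nxt M"
abbreviation rv :: "'d \<Rightarrow> 'd" where "rv \<equiv> opp M"

lemma rv_rv [simp]: "rv (rv d) = d" and rv_neq [simp]: "rv d \<noteq> d" "d \<noteq> rv d"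
  and nx3 [simp]: "nx (nx (nx d)) = d" and nx_neq [simp]: "nx d \<noteq> d" "d \<noteq> nx d"
  using torus by (auto simp: torus_triangulation_def) metis+

lemma nx2_neq [simp]: "nx (nx d) \<noteq> d" "d \<noteq> nx (nx d)"
  by (metis nx3 nx_neq(1))+

lemma bij_rv: "bij rv" by (rule involuntory_imp_bij) simp
lemma bij_nx: "bij nx" by (rule o_bij[where g="\<lambda>d. nx (nx d)"]) auto

lemma rv_eq_iff [simp]: "rv d = rv e \<longleftrightarrow> d = e" by (metis rv_rv)
lemma nx_eq_iff [simp]: "nx d = nx e \<longleftrightarrow> d = e" by (metis nx3)

lemma sum_rv: "(\<Sum>d\<in>UNIV. f (rv d)) = (\<Sum>d\<in>UNIV. f d)"
  by (rule sum.reindex_bij_betw[OF bij_rv])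
lemma sum_nx: "(\<Sum>d\<in>UNIV. f (nx d)) = (\<Sum>d\<in>UNIV. f d)"
  by (rule sum.reindex_bij_betw[OF bij_nx])

lemma dart_induct:
  assumes "K d0" and "\<And>d. K d \<Longrightarrow> K (nx d)" and "\<And>d. K d \<Longrightarrow> K (rv d)"
  shows "K d"
proof -
  have "(d0, d) \<in> ({(e, nx e) | e. True} \<union> {(e, rv e) | e. True})\<^sup>*"
    using torus by (auto simp: torus_triangulation_def)
  then show ?thesis by (induction rule: rtrancl_induct) (use assms in auto)
qed

lemma bij_cw: "bij (cw M)"
proof -
  have "cw M = nx \<circ> rv" by (auto simp: cw_def)
  then show ?thesis using bij_comp[OF bij_rv bij_nx] by simp
qed

lemma permutation_cw: "permutation (cw M)"
  by (simp add: permutation bij_cw)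

lemma self_org [simp]: "d \<in> org M d"
  unfolding org_def by (rule permutation_self_in_orbit[OF permutation_cw])

lemma org_eq: "e \<in> org M d \<Longrightarrow> org M e = org M d"
  unfolding org_def
  by (metis orbit_cyclic_eq3 cyclic_on_orbit' permutation_cw)

lemma org_eq_iff: "e \<in> org M d \<longleftrightarrow> org M e = org M d"
  using org_eq self_org by metis

lemma org_cw [simp]: "org M (cw M d) = org M d"
  by (rule org_eq) (auto simp: org_def intro: orbit.base)

lemma org_nx [simp]: "org M (nx d) = org M (rv d)"
  using org_cw[of "rv d"] by (simp add: cw_def)

lemma org_rv_nx_nx [simp]: "org M (rv (nx (nx d))) = org M d"
  using org_cw[of "rv (nx (nx d))"] by (simp add: cw_def)

lemma tgt_simps [simp]: "tgt M d = org M (rv d)"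
  by (simp add: tgt_def)

lemma bij_betw_ccw: "bij_betw (\<lambda>e. rv (nx (nx e))) (org M d) (org M d)"
  by (rule bij_betwI[where g="\<lambda>e. nx (rv e)"]) (auto simp: org_eq_iff)

text \<open>\<open>rv (nx (nx e))\<close> is the counterclockwise neighbour of \<open>e\<close>
  around their common origin. Reindexing by this rotation moves a quantity from the triangle on the
  right of \<open>e\<close> to the one on its left.\<close>

lemma sum_org_rv: "(\<Sum>e\<in>org M d. f (rv e)) = (\<Sum>e\<in>org M d. f (nx (nx e)))"
  using sum.reindex_bij_betw[OF bij_betw_ccw, of "\<lambda>e. f (rv e)" d] by simp

lemma prod_org_rv: "(\<Prod>e\<in>org M d. f (rv e)) = (\<Prod>e\<in>org M d. f (nx (nx e)))"
  using prod.reindex_bij_betw[OF bij_betw_ccw, of "\<lambda>e. f (rv e)" d] by simp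

lemma org_conv_funpow: "org M d = {(cw M ^^ m) d | m. True}"
  unfolding org_def by (rule orbit_altdef_permutation[OF permutation_cw])

lemma const_on_org:
  assumes "\<And>d. s (cw M d) = s d" and "e \<in> org M d"
  shows "s e = s d"
proof -
  have "s ((cw M ^^ m) d) = s d" for m by (induction m) (auto simp: assms(1))
  then show ?thesis using assms(2) unfolding org_conv_funpow by auto
qed

lemma face_eq: "face M d = {d, nx d, nx (nx d)}"
proof
  show "face M d \<subseteq> {d, nx d, nx (nx d)}"
  proof
    fix x assume "x \<in> face M d"
    then show "x \<in> {d, nx d, nx (nx d)}"
      unfolding face_def by (induction rule: orbit.induct) auto
  qed
  show "{d, nx d, nx (nx d)} \<subseteq> face M d"
    unfolding face_def
    using orbit.base[of nx d] orbit.step[OF orbit.base, of nx d]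
      orbit.step[OF orbit.step[OF orbit.base], of nx d] by simp
qed

lemma self_face [simp]: "d \<in> face M d" by (simp add: face_eq)
lemma face_of_mem: "e \<in> face M d \<Longrightarrow> face M e = face M d" by (auto simp: face_eq)

lemma sum_face: "(\<Sum>e\<in>face M d. f e) = f d + f (nx d) + f (nx (nx d))"
  for f :: "'d \<Rightarrow> 'a::comm_monoid_add"
  by (simp add: face_eq add.assoc)

lemma sum_faces: "(\<Sum>F\<in>faces M. \<Sum>d\<in>F. f d) = (\<Sum>d\<in>UNIV. f d)"
  for f :: "'d \<Rightarrow> 'a::comm_monoid_add"
  unfolding faces_def by (rule sum_over_classes) (auto simp: face_of_mem)

lemma sum_verts: "(\<Sum>v\<in>verts M. \<Sum>d\<in>v. f d) = (\<Sum>d\<in>UNIV. f d)"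
  for f :: "'d \<Rightarrow> 'a::comm_monoid_add"
  unfolding verts_def by (rule sum_over_classes) (auto simp: org_eq)

text \<open>The Euler characteristic enters through this count: \<open>D\<close> darts make
  \<open>D/2\<close> edges and \<open>D/3\<close> faces, hence \<open>D/6\<close> vertices.\<close>

lemma card_darts: "CARD('d) = 6 * card (verts M)"
proof -
  have "CARD('d) = 2 * card (edges M)"
    unfolding edges_def by (rule card_classes) (auto simp: edge_def)
  moreover have "CARD('d) = 3 * card (faces M)"
    unfolding faces_def by (rule card_classes) (auto simp: face_of_mem, simp add: face_eq)
  moreover have "int (card (verts M)) - int (card (edges M)) + int (card (faces M)) = 0"
    using torus by (simp add: torus_triangulation_def)
  ultimately show ?thesis by simp
qed

lemma sum_face3: "3 * (\<Sum>d\<in>UNIV. f d) = (\<Sum>d\<in>UNIV. f d + f (nx d) + f (nx (nx d)))"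
  for f :: "'d \<Rightarrow> real"
  by (simp add: sum.distrib sum_nx sum_nx[of "\<lambda>d. f (nx d)"])

lemma sum_edge2: "2 * (\<Sum>d\<in>UNIV. f d) = (\<Sum>d\<in>UNIV. f d + f (rv d))"
  for f :: "'d \<Rightarrow> real"
  by (simp add: sum.distrib sum_rv)

end

section \<open>Cocycles on a triangulated torus\<close>

context torus
begin

text \<open>Stated for a group that may be non-abelian, with the summands in path order: the same
  notion covers closed 1-forms and the transition maps of a flat plane bundle over the
  vertices.\<close>

definition cocycle :: "('d \<Rightarrow> 'g::group_add) \<Rightarrow> bool" where
  "cocycle s \<longleftrightarrow> (\<forall>d. s (rv d) = - s d) \<and> (\<forall>d. s d + s (nx d) + s (nx (nx d)) = 0)"

text \<open>A change of frame at the vertices. For abelian values it subtracts an exact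
  form.\<close>

definition gauge :: "('d set \<Rightarrow> 'g::group_add) \<Rightarrow> ('d \<Rightarrow> 'g) \<Rightarrow> 'd \<Rightarrow> 'g" where
  "gauge g s d = g (org M d) + s d - g (org M (rv d))"

lemma cocycle_rv: "cocycle s \<Longrightarrow> s (rv d) = - s d"
  and cocycle_face: "cocycle s \<Longrightarrow> s d + s (nx d) + s (nx (nx d)) = 0"
  by (auto simp: cocycle_def)

lemma cocycle_split: "cocycle s \<Longrightarrow> s d = s (nx (rv d)) + s (nx (nx (rv d)))"
  using cocycle_face[of s "rv d"] cocycle_rv[of s d]
  by (metis add.assoc add.inverse_inverse neg_eq_iff_add_eq_0)

lemma cocycle_third: "cocycle s \<Longrightarrow> s (nx (nx d)) = - s d - s (nx d)"
  for s :: "'d \<Rightarrow> 'g::ab_group_add"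
  using cocycle_face[of s d] by (simp add: add_eq_0_iff)

lemma cocycle_gauge: "cocycle s \<Longrightarrow> cocycle (gauge g s)"
proof -
  assume s: "cocycle s"
  have "gauge g s (rv d) = - gauge g s d" for d
    by (simp only: gauge_def cocycle_rv[OF s] rv_rv diff_conv_add_uminus minus_add minus_minus add.assoc)
  moreover have "gauge g s d + gauge g s (nx d) + gauge g s (nx (nx d)) = 0" for d
  proof -
    have "org M (rv (nx d)) = org M (nx (nx d))" by simp
    then have "gauge g s d + gauge g s (nx d) + gauge g s (nx (nx d))
       = g (org M d) + (s d + s (nx d) + s (nx (nx d))) - g (org M d)"
      by (simp only: gauge_def org_nx org_rv_nx_nx diff_conv_add_uminus add.assoc minus_add_cancel)
    then show ?thesis by (simp add: cocycle_face[OF s])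
  qed
  ultimately show ?thesis by (simp add: cocycle_def)
qed

subsection \<open>Cutting the torus open\<close>

text \<open>\<open>S\<close> collects the darts of the triangles glued so far and \<open>w\<close>
  is the boundary read as a word. Each new triangle is attached along one side only, so the result
  is always a polygon, whatever identifications its boundary still has in the surface.\<close>

inductive disk_word :: "'d set \<Rightarrow> 'd list \<Rightarrow> bool" where
  face: "disk_word (face M d) [d, nx d, nx (nx d)]"
| splice: "disk_word S (u @ d # v) \<Longrightarrow> rv d \<notin> S \<Longrightarrow>
     disk_word (S \<union> face M (rv d)) (u @ nx (rv d) # nx (nx (rv d)) # v)"

lemma disk_word_nx: "disk_word S w \<Longrightarrow> d \<in> S \<Longrightarrow> nx d \<in> S"
  by (induction rule: disk_word.induct) (auto simp: face_eq)

lemma disk_word_disjoint: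
  assumes "disk_word S w" "rv d \<notin> S" shows "S \<inter> face M (rv d) = {}"
proof -
  have "nx (rv d) \<notin> S" "nx (nx (rv d)) \<notin> S"
    using assms disk_word_nx[OF assms(1), of "nx (rv d)"] disk_word_nx[OF assms(1), of "nx (nx (rv d))"]
    by auto
  then show ?thesis using assms(2) by (auto simp: face_eq)
qed

text \<open>Gluing \<open>t\<close> triangles in this way gives a polygon with \<open>t + 2\<close>
  sides, and \<open>card S = 3 * t\<close>. The darts of \<open>S\<close> off the boundary are glued
  in pairs.\<close>

lemma disk_word_inv:
  "disk_word S w \<Longrightarrow> w \<noteq> [] \<and> distinct w \<and> set w \<subseteq> S \<and> (\<forall>d\<in>S - set w. rv d \<in> S - set w) \<and>
     3 * length w = card S + 6"
proof (induction rule: disk_word.induct)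
  case (face d)
  show ?case by (simp add: face_eq)
next
  case (splice S u d v)
  have dis: "S \<inter> face M (rv d) = {}" by (rule disk_word_disjoint[OF splice.hyps])
  have n: "nx (rv d) \<notin> S" "nx (nx (rv d)) \<notin> S"
    using dis by (auto simp: face_eq)
  have IH: "distinct (u @ d # v)" "set (u @ d # v) \<subseteq> S"
    "\<And>e. e \<in> S \<Longrightarrow> e \<notin> set (u @ d # v) \<Longrightarrow> rv e \<in> S \<and> rv e \<notin> set (u @ d # v)"
    "3 * length (u @ d # v) = card S + 6"
    using splice.IH by auto
  have "card (S \<union> face M (rv d)) = card S + 3"
    using dis by (subst card_Un_disjoint) (auto simp: face_eq)
  moreover have "rv e \<in> S \<union> face M (rv d) - set (u @ nx (rv d) # nx (nx (rv d)) # v)"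
    if "e \<in> S \<union> face M (rv d) - set (u @ nx (rv d) # nx (nx (rv d)) # v)" for e
  proof (cases "e = d \<or> e = rv d")
    case True
    then show ?thesis using IH(1,2) splice.hyps(2) n by (auto simp: face_eq)
  next
    case False
    then have "e \<in> S" "e \<notin> set (u @ d # v)" using that by (auto simp: face_eq)
    then show ?thesis using IH(3)[of e] n splice.hyps(2) by auto
  qed
  moreover have "distinct (u @ nx (rv d) # nx (nx (rv d)) # v)"
    using IH(1,2) n by auto
  moreover have "set (u @ nx (rv d) # nx (nx (rv d)) # v) \<subseteq> S \<union> face M (rv d)"
    using IH(2) by (auto simp: face_eq)
  ultimately show ?case
    using IH(4) by simp
qed

text \<open>A side that disappears from the boundary is the sum of the two sides replacing it. Going
  backwards, every value is thus generated by those on the final boundary; \<open>H\<close> stands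
  for a subgroup containing them.\<close>

lemma disk_word_closure:
  assumes "disk_word S w" and s: "cocycle s"
    and H: "\<And>x y. x \<in> H \<Longrightarrow> y \<in> H \<Longrightarrow> x + y \<in> H" "\<And>x. x \<in> H \<Longrightarrow> - x \<in> H"
    and "\<And>d. d \<in> set w \<Longrightarrow> s d \<in> H"
  shows "x \<in> S \<Longrightarrow> s x \<in> H"
  using assms(1,5)
proof (induction arbitrary: x rule: disk_word.induct)
  case (face d)
  then show ?case by (auto simp: face_eq)
next
  case (splice S u d v)
  have a: "s (nx (rv d)) \<in> H" "s (nx (nx (rv d))) \<in> H" using splice.prems by auto
  then have sd: "s d \<in> H" using cocycle_split[OF s, of d] H by metis
  then have srd: "s (rv d) \<in> H" using cocycle_rv[OF s] H by metis
  have "s e \<in> H" if "e \<in> S" for e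
    by (rule splice.IH[OF that]) (use splice.prems sd in auto)
  then show ?case using splice.prems(1) a srd by (auto simp: face_eq)
qed

text \<open>With \<open>K\<close> as membership in a set of vertices: a set that no boundary edge
  leaves is left by no edge at all. This is the source of connectedness of the boundary
  graph.\<close>

lemma disk_word_const:
  assumes "disk_word S w" and "\<And>d. d \<in> set w \<Longrightarrow> K (org M d) \<longleftrightarrow> K (org M (rv d))"
  shows "x \<in> S \<Longrightarrow> K (org M x) \<longleftrightarrow> K (org M (rv x))"
  using assms
proof (induction arbitrary: x rule: disk_word.induct)
  case (face d)
  then show ?case by (auto simp: face_eq)
next
  case (splice S u d v)
  have a: "K (org M (nx (rv d))) \<longleftrightarrow> K (org M (rv (nx (rv d))))"
    "K (org M (nx (nx (rv d)))) \<longleftrightarrow> K (org M (rv (nx (nx (rv d)))))"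
    by (rule splice.prems(2); simp)+
  then have d: "K (org M d) \<longleftrightarrow> K (org M (rv d))" by simp
  have "K (org M e) \<longleftrightarrow> K (org M (rv e))" if "e \<in> S" for e
    by (rule splice.IH[OF that]) (use splice.prems d in auto)
  then show ?case using splice.prems(1) a d by (auto simp: face_eq)
qed

lemma disk_word_sum:
  assumes "disk_word S w" and s: "cocycle s"
  shows "sum_list (map s w) = 0"
  using assms(1)
proof induction
  case (face d)
  then show ?case using cocycle_face[OF s, of d] by (simp add: add.assoc)
next
  case (splice S u d v)
  then show ?case using cocycle_split[OF s, of d] by (simp add: add.assoc)
qed

section \<open>Area forms and the intersection pairing\<close>

definition wedge :: "('d \<Rightarrow> real) \<Rightarrow> ('d \<Rightarrow> real) \<Rightarrow> 'd \<Rightarrow> real" where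
  "wedge s t d = s d * t (nx d) - t d * s (nx d)"

text \<open>\<open>wedge s t d\<close> is twice the signed area of the triangle with edge vectors
  \<open>(s, t)\<close>, and for closed forms it agrees at the three darts of a face. The sum over
  darts counts every face three times, which is the origin of the factors 3 below.\<close>

definition pairing :: "('d \<Rightarrow> real) \<Rightarrow> ('d \<Rightarrow> real) \<Rightarrow> real" where
  "pairing s t = (\<Sum>d\<in>UNIV. wedge s t d)"

text \<open>The sum of \<open>s x * t y - t x * s y\<close> over all pairs with \<open>x\<close>
  before \<open>y\<close> in the word: twice the signed area of the polygon if the word closes
  up.\<close>

primrec area :: "('d \<Rightarrow> real) \<Rightarrow> ('d \<Rightarrow> real) \<Rightarrow> 'd list \<Rightarrow> real" where
  "area s t [] = 0"
| "area s t (d # w) = s d * sum_list (map t w) - t d * sum_list (map s w) + area s t w"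

lemma area_append:
  "area s t (u @ v) = area s t u + area s t v
     + sum_list (map s u) * sum_list (map t v) - sum_list (map t u) * sum_list (map s v)"
  by (induction u) (simp_all add: algebra_simps)

lemma wedge_nx:
  assumes "cocycle s" "cocycle t" shows "wedge s t (nx d) = wedge s t d"
proof -
  show ?thesis unfolding wedge_def cocycle_third[OF assms(1)] cocycle_third[OF assms(2)]
    by (simp add: algebra_simps)
qed

lemma disk_word_area:
  assumes "disk_word S w" and s: "cocycle s" and t: "cocycle t"
  shows "3 * area s t w = (\<Sum>d\<in>S. wedge s t d)"
  using assms(1)
proof induction
  case (face d)
  have "3 * area s t [d, nx d, nx (nx d)] = 3 * wedge s t d"
    unfolding wedge_def by (simp add: cocycle_third[OF s] cocycle_third[OF t]) (simp add: algebra_simps)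
  then show ?case
    by (simp add: sum_face wedge_nx[OF s t])
next
  case (splice S u d v)
  let ?e = "nx (rv d)"
  have "(\<Sum>d\<in>S \<union> face M (rv d). wedge s t d) = (\<Sum>d\<in>S. wedge s t d) + 3 * wedge s t ?e"
    using disk_word_disjoint[OF splice.hyps]
    by (subst sum.union_disjoint) (auto simp: sum_face wedge_nx[OF s t])
  moreover have "area s t (u @ ?e # nx ?e # v) = area s t (u @ d # v) + wedge s t ?e"
    by (simp add: area_append cocycle_split[OF s, of d] cocycle_split[OF t, of d] wedge_def algebra_simps)
  ultimately show ?case using splice.IH by simp
qed

text \<open>If every boundary dart had its reverse in \<open>S\<close>, then \<open>S\<close> would
  be closed under \<open>nx\<close> and \<open>rv\<close>, and connectedness would make it
  everything.\<close>

lemma ex_disk_word: "\<exists>w. disk_word UNIV w"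
proof -
  have "disk_word S w \<Longrightarrow> \<exists>w. disk_word UNIV w" for S w
  proof (induction "card (- S)" arbitrary: S w rule: less_induct)
    case less
    show ?case
    proof (cases "S = UNIV")
      case False
      have inv: "w \<noteq> []" "set w \<subseteq> S" "\<forall>d\<in>S - set w. rv d \<in> S - set w"
        using disk_word_inv[OF less.prems] by auto
      have "\<exists>d\<in>set w. rv d \<notin> S"
      proof (rule ccontr)
        assume "\<not> ?thesis"
        then have rv: "rv d \<in> S" if "d \<in> S" for d using inv that by auto
        have "d \<in> S" for d
          by (rule dart_induct[of "\<lambda>d. d \<in> S" "hd w"])
             (use inv rv disk_word_nx[OF less.prems] in auto)
        with False show False by auto
      qed
      then obtain d where d: "d \<in> set w" "rv d \<notin> S" by blast
      then obtain u v where w: "w = u @ d # v" by (meson split_list)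
      have "card (- (S \<union> face M (rv d))) < card (- S)"
        by (rule psubset_card_mono) (use d in \<open>auto simp: face_eq\<close>)
      then show ?thesis using less.hyps disk_word.splice less.prems d w by blast
    qed (use less.prems in auto)
  qed
  then show ?thesis using disk_word.face by blast
qed

section \<open>Spanning trees and gauge fixing\<close>

inductive tree :: "'d set \<Rightarrow> 'd set set \<Rightarrow> 'd set \<Rightarrow> bool" for D where
  root: "tree D {org M d} {}"
| grow: "tree D U T \<Longrightarrow> d \<in> D \<Longrightarrow> org M d \<in> U \<Longrightarrow> org M (rv d) \<notin> U \<Longrightarrow>
     tree D (insert (org M (rv d)) U) (insert d (insert (rv d) T))"

text \<open>\<open>T\<close> contains both darts of each tree edge, so \<open>card U - 1\<close>
  edges give \<open>card T = 2 * card U - 2\<close>.\<close>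

lemma tree_inv:
  assumes "\<And>d. d \<in> D \<Longrightarrow> rv d \<in> D"
  shows "tree D U T \<Longrightarrow> T \<subseteq> D \<and> (\<forall>d\<in>T. rv d \<in> T) \<and> (\<forall>d\<in>T. org M d \<in> U) \<and>
    card T + 2 = 2 * card U \<and> U \<noteq> {} \<and> U \<subseteq> verts M"
proof (induction rule: tree.induct)
  case (grow U T d)
  then have "rv d \<notin> T" by auto
  moreover from this have "d \<notin> T" using grow by auto
  ultimately have "card (insert d (insert (rv d) T)) = card T + 2" by simp
  moreover have "card (insert (org M (rv d)) U) = card U + 1" using grow by simp
  ultimately show ?case using grow assms by (auto simp: verts_def)
qed (auto simp: verts_def)

text \<open>Transport from the root along the tree defines \<open>g\<close>. A new vertex is not yet
  met by \<open>T\<close>, so changing \<open>g\<close> there does not disturb the earlier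
  edges.\<close>

lemma tree_gauge:
  assumes s: "\<And>d. s (rv d) = - (s d :: 'g::group_add)"
  shows "tree D U T \<Longrightarrow> \<exists>g. (\<forall>d\<in>T. gauge g s d = 0) \<and> (\<forall>d\<in>T. org M d \<in> U \<and> org M (rv d) \<in> U)"
proof (induction rule: tree.induct)
  case (grow U T d)
  then obtain g where g: "\<And>d. d \<in> T \<Longrightarrow> gauge g s d = 0"
    and U: "\<And>d. d \<in> T \<Longrightarrow> org M d \<in> U \<and> org M (rv d) \<in> U" by blast
  let ?g = "g(org M (rv d) := g (org M d) + s d)"
  have ne: "org M d \<noteq> org M (rv d)" using grow.hyps by auto
  have "gauge ?g s e = 0" if "e \<in> insert d (insert (rv d) T)" for e
  proof -
    have "gauge ?g s e = 0" if "e \<in> T"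
    proof -
      have "org M e \<noteq> org M (rv d)" "org M (rv e) \<noteq> org M (rv d)"
        using U[OF that] grow.hyps(4) by metis+
      then have "gauge ?g s e = gauge g s e" unfolding gauge_def by simp
      then show ?thesis using g[OF that] by simp
    qed
    moreover have "gauge ?g s d = 0" unfolding gauge_def using ne by simp
    moreover have "gauge ?g s (rv d) = 0"
      unfolding gauge_def using ne by (simp add: s)
    ultimately show ?thesis using that by auto
  qed
  moreover have "org M e \<in> insert (org M (rv d)) U \<and> org M (rv e) \<in> insert (org M (rv d)) U"
    if "e \<in> insert d (insert (rv d) T)" for e
    using U that grow.hyps(3) by auto
  ultimately show ?case by blast
qed simp

lemma ex_spanning_tree:
  assumes w: "disk_word UNIV w"
  shows "\<exists>T. tree (set w) (verts M) T"
proof -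
  have rv: "rv d \<in> set w" if "d \<in> set w" for d
    using disk_word_inv[OF w] that by (metis DiffE DiffI UNIV_I rv_rv)
  have "tree (set w) U T \<Longrightarrow> \<exists>T. tree (set w) (verts M) T" for U T
  proof (induction "card (verts M - U)" arbitrary: U T rule: less_induct)
    case less
    have inv: "U \<noteq> {}" "U \<subseteq> verts M" using tree_inv[OF rv less.prems] by auto
    show ?case
    proof (cases "U = verts M")
      case False
      have "\<exists>d\<in>set w. org M d \<in> U \<and> org M (rv d) \<notin> U"
      proof (rule ccontr)
        assume "\<not> ?thesis"
        then have fw: "org M (rv d) \<in> U" if "d \<in> set w" "org M d \<in> U" for d
          using that by blast
        have "org M d \<in> U \<longleftrightarrow> org M (rv d) \<in> U" if "d \<in> set w" for d
          using fw[OF that] fw[OF rv[OF that]] by auto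
        then have eq: "org M d \<in> U \<longleftrightarrow> org M (rv d) \<in> U" for d
          by (rule disk_word_const[OF w]) auto
        obtain d0 where "org M d0 \<in> U" using inv by (auto simp: verts_def)
        then have "org M d \<in> U" for d
        proof (rule dart_induct)
          show "org M (nx d) \<in> U" if "org M d \<in> U" for d using that eq[of d] by simp
          show "org M (rv d) \<in> U" if "org M d \<in> U" for d using that eq[of d] by simp
        qed
        then show False using False inv by (auto simp: verts_def)
      qed
      then obtain d where d: "d \<in> set w" "org M d \<in> U" "org M (rv d) \<notin> U" by blast
      have "card (verts M - insert (org M (rv d)) U) < card (verts M - U)"
        by (rule psubset_card_mono) (use d in \<open>auto simp: verts_def\<close>)
      then show ?thesis using less.hyps tree.grow[OF less.prems d] by blast
    qed (use less.prems in auto)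
  qed
  then show ?thesis using tree.root by blast
qed

lemma sum_list_filter_zero:
  fixes s :: "'a \<Rightarrow> 'b::monoid_add"
  assumes "\<And>d. d \<in> T \<Longrightarrow> s d = 0"
  shows "sum_list (map s (filter (\<lambda>d. d \<notin> T) w)) = sum_list (map s w)"
  using assms by (induction w) auto

lemma area_filter_zero:
  assumes "\<And>d. d \<in> T \<Longrightarrow> s d = 0" "\<And>d. d \<in> T \<Longrightarrow> t d = 0"
  shows "area s t (filter (\<lambda>d. d \<notin> T) w) = area s t w"
  by (induction w) (auto simp: assms sum_list_filter_zero)

text \<open>The discrete Stokes theorem, by summation by parts over the corners.\<close>

lemma pairing_exact:
  assumes t: "cocycle t"
  shows "pairing (\<lambda>d. \<phi> (org M (rv d)) - \<phi> (org M d)) t = 0"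
proof -
  define h where "h d = \<phi> (org M d)" for d
  have "pairing (\<lambda>d. \<phi> (org M (rv d)) - \<phi> (org M d)) t =
     (\<Sum>d\<in>UNIV. h (nx d) * t (nx d) - h d * t (nx d) - t d * h (nx (nx d)) + t d * h (nx d))"
    unfolding pairing_def wedge_def h_def by (intro sum.cong) (auto simp: algebra_simps)
  also have "\<dots> = (\<Sum>d\<in>UNIV. h (nx d) * t (nx d)) - (\<Sum>d\<in>UNIV. h d * t (nx d))
      - (\<Sum>d\<in>UNIV. t d * h (nx (nx d))) + (\<Sum>d\<in>UNIV. t d * h (nx d))"
    by (simp only: sum.distrib sum_subtractf)
  finally have 1: "pairing (\<lambda>d. \<phi> (org M (rv d)) - \<phi> (org M d)) t = \<dots>" .
  have 2: "(\<Sum>d\<in>UNIV. h (nx d) * t (nx d)) = (\<Sum>d\<in>UNIV. h d * t d)"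
    by (rule sum_nx)
  have 3: "(\<Sum>d\<in>UNIV. t d * h (nx (nx d))) = (\<Sum>d\<in>UNIV. h d * t (nx d))"
    using sum_nx[of "\<lambda>d. t d * h (nx (nx d))"] by (simp only: nx3 mult.commute)
  have 4: "(\<Sum>d\<in>UNIV. t d * h (nx d)) = (\<Sum>d\<in>UNIV. t (nx d) * h (nx (nx d)))"
    by (rule sum_nx[symmetric])
  have 5: "\<dots> = (\<Sum>d\<in>UNIV. h d * t (nx (nx d)))"
    using sum_nx[of "\<lambda>d. t (nx d) * h (nx (nx d))"] by (simp only: nx3 mult.commute)
  have 6: "(\<Sum>d\<in>UNIV. h d * t (nx d)) = - (\<Sum>d\<in>UNIV. h d * t d) - (\<Sum>d\<in>UNIV. h d * t (nx (nx d)))"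
    unfolding sum_negf[symmetric] sum_subtractf[symmetric]
  proof (rule sum.cong)
    fix d
    have *: "t (nx d) = - t d - t (nx (nx d))"
      using cocycle_face[OF t, of d] by linarith
    show "h d * t (nx d) = - (h d * t d) - h d * t (nx (nx d))"
      unfolding * by (simp add: algebra_simps)
  qed simp
  \<comment> \<open>Rotating to \<open>cw M d\<close> keeps the origin, and the third side of its
    triangle is \<open>rv d\<close>.\<close>
  have 7: "(\<Sum>d\<in>UNIV. h d * t (nx (nx d))) = (\<Sum>d\<in>UNIV. h (cw M d) * t (nx (nx (cw M d))))"
    by (rule sum.reindex_bij_betw[OF bij_cw, symmetric])
  have 8: "\<dots> = - (\<Sum>d\<in>UNIV. h d * t d)"
    unfolding sum_negf[symmetric] by (intro sum.cong) (auto simp: h_def cw_def cocycle_rv[OF t])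
  show ?thesis using 1 2 3 4 5 6 7 8 by linarith
qed

end

context torus
begin

lemma pairing_diff_left: "pairing (\<lambda>d. s d - s' d) t = pairing s t - pairing s' t"
  unfolding pairing_def wedge_def sum_subtractf[symmetric] by (rule sum.cong) (auto simp: algebra_simps)

lemma pairing_add_left: "pairing (\<lambda>d. s d + s' d) t = pairing s t + pairing s' t"
  unfolding pairing_def wedge_def sum.distrib[symmetric] by (rule sum.cong) (auto simp: algebra_simps)

lemma pairing_scale_left: "pairing (\<lambda>d. k * s d) t = k * pairing s t"
  unfolding pairing_def wedge_def sum_distrib_left by (rule sum.cong) (auto simp: algebra_simps)

lemma pairing_skew: "pairing t s = - pairing s t"
  unfolding pairing_def wedge_def sum_negf[symmetric] by (rule sum.cong) (auto simp: algebra_simps)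

lemma pairing_self [simp]: "pairing s s = 0"
  using pairing_skew[of s s] by simp

lemma pairing_gauge:
  assumes s: "cocycle s" and t: "cocycle t"
  shows "pairing (gauge g s) (gauge h t) = pairing s t"
proof -
  have eq: "gauge g s = (\<lambda>d. s d - (g (org M (rv d)) - g (org M d)))" for g and s :: "'d \<Rightarrow> real"
    by (rule ext) (simp add: gauge_def)
  have l: "pairing (gauge g s) t = pairing s t" if "cocycle t" for g s t
    unfolding eq pairing_diff_left[of s "\<lambda>d. g (org M (rv d)) - g (org M d)" t]
    by (simp only: pairing_exact[OF that] diff_zero)
  have "pairing (gauge g s) (gauge h t) = pairing s (gauge h t)"
    by (rule l[OF cocycle_gauge[OF t]])
  also have "\<dots> = - pairing (gauge h t) s" by (rule pairing_skew)
  also have "\<dots> = - pairing t s" by (simp add: l[OF s])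
  finally show ?thesis by (simp add: pairing_skew[of t s])
qed

section \<open>The cut graph of the torus\<close>

lemma cut_graph:
  obtains w U T a b c e where "disk_word UNIV w" "tree (set w) U T"
    "filter (\<lambda>d. d \<notin> T) w = [a, b, c, e]" "distinct [a, b, c, e]"
    "\<And>d. d \<in> {a, b, c, e} \<Longrightarrow> rv d \<in> {a, b, c, e}"
proof -
  obtain w where w: "disk_word UNIV w" using ex_disk_word by blast
  have inv: "distinct w" "3 * length w = CARD('d) + 6" using disk_word_inv[OF w] by auto
  have rv: "rv d \<in> set w" if "d \<in> set w" for d
    using disk_word_inv[OF w] that by (metis DiffE DiffI UNIV_I rv_rv)
  obtain T where T: "tree (set w) (verts M) T" using ex_spanning_tree[OF w] by blast
  have t: "T \<subseteq> set w" "\<And>d. d \<in> T \<Longrightarrow> rv d \<in> T" "card T + 2 = 2 * card (verts M)"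
    using tree_inv[OF rv T] by auto
  let ?l = "filter (\<lambda>d. d \<notin> T) w"
  have dl: "distinct ?l" using inv by simp
  have sl: "set ?l = set w - T" by auto
  have "card (set w - T) = length w - card T"
    using t(1) inv(1) by (simp add: card_Diff_subset distinct_card finite_subset)
  then have "length ?l = length w - card T"
    using distinct_card[OF dl] sl by simp
  \<comment> \<open>With \<open>V\<close> vertices, \<open>w\<close> has \<open>2 * V + 2\<close>
    letters and \<open>T\<close> has \<open>2 * V - 2\<close> darts. Four darts remain, that is, two
    edges.\<close>
  then have "length ?l = Suc (Suc (Suc (Suc 0)))"
    using inv(2) t(3) card_darts by simp
  then obtain a b c e where l: "?l = [a, b, c, e]"
    by (auto simp: length_Suc_conv)
  have "{a, b, c, e} = set w - T" using arg_cong[OF l, of set] sl by simp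
  then have "rv d \<in> {a, b, c, e}" if "d \<in> {a, b, c, e}" for d
    using that rv t(2) by (metis DiffE DiffI rv_rv)
  with that[OF w T l] dl l show ?thesis by simp
qed

text \<open>The possible side pairings of a quadrilateral. The middle one is the commutator pattern
  of a torus; the other two give a sphere.\<close>

lemma rv_pairs:
  assumes d: "distinct [a, b, c, e]" and rv: "\<And>d. d \<in> {a, b, c, e} \<Longrightarrow> rv d \<in> {a, b, c, e}"
  obtains "rv a = b" "rv c = e" | "rv a = c" "rv b = e" | "rv a = e" "rv b = c"
proof -
  have eq: "rv x = y \<Longrightarrow> rv y = x" for x y by auto
  have "rv a \<in> {b, c, e}" using rv[of a] by simp
  then consider "rv a = b" | "rv a = c" | "rv a = e" by blast
  then show ?thesis
  proof cases
    case 1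
    have "rv c \<noteq> a" "rv c \<noteq> b" using d 1 eq[of c a] eq[of c b] eq[OF 1] by auto
    then show ?thesis using that(1)[OF 1] rv[of c] by simp
  next
    case 2
    have "rv b \<noteq> a" "rv b \<noteq> c" using d 2 eq[of b a] eq[of b c] eq[OF 2] by auto
    then show ?thesis using that(2)[OF 2] rv[of b] by simp
  next
    case 3
    have "rv b \<noteq> a" "rv b \<noteq> e" using d 3 eq[of b a] eq[of b e] eq[OF 3] by auto
    then show ?thesis using that(3)[OF 3] rv[of b] by simp
  qed
qed

text \<open>Once the tree is gauged away, the pairing depends only on the values at the four
  remaining darts, and antisymmetry makes it a multiple of one 2 by 2 determinant. Determinants of
  plane vectors satisfy the Pluecker relation.\<close>

lemma pairing_pluecker:
  assumes "cocycle s1" "cocycle s2" "cocycle s3" "cocycle s4"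
  shows "pairing s1 s2 * pairing s3 s4 - pairing s1 s3 * pairing s2 s4 + pairing s1 s4 * pairing s2 s3 = 0"
proof -
  obtain w U T a b c e where w: "disk_word UNIV w" and T: "tree (set w) U T"
    and l: "filter (\<lambda>d. d \<notin> T) w = [a, b, c, e]" "distinct [a, b, c, e]"
    and rv: "\<And>d. d \<in> {a, b, c, e} \<Longrightarrow> rv d \<in> {a, b, c, e}"
    using cut_graph by metis
  have "\<exists>s'. cocycle s' \<and> (\<forall>d\<in>T. s' d = 0) \<and> (\<exists>g. s' = gauge g s)" if s: "cocycle s" for s :: "'d \<Rightarrow> real"
    using tree_gauge[of s, OF _ T] cocycle_rv[OF s] cocycle_gauge[OF s] by blast
  then obtain \<sigma> where \<sigma>: "\<And>s. cocycle s \<Longrightarrow> cocycle (\<sigma> s)" "\<And>s d. cocycle s \<Longrightarrow> d \<in> T \<Longrightarrow> \<sigma> s d = (0::real)"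
    "\<And>s. cocycle s \<Longrightarrow> \<exists>g. \<sigma> s = gauge g s"
    by metis
  have ar: "pairing s t = 3 * area (\<sigma> s) (\<sigma> t) [a, b, c, e]" if s: "cocycle s" and t: "cocycle t" for s t
  proof -
    have "pairing s t = pairing (\<sigma> s) (\<sigma> t)"
      using \<sigma>(3)[OF s] \<sigma>(3)[OF t] pairing_gauge[OF s t] by metis
    also have "\<dots> = 3 * area (\<sigma> s) (\<sigma> t) w"
      using disk_word_area[OF w \<sigma>(1)[OF s] \<sigma>(1)[OF t]] by (simp add: pairing_def)
    finally show ?thesis
      using area_filter_zero[of T "\<sigma> s" "\<sigma> t" w] \<sigma>(2)[OF s] \<sigma>(2)[OF t] l by simp
  qed
  \<comment> \<open>For the parallelogram \<open>a\<close>, \<open>b\<close>, \<open>rv a\<close>,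
    \<open>rv b\<close>, \<open>area\<close> is twice the determinant, and faces count three times,
    whence \<open>k = 6\<close>. In the spherical patterns the area vanishes and
    \<open>k = 0\<close> serves.\<close>
  have "\<exists>k. \<forall>s t. cocycle s \<longrightarrow> cocycle t \<longrightarrow> pairing s t = k * (\<sigma> s a * \<sigma> t b - \<sigma> s b * \<sigma> t a)"
  proof -
    consider "rv a = b" "rv c = e" | "rv a = c" "rv b = e" | "rv a = e" "rv b = c"
      by (rule rv_pairs[OF l(2) rv])
    then show ?thesis
    proof cases
      case 1
      have "pairing s t = 0 * (\<sigma> s a * \<sigma> t b - \<sigma> s b * \<sigma> t a)" if "cocycle s" "cocycle t" for s t
        using ar[OF that] cocycle_rv[OF \<sigma>(1)[OF that(1)]] cocycle_rv[OF \<sigma>(1)[OF that(2)]] 1[symmetric]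
        by (simp add: algebra_simps)
      then show ?thesis by blast
    next
      case 2
      have "pairing s t = 6 * (\<sigma> s a * \<sigma> t b - \<sigma> s b * \<sigma> t a)" if "cocycle s" "cocycle t" for s t
        using ar[OF that] cocycle_rv[OF \<sigma>(1)[OF that(1)]] cocycle_rv[OF \<sigma>(1)[OF that(2)]] 2[symmetric]
        by (simp add: algebra_simps)
      then show ?thesis by blast
    next
      case 3
      have "pairing s t = 0 * (\<sigma> s a * \<sigma> t b - \<sigma> s b * \<sigma> t a)" if "cocycle s" "cocycle t" for s t
        using ar[OF that] cocycle_rv[OF \<sigma>(1)[OF that(1)]] cocycle_rv[OF \<sigma>(1)[OF that(2)]] 3[symmetric]
        by (simp add: algebra_simps)
      then show ?thesis by blast
    qed
  qed
  then obtain k where k: "\<And>s t. cocycle s \<Longrightarrow> cocycle t \<Longrightarrow> pairing s t = k * (\<sigma> s a * \<sigma> t b - \<sigma> s b * \<sigma> t a)"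
    by blast
  show ?thesis by (simp add: k assms algebra_simps)
qed

text \<open>The boundary word of the cut torus has trivial holonomy. With the tree gauged away it
  reads \<open>a\<close>, \<open>b\<close>, \<open>rv a\<close>, \<open>rv b\<close>, and its
  vanishing sum is the commutation relation. The spherical patterns are excluded because the area of
  \<open>p\<close> and \<open>q\<close> would vanish there. The clause on \<open>H\<close> says that
  the two values generate all others.\<close>

lemma commuting_generators:
  fixes s :: "'d \<Rightarrow> 'g::group_add"
  assumes s: "cocycle s" and p: "cocycle p" "cocycle q" "pairing p q \<noteq> 0"
  obtains g a b where "gauge g s a + gauge g s b = gauge g s b + gauge g s a"
    "\<And>H d. gauge g s a \<in> H \<Longrightarrow> gauge g s b \<in> H \<Longrightarrow> (\<And>x y. x \<in> H \<Longrightarrow> y \<in> H \<Longrightarrow> x + y \<in> H) \<Longrightarrow>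
       (\<And>x. x \<in> H \<Longrightarrow> - x \<in> H) \<Longrightarrow> gauge g s d \<in> H"
proof -
  obtain w U T a b c e where w: "disk_word UNIV w" and T: "tree (set w) U T"
    and l: "filter (\<lambda>d. d \<notin> T) w = [a, b, c, e]" "distinct [a, b, c, e]"
    and rv: "\<And>d. d \<in> {a, b, c, e} \<Longrightarrow> rv d \<in> {a, b, c, e}"
    using cut_graph by metis
  have setw: "set w \<subseteq> T \<union> {a, b, c, e}" using arg_cong[OF l(1), of set] by auto
  obtain gp gq where gp: "\<And>d. d \<in> T \<Longrightarrow> gauge gp p d = 0" and gq: "\<And>d. d \<in> T \<Longrightarrow> gauge gq q d = 0"
    using tree_gauge[of p, OF _ T] tree_gauge[of q, OF _ T] cocycle_rv[OF p(1)] cocycle_rv[OF p(2)] by metis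
  note cp = cocycle_gauge[OF p(1), of gp] and cq = cocycle_gauge[OF p(2), of gq]
  have "pairing p q = pairing (gauge gp p) (gauge gq q)"
    using pairing_gauge[OF p(1,2)] by metis
  also have "\<dots> = 3 * area (gauge gp p) (gauge gq q) w"
    using disk_word_area[OF w cp cq] by (simp add: pairing_def)
  also have "\<dots> = 3 * area (gauge gp p) (gauge gq q) [a, b, c, e]"
    using area_filter_zero[of T "gauge gp p" "gauge gq q" w, OF gp gq] l(1) by simp
  finally have ar: "area (gauge gp p) (gauge gq q) [a, b, c, e] \<noteq> 0" using p(3) by auto
  consider "rv a = b" "rv c = e" | "rv a = c" "rv b = e" | "rv a = e" "rv b = c"
    by (rule rv_pairs[OF l(2) rv])
  then have pat: "c = rv a \<and> e = rv b"
  proof cases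
    case 1
    then have "area (gauge gp p) (gauge gq q) [a, b, c, e] = 0"
      using cocycle_rv[OF cp] cocycle_rv[OF cq] 1[symmetric] by (simp add: algebra_simps)
    then show ?thesis using ar by simp
  next
    case 3
    then have "area (gauge gp p) (gauge gq q) [a, b, c, e] = 0"
      using cocycle_rv[OF cp] cocycle_rv[OF cq] 3[symmetric] by (simp add: algebra_simps)
    then show ?thesis using ar by simp
  qed auto
  obtain g where g: "\<And>d. d \<in> T \<Longrightarrow> gauge g s d = 0"
    using tree_gauge[of s, OF _ T] cocycle_rv[OF s] by metis
  let ?s = "gauge g s"
  note cs = cocycle_gauge[OF s, of g]
  have "sum_list (map ?s [a, b, c, e]) = 0"
    using sum_list_filter_zero[of T ?s w, OF g] disk_word_sum[OF w cs] l(1) by simp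
  moreover have "sum_list (map ?s [a, b, c, e]) = (?s a + ?s b) - (?s b + ?s a)"
    using pat by (simp only: list.map sum_list.Cons sum_list.Nil cocycle_rv[OF cs] diff_conv_add_uminus
        minus_add add.assoc add_0_right)
  ultimately have "?s a + ?s b = ?s b + ?s a" by simp
  moreover have "?s d \<in> H" if "?s a \<in> H" "?s b \<in> H" and H: "\<And>x y. x \<in> H \<Longrightarrow> y \<in> H \<Longrightarrow> x + y \<in> H"
       "\<And>x. x \<in> H \<Longrightarrow> - x \<in> H" for H d
  proof (rule disk_word_closure[OF w cs H])
    have "0 \<in> H" using H(1)[OF that(1) H(2)[OF that(1)]] by simp
    then show "?s d \<in> H" if "d \<in> set w" for d
      using that setw g \<open>?s a \<in> H\<close> \<open>?s b \<in> H\<close> H(2) pat by (auto simp: cocycle_rv[OF cs])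
  qed auto
  ultimately show ?thesis using that by blast
qed

end

section \<open>Flat sections of the holonomy\<close>

lemma cis_eqD:
  assumes "cis x = cis y" shows "\<exists>n::int. x = y + 2 * pi * n"
proof -
  have "cis (x - y) = 1"
    by (simp add: cis_divide[symmetric] assms)
  then have "cos (x - y) = 1"
    by (metis cis.sel(1) one_complex.sel(1))
  then obtain n :: int where "x - y = real_of_int n * 2 * pi"
    using cos_one_2pi_int[of "x - y"] by auto
  then have "x = y + 2 * pi * n" by (simp add: algebra_simps)
  then show ?thesis ..
qed

lemma pi_mult_less_iff: "pi * a < pi * b \<longleftrightarrow> a < b"
  and pi_mult_le_iff: "pi * a \<le> pi * b \<longleftrightarrow> a \<le> b"
  by simp_all

lemma Im_one_over_one_minus: "Im (1 / (1 - z)) = Im z / (cmod (1 - z))\<^sup>2"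
  by (simp add: Im_divide cmod_power2)

lemma Im_one_over_one_minus_neg_iff: "z \<noteq> 1 \<Longrightarrow> Im (1 / (1 - z)) < 0 \<longleftrightarrow> Im z < 0"
  and Im_one_over_one_minus_pos_iff: "z \<noteq> 1 \<Longrightarrow> 0 < Im (1 / (1 - z)) \<longleftrightarrow> 0 < Im z"
  unfolding Im_one_over_one_minus by (simp_all add: divide_less_0_iff zero_less_divide_iff)

text \<open>The three ratios of a triangle have product -1 and lie in the same closed half-plane. So
  their arguments add up to an odd multiple of pi, and the range of \<open>Arg\<close> leaves one
  choice.\<close>

lemma Arg_triangle:
  assumes z: "z \<noteq> 0" "z \<noteq> 1" and w: "w = 1 / (1 - z)" and u: "u = 1 / (1 - w)"
  shows "Arg z + Arg w + Arg u = (if Im z < 0 then - pi else pi)"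
proof -
  have w1: "w \<noteq> 0" "w \<noteq> 1" and u0: "u \<noteq> 0"
    using z by (auto simp: w u field_simps)
  have prod: "z * w * u = -1"
    using z w1 by (simp add: u w) (simp add: divide_simps)
  have "cis (Arg z + Arg w + Arg u) = sgn (z * w * u)"
    using z w1 u0 by (simp add: cis_mult[symmetric] cis_Arg sgn_mult)
  also have "\<dots> = cis pi" using prod by (simp add: cis_pi)
  finally obtain n :: int where n: "Arg z + Arg w + Arg u = pi + 2 * pi * n"
    using cis_eqD by blast
  have sw: "Im w < 0 \<longleftrightarrow> Im z < 0" using z w Im_one_over_one_minus_neg_iff by simp
  have su: "Im u < 0 \<longleftrightarrow> Im z < 0" using w1 u sw Im_one_over_one_minus_neg_iff by simp
  show ?thesis
  proof (cases "Im z < 0")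
    case True
    then have "Arg z < 0" "Arg w < 0" "Arg u < 0" using sw su Arg_neg_iff by auto
    then have "pi + 2 * pi * n < 0" "- (3 * pi) < pi + 2 * pi * n"
      using n Arg_bounded[of z] Arg_bounded[of w] Arg_bounded[of u] by linarith+
    then have "pi * (1 + 2 * n) < pi * 0" "pi * (-3) < pi * (1 + 2 * n)"
      by (simp_all add: algebra_simps)
    then have "1 + 2 * real_of_int n < 0" "-3 < 1 + 2 * real_of_int n"
      unfolding pi_mult_less_iff by simp_all
    then have "n = -1" by linarith
    then show ?thesis using n True by simp
  next
    case False
    have ge: "Arg z \<ge> 0" "Arg w \<ge> 0" "Arg u \<ge> 0" using False sw su Arg_less_0 by (simp_all add: not_less)
    \<comment> \<open>Three arguments equal to pi are the one case that the bounds alone do not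
      exclude.\<close>
    have ne: "\<not> (Arg z = pi \<and> Arg w = pi)"
    proof
      assume "Arg z = pi \<and> Arg w = pi"
      then have "Re z < 0" "Im z = 0" "Re w < 0" by (auto simp: Arg_eq_pi)
      then show False by (simp add: w Re_divide divide_less_0_iff)
    qed
    have "Arg z + Arg w + Arg u < 3 * pi"
      using ne Arg_bounded[of z] Arg_bounded[of w] Arg_bounded[of u] by linarith
    then have "pi * 0 \<le> pi * (1 + 2 * n)" "pi * (1 + 2 * n) < pi * 3"
      using n ge by (simp_all add: algebra_simps)
    then have "0 \<le> 1 + 2 * real_of_int n" "1 + 2 * real_of_int n < 3"
      unfolding pi_mult_less_iff pi_mult_le_iff by simp_all
    then have "n = 0" by linarith
    then show ?thesis using n False by simp
  qed
qed

locale angled_torus = torus M for M :: "'d::finite dart_map" +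
  fixes \<Theta> :: "'d \<Rightarrow> real"
  assumes Theta_rv [simp]: "\<Theta> (opp M d) = \<Theta> d"
    and Theta_nonneg: "0 \<le> \<Theta> d" and Theta_less: "\<Theta> d < pi"
    and Theta_sum: "(\<Sum>e\<in>org M d. \<Theta> e) = 2 * pi"
begin

definition has_angles :: "('d \<Rightarrow> complex) \<Rightarrow> bool" where
  "has_angles X \<longleftrightarrow> (\<forall>d. X d \<noteq> 0 \<and> Arg (X d) = \<Theta> d)"

lemma Theta_total: "(\<Sum>d\<in>UNIV. \<Theta> d) = CARD('d) * pi / 3"
proof -
  have "(\<Sum>d\<in>UNIV. \<Theta> d) = (\<Sum>v\<in>verts M. \<Sum>d\<in>v. \<Theta> d)" by (rule sum_verts[symmetric])
  also have "\<dots> = (\<Sum>v\<in>verts M. 2 * pi)"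
    by (rule sum.cong) (auto simp: verts_def Theta_sum)
  finally show ?thesis by (simp add: card_darts)
qed

text \<open>The product fixes the sum of the arguments modulo \<open>2 * pi\<close>. As
  \<open>Arg\<close> lies in (-pi, pi], a correction is due exactly when both points are in the
  lower half-plane.\<close>

lemma Arg_edge:
  assumes x: "x \<noteq> 0" "Arg x = \<theta>" "0 \<le> \<theta>" "\<theta> < pi" and z: "z \<noteq> 0" and w: "w = -1 / (x * z)"
  shows "Arg z + Arg w = pi - \<theta> - (if Im z < 0 \<and> Im w < 0 then 2 * pi else 0)"
proof -
  have w0: "w \<noteq> 0" using w x z by simp
  have "x * (z * w) = -1" using x z by (simp add: w)
  then have "cis \<theta> * cis (Arg z + Arg w) = cis pi"
    using x z w0 by (simp add: cis_mult[symmetric] cis_Arg sgn_mult[symmetric] flip: x(2))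
  then have "cis (\<theta> + (Arg z + Arg w)) = cis pi" by (simp add: cis_mult)
  then obtain n :: int where n: "\<theta> + (Arg z + Arg w) = pi + 2 * pi * n"
    using cis_eqD by blast
  show ?thesis
  proof (cases "Im z < 0 \<and> Im w < 0")
    case True
    then have "Arg z < 0" "Arg w < 0" using Arg_neg_iff by auto
    then have "pi * (2 * n) < pi * 0" "pi * (-3) < pi * (2 * n)"
      using n x Arg_bounded[of z] Arg_bounded[of w] by (auto simp: algebra_simps)
    then have "2 * real_of_int n < 0" "-3 < 2 * real_of_int n"
      unfolding pi_mult_less_iff by simp_all
    then have "n = -1" by linarith
    then show ?thesis using n True by simp
  next
    case False
    then have "Arg z \<ge> 0 \<or> Arg w \<ge> 0" using Arg_less_0 by (auto simp: not_less)
    moreover have "pi * (2 * n) = \<theta> + (Arg z + Arg w) - pi" using n by (simp add: algebra_simps)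
    ultimately have "pi * (-2) < pi * (2 * n)" "pi * (2 * n) < pi * 2"
      using x Arg_bounded[of z] Arg_bounded[of w] by linarith+
    then have "-2 < 2 * real_of_int n" "2 * real_of_int n < 2"
      unfolding pi_mult_less_iff by simp_all
    then have "n = 0" by linarith
    then show ?thesis using n False by auto
  qed
qed

text \<open>
  \<open>P d\<close> is the position of a fixed point of the holonomy in the coordinate in which the triangle
  \<open>ijk\<close> on the left of the dart \<open>d\<close> from \<open>i\<close> to \<open>j\<close> has its vertices at \<open>0, \<infinity>, 1\<close>.
\<close>

definition flat :: "('d \<Rightarrow> complex) \<Rightarrow> ('d \<Rightarrow> sphere) \<Rightarrow> bool" where
  "flat X P \<longleftrightarrow> (\<forall>d.
     P (nx d) = (case P d of None \<Rightarrow> Some 0 | Some z \<Rightarrow> if z = 1 then None else Some (1 / (1 - z))) \<and>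
     P (rv d) = (case P d of None \<Rightarrow> Some 0 | Some z \<Rightarrow> if z = 0 then None else Some (-1 / (X d * z))))"

text \<open>
  With the angles \<open>Arg P\<close> (and suitable values at \<open>0\<close> and \<open>\<infinity>\<close>), Gauss-Bonnet forces as many
  darts between two negatively oriented triangles as the inequality \<open>\<pi> + \<Theta> \<ge> \<pi>\<close> for the
  corresponding pairs of angles forbids.
\<close>

lemma flat_upper:
  assumes X: "has_angles X" and P: "flat X P"
  shows "\<exists>z. P d = Some z \<and> z \<noteq> 0 \<and> 0 \<le> Im z"
proof -
  have Pnx: "P (nx d) = (case P d of None \<Rightarrow> Some 0 | Some z \<Rightarrow> if z = 1 then None else Some (1 / (1 - z)))"
    and Prv: "P (rv d) = (case P d of None \<Rightarrow> Some 0 | Some z \<Rightarrow> if z = 0 then None else Some (-1 / (X d * z)))"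
    for d using P unfolding flat_def by blast+
  have X0: "X d \<noteq> 0" and XA: "Arg (X d) = \<Theta> d" for d using X by (auto simp: has_angles_def)
  \<comment> \<open>The value at infinity makes the edge relation hold without exception: there
    \<open>rv d\<close> has position 0, and \<open>Arg 0 = 0\<close>. The price is the defect
    \<open>\<tau>\<close> in the face relation.\<close>
  define \<alpha> where "\<alpha> d = (case P d of None \<Rightarrow> pi - \<Theta> d | Some z \<Rightarrow> Arg z)" for d
  define neg where "neg d = (case P d of None \<Rightarrow> False | Some z \<Rightarrow> Im z < 0)" for d
  define n :: "'d \<Rightarrow> real" where "n d = of_bool (neg d)" for d
  define b :: "'d \<Rightarrow> real" where "b d = of_bool (neg d \<and> neg (rv d))" for d
  define \<tau> where "\<tau> d = (if P d = None then \<Theta> d else 0)" for d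
  have neg_nx: "neg (nx d) = neg d" for d
  proof (cases "P d")
    case (Some z)
    then show ?thesis
      using Im_one_over_one_minus_neg_iff[of z] by (cases "z = 1") (simp_all add: neg_def Pnx)
  qed (simp add: neg_def Pnx)
  have face: "\<alpha> d + \<alpha> (nx d) + \<alpha> (nx (nx d)) =
      pi - 2 * pi * n d - (\<tau> d + \<tau> (nx d) + \<tau> (nx (nx d)))" for d
  proof (cases "P d")
    case None
    then show ?thesis by (simp add: \<alpha>_def Pnx n_def neg_def \<tau>_def Arg_zero)
  next
    case (Some z)
    consider "z = 1" | "z = 0" | "z \<noteq> 0" "z \<noteq> 1" by blast
    then show ?thesis
    proof cases
      case 3
      define w where "w = 1 / (1 - z)"
      have "w \<noteq> 1" using 3 by (simp add: w_def field_simps)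
      then show ?thesis
        using Some 3 Arg_triangle[OF 3 w_def refl]
        by (simp add: \<alpha>_def Pnx n_def neg_def \<tau>_def flip: w_def)
    qed (simp_all add: \<alpha>_def Pnx n_def neg_def \<tau>_def Arg_zero Some)
  qed
  have edge: "\<alpha> d + \<alpha> (rv d) = pi - \<Theta> d - 2 * pi * b d" for d
  proof (cases "P d")
    case None
    then show ?thesis by (simp add: \<alpha>_def Prv b_def neg_def Arg_zero)
  next
    case (Some z)
    show ?thesis
    proof (cases "z = 0")
      case False
      show ?thesis
        using Some False Arg_edge[OF X0 XA Theta_nonneg Theta_less False refl, of d]
        by (simp add: \<alpha>_def Prv b_def neg_def)
    qed (simp add: \<alpha>_def Prv b_def neg_def Arg_zero Some)
  qed
  have neg_lt: "\<alpha> d < 0" if "neg d" for d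
    using that by (auto simp: neg_def \<alpha>_def Arg_neg_iff split: option.splits)
  define A where "A = (\<Sum>d\<in>UNIV. \<alpha> d)"
  define k where "k = (\<Sum>d\<in>UNIV. n d)"
  define m where "m = (\<Sum>d\<in>UNIV. b d)"
  define T where "T = (\<Sum>d\<in>UNIV. \<tau> d)"
  let ?N = "real CARD('d)"
  have 1: "2 * A = ?N * pi - ?N * pi / 3 - 2 * pi * m"
    unfolding A_def sum_edge2 edge m_def
    by (simp add: sum_subtractf Theta_total sum_distrib_left)
  have 2: "3 * A = ?N * pi - 2 * pi * k - 3 * T"
    unfolding A_def sum_face3 face k_def T_def
    by (simp add: sum_subtractf sum_distrib_left sum_face3)
  have 3: "3 * (\<Sum>d\<in>UNIV. n d * \<alpha> d) = - (pi * k)"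
  proof -
    have "n d * \<alpha> d + n (nx d) * \<alpha> (nx d) + n (nx (nx d)) * \<alpha> (nx (nx d)) = - (pi * n d)" for d
    proof (cases "neg d")
      case True
      then have "P d \<noteq> None" "P (nx d) \<noteq> None" "P (nx (nx d)) \<noteq> None"
        using neg_nx[of d] neg_nx[of "nx d"] unfolding neg_def by (auto split: option.splits)
      then have "\<tau> d = 0" "\<tau> (nx d) = 0" "\<tau> (nx (nx d)) = 0" unfolding \<tau>_def by (simp_all only: if_False)
      then show ?thesis using face[of d] True by (simp add: n_def neg_nx)
    qed (simp add: n_def neg_nx)
    then show ?thesis unfolding sum_face3 k_def by (simp add: sum_distrib_left sum_negf)
  qed
  have 4: "2 * (\<Sum>d\<in>UNIV. b d * \<alpha> d) = - (pi * m) - (\<Sum>d\<in>UNIV. b d * \<Theta> d)"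
  proof -
    have "b d * \<alpha> d + b (rv d) * \<alpha> (rv d) = - (pi * b d) - b d * \<Theta> d" for d
      using edge[of d] by (auto simp: b_def)
    then show ?thesis unfolding sum_edge2 m_def by (simp add: sum_distrib_left sum_negf sum_subtractf)
  qed
  have nb: "(n d - b d) * \<alpha> d \<le> 0" for d
    using neg_lt[of d] by (auto simp: n_def b_def)
  have 5: "(\<Sum>d\<in>UNIV. (n d - b d) * \<alpha> d) = (\<Sum>d\<in>UNIV. n d * \<alpha> d) - (\<Sum>d\<in>UNIV. b d * \<alpha> d)"
    by (simp add: algebra_simps sum_subtractf)
  have 6: "(\<Sum>d\<in>UNIV. (n d - b d) * \<alpha> d) \<le> 0" by (rule sum_nonpos) (rule nb)
  have 7: "(\<Sum>d\<in>UNIV. b d * \<Theta> d) \<ge> 0" by (rule sum_nonneg) (simp add: b_def Theta_nonneg)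
  have 8: "T \<ge> 0" unfolding T_def by (rule sum_nonneg) (simp add: \<tau>_def Theta_nonneg)
  have 9: "3 * (pi * m) = 2 * (pi * k) + 3 * T" using 1 2 by linarith
  \<comment> \<open>\<open>n\<close> marks the darts of negatively oriented triangles,
    \<open>b\<close> those with such triangles on both sides. Since \<open>\<alpha> < 0\<close>
    where \<open>n = 1\<close>, and \<open>b \<le> n\<close>, facts 3 and 4 give
    \<open>3 * m \<le> 2 * k\<close>, whereas fact 9 gives \<open>3 * m \<ge> 2 * k\<close>. So
    every estimate is an equality.\<close>
  have T0: "T = 0" and z: "(\<Sum>d\<in>UNIV. (n d - b d) * \<alpha> d) = 0"
    using 3 4 5 6 7 8 9 by linarith+
  have "(\<Sum>d\<in>UNIV. - ((n d - b d) * \<alpha> d)) = 0" unfolding sum_negf z by simp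
  then have nb0: "- ((n d - b d) * \<alpha> d) = 0" for d
    using nb by (subst (asm) sum_nonneg_eq_0_iff) (auto simp only: neg_0_le_iff_le finite UNIV_I)
  have "n d = b d" for d
  proof (cases "neg d")
    case True
    then show ?thesis using nb0[of d] neg_lt[of d] by simp
  qed (simp add: n_def b_def)
  then have "k = m" by (simp add: k_def m_def)
  then have "k = 0" using 9 T0 by simp
  then have "n d = 0" for d
    unfolding k_def by (subst (asm) sum_nonneg_eq_0_iff) (auto simp: n_def)
  then have nonneg: "\<not> neg d" for d by (simp add: n_def split: if_splits)
  have T0': "\<tau> d = 0" for d
    using T0 unfolding T_def by (subst (asm) sum_nonneg_eq_0_iff) (auto simp: \<tau>_def Theta_nonneg)
  \<comment> \<open>Position infinity at \<open>d\<close> puts the fixed point at the target vertex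
    of \<open>d\<close>. Then every dart starting there has position 0 and, the defects being zero,
    angle \<open>\<Theta> = 0\<close>, against the sum \<open>2 * pi\<close>.\<close>
  have ninf: "P d \<noteq> None" for d
  proof
    assume "P d = None"
    then have e: "P (rv d) = Some 0" by (simp add: Prv)
    have "P ((cw M ^^ m) (rv d)) = Some 0" for m
    proof (induction m)
      case (Suc m)
      then have "P (rv ((cw M ^^ m) (rv d))) = None" by (simp add: Prv)
      then have "P (cw M ((cw M ^^ m) (rv d))) = Some 0" unfolding cw_def Pnx by simp
      then show ?case by simp
    qed (simp add: e)
    then have "P e = Some 0" if "e \<in> org M (rv d)" for e
      using that unfolding org_conv_funpow by auto
    then have "\<Theta> e = 0" if "e \<in> org M (rv d)" for e
      using T0'[of "rv e"] that by (simp add: \<tau>_def Prv)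
    then have "(\<Sum>e\<in>org M (rv d). \<Theta> e) = 0" by simp
    then show False using Theta_sum[of "rv d"] by simp
  qed
  obtain z where z: "P d = Some z" using ninf[of d] by auto
  moreover have "z \<noteq> 0" using ninf[of "rv d"] z by (auto simp: Prv)
  ultimately show ?thesis using nonneg[of d] by (auto simp: neg_def)
qed

end

section \<open>Shapes of triangles and their degenerations\<close>

context angled_torus
begin

text \<open>With the fixed point at infinity, \<open>Q d\<close> is the ratio (j - k) / (i - k) in
  the triangle ijk on the left of the dart \<open>d\<close> from i to j. The weak version admits
  collinear vertices.\<close>

definition weak_shape :: "('d \<Rightarrow> complex) \<Rightarrow> ('d \<Rightarrow> complex) \<Rightarrow> bool" where
  "weak_shape X Q \<longleftrightarrow> (\<forall>d. Q d \<noteq> 0 \<and> Q d \<noteq> 1 \<and> 0 \<le> Im (Q d) \<and> Q (nx d) = 1 / (1 - Q d) \<and>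
     X d * Q d * Q (rv d) = -1)"

definition shape :: "('d \<Rightarrow> complex) \<Rightarrow> ('d \<Rightarrow> complex) \<Rightarrow> bool" where
  "shape X Q \<longleftrightarrow> (\<forall>d. 0 < Im (Q d) \<and> Q (nx d) = 1 / (1 - Q d) \<and> X d * Q d * Q (rv d) = -1)"

definition triangle_angles :: "('d \<Rightarrow> real) \<Rightarrow> bool" where
  "triangle_angles \<alpha> \<longleftrightarrow> (\<forall>d. 0 < \<alpha> d \<and> \<alpha> d + \<alpha> (rv d) = pi - \<Theta> d \<and>
     \<alpha> d + \<alpha> (nx d) + \<alpha> (nx (nx d)) = pi)"

lemma flat_weak_shape:
  assumes X: "has_angles X" and P: "flat X P"
  obtains Q where "\<And>d. P d = Some (Q d)" "weak_shape X Q"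
proof -
  define Q where "Q d = the (P d)" for d
  have Q: "P d = Some (Q d)" "Q d \<noteq> 0" "0 \<le> Im (Q d)" for d
    using flat_upper[OF X P, of d] by (auto simp: Q_def)
  have fl: "P (nx d) = (if Q d = 1 then None else Some (1 / (1 - Q d)))"
     "P (rv d) = Some (-1 / (X d * Q d))" for d
    using P Q(2)[of d] unfolding flat_def by (auto simp: Q(1))
  have Q1: "Q d \<noteq> 1" for d using fl(1)[of d] Q(1)[of "nx d"] by auto
  have "X d \<noteq> 0" for d using X by (simp add: has_angles_def)
  then have "weak_shape X Q"
    unfolding weak_shape_def using fl Q Q1 by (auto simp: Q(1))
  with Q(1) that show ?thesis by blast
qed

lemma weak_shape_angles:
  assumes X: "has_angles X" and Q: "weak_shape X Q"
  shows "Arg (Q d) + Arg (Q (rv d)) = pi - \<Theta> d"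
    and "Arg (Q d) + Arg (Q (nx d)) + Arg (Q (nx (nx d))) = pi"
    and "0 \<le> Arg (Q d)"
proof -
  have q: "Q d \<noteq> 0" "Q d \<noteq> 1" "0 \<le> Im (Q d)" "Q (nx d) = 1 / (1 - Q d)" "X d * Q d * Q (rv d) = -1" for d
    using Q unfolding weak_shape_def by blast+
  have x: "X d \<noteq> 0" "Arg (X d) = \<Theta> d" using X by (auto simp: has_angles_def)
  have "Q (rv d) = -1 / (X d * Q d)" using q(5)[of d] q(1)[of d] x by (simp add: field_simps)
  from Arg_edge[OF x Theta_nonneg Theta_less q(1) this] show "Arg (Q d) + Arg (Q (rv d)) = pi - \<Theta> d"
    using q(3)[of d] by simp
  show "Arg (Q d) + Arg (Q (nx d)) + Arg (Q (nx (nx d))) = pi"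
    using Arg_triangle[OF q(1,2) q(4) q(4)] q(3)[of d] by simp
  show "0 \<le> Arg (Q d)" using q(3) Arg_less_0 by simp
qed

lemma weak_shape_long:
  assumes X: "has_angles X" and Q: "weak_shape X Q" and d: "Arg (Q d) = 0"
  shows "Arg (Q (nx d)) = pi \<or> Arg (Q (nx (nx d))) = pi"
proof -
  have q: "Q (nx d) = 1 / (1 - Q d)" for d
    using Q unfolding weak_shape_def by blast+
  have r: "Q d \<in> \<real>" using d Arg_eq_0 by blast
  then have r1: "Q (nx d) \<in> \<real>" unfolding q by simp
  then have "Q (nx (nx d)) \<in> \<real>" unfolding q[of "nx d"] by simp
  with r1 show ?thesis
    using weak_shape_angles(2)[OF X Q, of d] d Arg_eq_0_pi[of "Q (nx d)"] Arg_eq_0_pi[of "Q (nx (nx d))"]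
    by auto
qed

lemma weak_shape_strict:
  assumes X: "has_angles X" and Q: "weak_shape X Q" and n: "\<And>d. Arg (Q d) \<noteq> pi"
  shows "shape X Q"
proof -
  have "Arg (Q d) \<noteq> 0" for d using weak_shape_long[OF X Q] n by blast
  then have "Arg (Q d) > 0" "Arg (Q d) < pi" for d
    using weak_shape_angles(3)[OF X Q, of d] n[of d] Arg_bounded[of "Q d"]
    by (auto simp: less_le)
  then have "Im (Q d) > 0" for d using Arg_lt_pi by blast
  then show ?thesis using Q by (auto simp: shape_def weak_shape_def)
qed

lemma shape_weak: "shape X Q \<Longrightarrow> weak_shape X Q"
proof -
  assume Q: "shape X Q"
  have "Q d \<noteq> 0 \<and> Q d \<noteq> 1" for d
    using Q by (metis shape_def less_irrefl zero_complex.sel(2) one_complex.sel(2))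
  then show ?thesis using Q by (simp add: shape_def weak_shape_def less_imp_le)
qed

lemma shape_triangle_angles:
  assumes X: "has_angles X" and Q: "shape X Q"
  shows "triangle_angles (\<lambda>d. Arg (Q d))"
proof -
  have "0 < Arg (Q d)" for d using Q by (simp add: shape_def Arg_pos_iff)
  then show ?thesis
    unfolding triangle_angles_def using weak_shape_angles[OF X shape_weak[OF Q]] by blast
qed

text \<open>A degenerate triangle has an angle pi opposite to its long side. Across that side the
  angle is 0, so the neighbour is degenerate too, with its long side elsewhere. Weigh darts by the
  genuine angles \<alpha>: each degenerate triangle has weight pi, and so has each long edge, where
  \<Theta> vanishes. The totals agree, so all darts of degenerate triangles belong to long edges.
  Counting them by triangles and by edges gives \<open>3 * L = 2 * L\<close> for the number
  \<open>L\<close> of long sides.\<close>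

lemma weak_shape_shape:
  assumes X: "has_angles X" and Q: "weak_shape X Q" and \<alpha>: "triangle_angles \<alpha>"
  shows "shape X Q"
proof (rule weak_shape_strict[OF X Q])
  note ang = weak_shape_angles[OF X Q]
  define l :: "'d \<Rightarrow> real" where "l d = of_bool (Arg (Q d) = pi)" for d
  define z where "z d = l d + l (nx d) + l (nx (nx d))" for d
  have A: "0 < \<alpha> d" "\<alpha> d + \<alpha> (nx d) + \<alpha> (nx (nx d)) = pi" for d
    using \<alpha> by (auto simp: triangle_angles_def)
  have Ae: "\<alpha> d + \<alpha> (rv d) = pi - \<Theta> d" for d
    using \<alpha> by (auto simp: triangle_angles_def)
  have long: "Arg (Q (rv d)) = 0" "\<Theta> d = 0" if "Arg (Q d) = pi" for d
    using ang(1)[of d] ang(3)[of "rv d"] Theta_nonneg[of d] that by linarith+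
  have le: "l d + l (rv d) \<le> z d" for d
  proof (cases "Arg (Q d) = pi")
    case True
    then show ?thesis using long(1)[OF True] by (simp add: l_def z_def)
  next
    case False
    show ?thesis
    proof (cases "Arg (Q (rv d)) = pi")
      case True
      then have "Arg (Q d) = 0" using long(1)[OF True] by simp
      from weak_shape_long[OF X Q this] show ?thesis by (auto simp: l_def z_def)
    qed (use False in \<open>simp add: l_def z_def\<close>)
  qed
  have s1: "(\<Sum>d\<in>UNIV. z d * \<alpha> d) = (\<Sum>d\<in>UNIV. l d * pi)"
  proof -
    have "(\<Sum>d\<in>UNIV. l (nx d) * \<alpha> d) = (\<Sum>d\<in>UNIV. l d * \<alpha> (nx (nx d)))"
      using sum_nx[of "\<lambda>d. l d * \<alpha> (nx (nx d))"] by simp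
    moreover have "(\<Sum>d\<in>UNIV. l (nx (nx d)) * \<alpha> d) = (\<Sum>d\<in>UNIV. l d * \<alpha> (nx d))"
      using sum_nx[of "\<lambda>d. l (nx d) * \<alpha> (nx (nx d))"] sum_nx[of "\<lambda>d. l d * \<alpha> (nx d)"] by simp
    ultimately have "(\<Sum>d\<in>UNIV. z d * \<alpha> d)
      = (\<Sum>d\<in>UNIV. l d * \<alpha> d) + (\<Sum>d\<in>UNIV. l d * \<alpha> (nx (nx d))) + (\<Sum>d\<in>UNIV. l d * \<alpha> (nx d))"
      by (simp add: z_def distrib_right sum.distrib)
    also have "\<dots> = (\<Sum>d\<in>UNIV. l d * (\<alpha> d + \<alpha> (nx d) + \<alpha> (nx (nx d))))"
      by (simp add: distrib_left sum.distrib)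
    finally show ?thesis by (simp add: A)
  qed
  have s2: "(\<Sum>d\<in>UNIV. (l d + l (rv d)) * \<alpha> d) = (\<Sum>d\<in>UNIV. l d * pi)"
  proof -
    have "(\<Sum>d\<in>UNIV. l (rv d) * \<alpha> d) = (\<Sum>d\<in>UNIV. l d * \<alpha> (rv d))"
      using sum_rv[of "\<lambda>d. l d * \<alpha> (rv d)"] by simp
    then have "(\<Sum>d\<in>UNIV. (l d + l (rv d)) * \<alpha> d) = (\<Sum>d\<in>UNIV. l d * (\<alpha> d + \<alpha> (rv d)))"
      by (simp add: distrib_left distrib_right sum.distrib)
    also have "\<dots> = (\<Sum>d\<in>UNIV. l d * pi)"
      by (rule sum.cong) (auto simp: Ae l_def long(2))
    finally show ?thesis .
  qed
  have "(\<Sum>d\<in>UNIV. (z d - (l d + l (rv d))) * \<alpha> d) = 0"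
    unfolding left_diff_distrib sum_subtractf s1 s2 by simp
  then have "(z d - (l d + l (rv d))) * \<alpha> d = 0" for d
  proof (subst (asm) sum_nonneg_eq_0_iff)
    show "0 \<le> (z d - (l d + l (rv d))) * \<alpha> d" for d
      using le[of d] A(1)[of d] by simp
  qed auto
  then have "z d = l d + l (rv d)" for d using A(1)[of d] by (metis eq_iff_diff_eq_0 less_irrefl mult_eq_0_iff)
  then have "3 * (\<Sum>d\<in>UNIV. l d) = 2 * (\<Sum>d\<in>UNIV. l d)"
    unfolding sum_face3 sum_edge2 by (intro sum.cong) (simp_all add: z_def)
  then have "(\<Sum>d\<in>UNIV. l d) = 0" by simp
  then have "l d = 0" for d
    by (subst (asm) sum_nonneg_eq_0_iff) (auto simp: l_def)
  then show "Arg (Q d) \<noteq> pi" for d by (auto simp: l_def split: if_splits)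
qed

text \<open>With actual edge vectors a maximum argument suffices: across the longest long side lies
  a degenerate triangle in which this side is not the long one, so that triangle has a still longer
  one.\<close>

lemma weak_shape_lengths:
  assumes X: "has_angles X" and Q: "weak_shape X Q"
    and F: "\<And>d. F d \<noteq> (0::complex)" "\<And>d. F (rv d) = - F d" "\<And>d. (1 - Q d) * F (nx d) = Q d * F d"
      "\<And>d. F d + F (nx d) + F (nx (nx d)) = 0"
  shows "shape X Q"
proof (rule weak_shape_strict[OF X Q], rule notI)
  fix d0 assume d0: "Arg (Q d0) = pi"
  let ?L = "{d. Arg (Q d) = pi}"
  have q1: "Q d \<noteq> 1" for d using Q unfolding weak_shape_def by blast
  have short: "cmod (F (nx d)) < cmod (F d) \<and> cmod (F (nx (nx d))) < cmod (F d)" if "d \<in> ?L" for d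
  proof -
    from that have r: "Im (Q d) = 0" "Re (Q d) < 0" by (auto simp: Arg_eq_pi)
    define q where "q = Re (Q d)"
    have Qq: "Q d = of_real q" "q < 0" using r by (auto simp: q_def complex_eq_iff)
    have 1: "of_real (1 - q) * F (nx d) = of_real q * F d" using F(3)[of d] by (simp add: Qq)
    have "F (nx (nx d)) = (F d + F (nx d) + F (nx (nx d))) - F d - F (nx d)" by simp
    then have f: "F (nx (nx d)) = - F d - F (nx d)" unfolding F(4) by simp
    have "of_real (1 - q) * F (nx (nx d)) = of_real (1 - q) * (- F d) - of_real (1 - q) * F (nx d)"
      unfolding f by (simp add: algebra_simps)
    then have 2: "of_real (1 - q) * F (nx (nx d)) = - F d" unfolding 1 by (simp add: algebra_simps)
    have "(1 - q) * cmod (F (nx d)) = - q * cmod (F d)" "(1 - q) * cmod (F (nx (nx d))) = cmod (F d)"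
      using arg_cong[OF 1, of cmod] arg_cong[OF 2, of cmod] Qq(2) unfolding norm_mult norm_of_real by auto
    moreover have "0 < cmod (F d)" using F(1) by simp
    ultimately have "(1 - q) * cmod (F (nx d)) < (1 - q) * cmod (F d)"
       "(1 - q) * cmod (F (nx (nx d))) < (1 - q) * cmod (F d)"
      using Qq(2) by (simp_all add: algebra_simps mult_neg_pos)
    then show ?thesis using Qq(2) by simp
  qed
  have "finite ?L" "?L \<noteq> {}" using d0 by auto
  then have "Max ((\<lambda>d. cmod (F d)) ` ?L) \<in> (\<lambda>d. cmod (F d)) ` ?L"
    by (intro Max_in) auto
  then obtain d where d: "d \<in> ?L" and "Max ((\<lambda>d. cmod (F d)) ` ?L) = cmod (F d)" by blast
  then have max: "cmod (F e) \<le> cmod (F d)" if "e \<in> ?L" for e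
    using that Max_ge[of "(\<lambda>d. cmod (F d)) ` ?L" "cmod (F e)"] by simp
  have "Arg (Q (rv d)) = 0"
    using weak_shape_angles(1,3)[OF X Q, of d] weak_shape_angles(3)[OF X Q, of "rv d"] Theta_nonneg[of d] d by auto
  from weak_shape_long[OF X Q this] obtain e where e: "e \<in> ?L" "rv d = nx e \<or> rv d = nx (nx e)"
    by (metis (mono_tags) mem_Collect_eq nx3)
  then have "cmod (F (rv d)) < cmod (F e)" using short by auto
  then show False using max[OF e(1)] by (simp add: F(2))
qed

end

section \<open>Developing maps and Euclidean structures\<close>

lemma path_from_append [simp]:
  "path_from M v (p @ q) \<longleftrightarrow> path_from M v p \<and> path_from M (path_end M v p) q"
  by (induction p arbitrary: v) auto

lemma path_end_append [simp]: "path_end M v (p @ q) = path_end M (path_end M v p) q"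
  by (induction p arbitrary: v) auto

lemma homotopic_refl [simp]: "homotopic_paths_from M b p p"
  by (simp add: homotopic_paths_from_def)

lemma homotopic_sym: "homotopic_paths_from M b p q \<Longrightarrow> homotopic_paths_from M b q p"
  unfolding homotopic_paths_from_def by (rule sympD[OF symp_rtranclp]) (auto intro: sympI)

lemma homotopic_trans:
  "homotopic_paths_from M b p q \<Longrightarrow> homotopic_paths_from M b q r \<Longrightarrow> homotopic_paths_from M b p r"
  unfolding homotopic_paths_from_def by (rule rtranclp_trans)

lemma elementary_homotopic: "elementary_homotopy M b p q \<Longrightarrow> homotopic_paths_from M b p q"
  unfolding homotopic_paths_from_def by (rule r_into_rtranclp) simp

lemma hclass_eqI: "homotopic_paths_from M b p q \<Longrightarrow> hclass M b p = hclass M b q"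
  unfolding hclass_def
  by (intro Collect_cong iffI) (erule homotopic_trans[OF homotopic_sym], assumption, erule homotopic_trans)

lemma mem_hclass [simp]: "p \<in> hclass M b p" by (simp add: hclass_def)

lemma of_homog_homog [simp]: "of_homog (homog p) = p"
  by (cases p) (auto simp: of_homog_def)

lemma moebius_id: "moebius (\<lambda>p. p)"
  unfolding moebius_def
  by (intro exI[of _ 1] exI[of _ 0] conjI) auto

lemma translation_Some [simp]: "translation c (Some z) = Some (z + c)"
  by (simp add: translation_def)

lemma moebius_translation: "moebius (translation c)"
proof -
  have "translation c p = of_homog (1 * fst (homog p) + c * snd (homog p), 0 * fst (homog p) + 1 * snd (homog p))" for p
    by (cases p) (auto simp: of_homog_def translation_def)
  then show ?thesis unfolding moebius_def
    by (intro exI[of _ 1] exI[of _ c] exI[of _ 0] conjI) auto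
qed

lemma homog_of_homog:
  assumes "u \<noteq> (0, 0)"
  obtains k where "k \<noteq> 0" "fst u = k * fst (homog (of_homog u))" "snd u = k * snd (homog (of_homog u))"
proof (cases "snd u = 0")
  case True
  then have "fst u \<noteq> 0" using assms by (cases u) auto
  then show ?thesis using that[of "fst u"] True by (auto simp: of_homog_def)
next
  case False
  then show ?thesis using that[of "snd u"] by (auto simp: of_homog_def)
qed

text \<open>On homogeneous coordinates a Moebius map is linear; \<delta> is its determinant and
  \<open>k p\<close> the factor lost in renormalising. Invariance of cross ratios then needs no case
  distinction at infinity.\<close>

lemma moebius_homog:
  assumes "moebius m"
  obtains \<delta> k where "\<delta> \<noteq> 0" "\<And>p. k p \<noteq> 0"
    "\<And>p q. \<delta> * sphere_diff p q = k p * k q * sphere_diff (m p) (m q)"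
proof -
  obtain a b c d where det: "a * d - b * c \<noteq> 0" and
    m: "m = (\<lambda>p. of_homog (a * fst (homog p) + b * snd (homog p), c * fst (homog p) + d * snd (homog p)))"
    using assms unfolding moebius_def by blast
  let ?u = "\<lambda>p. (a * fst (homog p) + b * snd (homog p), c * fst (homog p) + d * snd (homog p))"
  have "?u p \<noteq> (0, 0)" for p
  proof
    assume u: "?u p = (0, 0)"
    have "(a * d - b * c) * fst (homog p) = d * fst (?u p) - b * snd (?u p)"
      "(a * d - b * c) * snd (homog p) = a * snd (?u p) - c * fst (?u p)"
      by (simp_all add: algebra_simps)
    then have "fst (homog p) = 0" "snd (homog p) = 0" using det unfolding u by auto
    then show False by (cases p) auto
  qed
  then have "\<exists>k. k \<noteq> 0 \<and> fst (?u p) = k * fst (homog (m p)) \<and> snd (?u p) = k * snd (homog (m p))" for p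
    unfolding m using homog_of_homog[of "?u p"] by metis
  then obtain k where k: "\<And>p. k p \<noteq> 0" "\<And>p. fst (?u p) = k p * fst (homog (m p))"
    "\<And>p. snd (?u p) = k p * snd (homog (m p))" by metis
  have "(a * d - b * c) * sphere_diff p q = k p * k q * sphere_diff (m p) (m q)" for p q
  proof -
    have "(a * d - b * c) * sphere_diff p q = fst (?u p) * snd (?u q) - fst (?u q) * snd (?u p)"
      by (simp add: sphere_diff_def algebra_simps)
    also have "\<dots> = k p * k q * sphere_diff (m p) (m q)"
      unfolding k(2) k(3) by (simp add: sphere_diff_def algebra_simps)
    finally show ?thesis .
  qed
  with det k(1) that show ?thesis by blast
qed

lemma sphere_diff_eq_0_iff: "sphere_diff p q = 0 \<longleftrightarrow> p = q"
  by (cases p; cases q) (auto simp: sphere_diff_def)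

lemma moebius_inj:
  assumes "moebius m" shows "inj m"
proof -
  obtain \<delta> k where "\<delta> \<noteq> 0" "\<And>p. k p \<noteq> 0"
    "\<And>p q. \<delta> * sphere_diff p q = k p * k q * sphere_diff (m p) (m q)"
    using moebius_homog[OF assms] by blast
  then show ?thesis by (metis injI mult_eq_0_iff sphere_diff_eq_0_iff)
qed

lemma edge_cross_ratio_moebius:
  assumes "moebius m"
  shows "edge_cross_ratio (m p) (m q) (m r) (m s) = edge_cross_ratio p q r s"
proof -
  obtain \<delta> k where k: "\<delta> \<noteq> 0" "\<And>p. k p \<noteq> 0"
    "\<And>p q. \<delta> * sphere_diff p q = k p * k q * sphere_diff (m p) (m q)"
    using moebius_homog[OF assms] by blast
  then have sd: "sphere_diff p q = k p * k q / \<delta> * sphere_diff (m p) (m q)" for p q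
    by (simp add: field_simps)
  let ?K = "k p * k q * k r * k s / \<delta>\<^sup>2"
  have K: "?K \<noteq> 0" using k by simp
  have n: "sphere_diff r p * sphere_diff s q = ?K * (sphere_diff (m r) (m p) * sphere_diff (m s) (m q))"
    and d: "sphere_diff p s * sphere_diff q r = ?K * (sphere_diff (m p) (m s) * sphere_diff (m q) (m r))"
    by (simp_all add: sd[of r p] sd[of s q] sd[of p s] sd[of q r] power2_eq_square)
  show ?thesis
    unfolding edge_cross_ratio_def n d minus_divide_left[symmetric] using K by simp
qed

context torus
begin

text \<open>Integrating the closed form \<open>E\<close> along paths gives the vertex positions, on
  which loops act by translation by their periods.\<close>

lemma induces_euclidean_torusI:
  fixes E :: "'d \<Rightarrow> complex"
  assumes E: "cocycle E" and nz: "\<And>d. E d \<noteq> 0"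
    and X: "\<And>d. X d * E (nx d) * E (nx (rv d)) = - E (nx (nx d)) * E (nx (nx (rv d)))"
  shows "induces_euclidean_torus M b X"
proof -
  define S where "S p = sum_list (map E p)" for p
  have el: "S p = S q" if "elementary_homotopy M b p q" for p q
    using that
  proof induction
    case (backtrack p d q)
    then show ?case by (simp add: S_def cocycle_rv[OF E])
  next
    case (triangle p d q)
    then show ?case using cocycle_face[OF E, of d] by (simp add: S_def add.assoc[symmetric])
  qed
  have hom: "S p = S q" if "homotopic_paths_from M b p q" for p q
    using that unfolding homotopic_paths_from_def
    by (induction rule: rtranclp_induct) (use el in \<open>auto simp: S_def\<close>)
  define s where "s C = S (SOME p. p \<in> C)" for C
  have s: "s (hclass M b p) = S p" for p
  proof -
    have "(SOME q. q \<in> hclass M b p) \<in> hclass M b p" by (rule someI[of _ p]) simp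
    then show ?thesis using hom by (simp add: s_def hclass_def)
  qed
  let ?z = "\<lambda>C. Some (s C)" and ?\<rho> = "\<lambda>C. translation (s C)"
  have "developing_map M b X ?z"
    unfolding developing_map_def
  proof (intro allI impI)
    fix p d
    have l: "E (nx (rv d)) - E d = - E (nx (nx (rv d)))"
      using cocycle_face[OF E, of "rv d"] cocycle_rv[OF E, of d]
      by (metis add.commute diff_0 diff_add_cancel diff_minus_eq_add eq_diff_eq minus_diff_eq uminus_add_conv_diff)
    have k: "E d + E (nx d) = - E (nx (nx d))"
      using cocycle_face[OF E, of d] by (simp add: eq_neg_iff_add_eq_0)
    have "edge_cross_ratio (Some (S p)) (Some (S (p @ [d]))) (Some (S (p @ [d, nx d]))) (Some (S (p @ [nx (rv d)])))
       = - ((E d + E (nx d)) * (E (nx (rv d)) - E d)) / ((- E (nx (rv d))) * (- E (nx d)))"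
      by (simp add: edge_cross_ratio_def sphere_diff_def S_def algebra_simps)
    also have "\<dots> = X d"
      unfolding l k using X[of d] nz by (simp add: field_simps)
    finally show "X d = edge_cross_ratio (?z (hclass M b p)) (?z (hclass M b (p @ [d])))
          (?z (hclass M b (p @ [d, nx d]))) (?z (hclass M b (p @ [nx (rv d)])))"
      by (simp only: s)
  qed
  moreover have "holonomy M b ?z ?\<rho>"
    unfolding holonomy_def by (auto simp: moebius_translation s S_def add.commute)
  moreover have "(\<lambda>p. p) \<circ> ?\<rho> C \<circ> inv (\<lambda>p. p) = translation (s C)" for C
    by (auto simp: inv_id[unfolded id_def] fun_eq_iff)
  ultimately show ?thesis
    unfolding induces_euclidean_torus_def
    by (intro exI[of _ ?z] exI[of _ ?\<rho>] exI[of _ "\<lambda>p. p"] conjI moebius_id) blast+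
qed

definition reverse_path :: "'d list \<Rightarrow> 'd list" where
  "reverse_path p = map rv (rev p)"

lemma reverse_path: "path_from M v p \<Longrightarrow> path_from M (path_end M v p) (reverse_path p)
    \<and> path_end M (path_end M v p) (reverse_path p) = v"
  by (induction p arbitrary: v) (auto simp: reverse_path_def)

lemma homotopic_reverse_path:
  "path_from M (org M b) (p @ reverse_path r @ r @ q) \<Longrightarrow>
     homotopic_paths_from M b (p @ reverse_path r @ r @ q) (p @ q)"
proof (induction r arbitrary: p q)
  case (Cons x r)
  let ?u = "p @ reverse_path r" and ?v = "r @ q"
  have eq: "p @ reverse_path (x # r) @ (x # r) @ q = ?u @ [rv x, rv (rv x)] @ ?v"
    by (simp add: reverse_path_def)
  have pf: "path_from M (org M b) (?u @ [rv x, rv (rv x)] @ ?v)"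
    using Cons.prems unfolding eq .
  then have "homotopic_paths_from M b (?u @ [rv x, rv (rv x)] @ ?v) (?u @ ?v)"
    by (intro elementary_homotopic elementary_homotopy.backtrack)
  moreover have "homotopic_paths_from M b (?u @ ?v) (p @ q)"
    using Cons.IH[of p q] pf by auto
  ultimately show ?case unfolding eq by (rule homotopic_trans)
qed (simp add: reverse_path_def)

lemma ex_path: "\<exists>p. path_from M (org M b) p \<and> path_end M (org M b) p = org M d"
proof (rule dart_induct[of _ b])
  show "\<exists>p. path_from M (org M b) p \<and> path_end M (org M b) p = org M b"
    by (rule exI[of _ "[]"]) simp
  have st: "\<exists>p. path_from M (org M b) p \<and> path_end M (org M b) p = org M (rv d)"
    if ex: "\<exists>p. path_from M (org M b) p \<and> path_end M (org M b) p = org M d" for d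
  proof -
    from ex obtain p where "path_from M (org M b) p \<and> path_end M (org M b) p = org M d" by blast
    then show ?thesis by (intro exI[of _ "p @ [d]"]) simp
  qed
  then show "\<exists>p. path_from M (org M b) p \<and> path_end M (org M b) p = org M (rv d)"
    if "\<exists>p. path_from M (org M b) p \<and> path_end M (org M b) p = org M d" for d using that .
  show "\<exists>p. path_from M (org M b) p \<and> path_end M (org M b) p = org M (nx d)"
    if "\<exists>p. path_from M (org M b) p \<and> path_end M (org M b) p = org M d" for d
    using st[OF that] by simp
qed

lemma sphere_diff_translation [simp]:
  "sphere_diff (translation c p) (translation c q) = sphere_diff p q"
  by (cases p; cases q) (auto simp: sphere_diff_def translation_def)

lemma snd_homog_translation [simp]: "snd (homog (translation c p)) = snd (homog p)"
  by (cases p) (auto simp: translation_def)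

text \<open>Translations preserve determinants of homogeneous coordinates and their second
  components, so both descend from the universal cover to the darts of the torus. \<open>l\<close>
  is the edge difference, and \<open>s\<close> is 0 at vertices developed to infinity, which are not
  excluded at this stage. The last relation is the Pluecker relation of three vectors in
  C^2.\<close>

lemma euclidean_torus_data:
  assumes ind: "induces_euclidean_torus M b X" and nz: "\<And>d. X d \<noteq> 0"
  obtains l s :: "'d \<Rightarrow> complex" where
    "\<And>d. l d \<noteq> 0" "\<And>d. l (rv d) = - l d"
    "\<And>d. X d * l (nx d) * l (nx (rv d)) = - l (nx (nx d)) * l (nx (nx (rv d)))"
    "\<And>d. s d = 0 \<or> s d = 1" "\<And>d. s (nx d) = s (rv d)" "\<And>d. s d \<noteq> 0 \<or> s (rv d) \<noteq> 0"
    "\<And>d. l d * s (nx (nx d)) + l (nx d) * s d + l (nx (nx d)) * s (nx d) = 0"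
proof -
  obtain z \<rho> m where dev: "developing_map M b X z" and hol: "holonomy M b z \<rho>" and m: "moebius m"
    and tr: "\<And>g. g \<in> based_loops M b \<Longrightarrow> \<exists>c. m \<circ> \<rho> (hclass M b g) \<circ> inv m = translation c"
    using ind unfolding induces_euclidean_torus_def by blast
  define w where "w p = m (z (hclass M b p))" for p
  have w_hom: "w p = w q" if "homotopic_paths_from M b p q" for p q
    using hclass_eqI[OF that] by (simp add: w_def)
  have w_tr: "\<exists>c. \<forall>p. path_from M (org M b) p \<longrightarrow> w (g @ p) = translation c (w p)" if g: "g \<in> based_loops M b" for g
  proof -
    obtain c where c: "m \<circ> \<rho> (hclass M b g) \<circ> inv m = translation c" using tr[OF g] by blast
    have "w (g @ p) = translation c (w p)" if "path_from M (org M b) p" for p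
    proof -
      have "w (g @ p) = m (\<rho> (hclass M b g) (z (hclass M b p)))"
        using hol g that unfolding holonomy_def w_def by auto
      also have "\<dots> = (m \<circ> \<rho> (hclass M b g) \<circ> inv m) (w p)"
        by (simp add: w_def inv_f_f[OF moebius_inj[OF m]])
      finally show ?thesis by (simp add: c)
    qed
    then show ?thesis by blast
  qed
  define pth where "pth v = (SOME p. path_from M (org M b) p \<and> path_end M (org M b) p = v)" for v
  have pth: "path_from M (org M b) (pth (org M d))" "path_end M (org M b) (pth (org M d)) = org M d" for d
    using someI_ex[OF ex_path[of b d]] unfolding pth_def by auto
  define W where "W d q = w (pth (org M d) @ q)" for d q
  \<comment> \<open>The chosen paths to the two ends of \<open>d\<close> differ by the loop
    \<open>?g\<close>, whose translation relates the two developed pictures.\<close>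
  have "\<exists>c. \<forall>q. path_from M (org M (rv d)) q \<longrightarrow> W d (d # q) = translation c (W (rv d) q)" for d
  proof -
    let ?p = "pth (org M d) @ [d]" and ?r = "pth (org M (rv d))"
    let ?g = "?p @ reverse_path ?r"
    have r: "path_from M (org M (rv d)) (reverse_path ?r)" "path_end M (org M (rv d)) (reverse_path ?r) = org M b"
      using reverse_path[OF pth(1)[of "rv d"]] pth(2)[of "rv d"] by auto
    have g: "?g \<in> based_loops M b"
      using pth[of d] r by (simp add: based_loops_def)
    then obtain c where c: "\<And>p. path_from M (org M b) p \<Longrightarrow> w (?g @ p) = translation c (w p)"
      using w_tr by blast
    have "W d (d # q) = translation c (W (rv d) q)" if q: "path_from M (org M (rv d)) q" for q
    proof -
      have pf: "path_from M (org M b) (?r @ q)" using pth[of "rv d"] q by simp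
      have "path_from M (org M b) (?p @ reverse_path ?r @ ?r @ q)"
        using pth[of d] pth[of "rv d"] r q by simp
      from w_hom[OF homotopic_reverse_path[OF this]] c[OF pf]
      show ?thesis by (simp add: W_def)
    qed
    then show ?thesis by blast
  qed
  then obtain c where c: "\<And>d q. path_from M (org M (rv d)) q \<Longrightarrow> W d (d # q) = translation (c d) (W (rv d) q)"
    by metis
  have bk: "W d (d # rv d # q) = W d q" if "path_from M (org M d) q" for d q
    unfolding W_def
    by (rule w_hom, rule elementary_homotopic, rule elementary_homotopy.backtrack[of M b "pth (org M d)" d q, simplified])
       (use pth[of d] that in simp)
  have tri: "W d (d # nx d # nx (nx d) # q) = W d q" if "path_from M (org M d) q" for d q
    unfolding W_def
    by (rule w_hom, rule elementary_homotopic, rule elementary_homotopy.triangle[of M b "pth (org M d)" d q, simplified])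
       (use pth[of d] that in simp)
  have W_nx: "W (nx d) = W (rv d)" for d by (simp add: W_def fun_eq_iff)
  define l where "l d = sphere_diff (W d []) (W d [d])" for d
  define s where "s d = snd (homog (W d []))" for d
  have l_rv: "l (rv d) = sphere_diff (W d [d]) (W d [])" for d
    using c[of d "[]"] c[of d "[rv d]"] bk[of d "[]"] by (simp add: l_def)
  have s_rv: "s (rv d) = snd (homog (W d [d]))" for d
    using c[of d "[]"] by (simp add: s_def)
  have l_nx: "l (nx d) = sphere_diff (W d [d]) (W d [d, nx d])" for d
    using W_nx[of d] c[of d "[]"] c[of d "[nx d]"] by (simp add: l_def)
  have s_nx: "s (nx d) = s (rv d)" for d unfolding s_def W_nx ..
  have l_nx2: "l (nx (nx d)) = sphere_diff (W d [d, nx d]) (W d [])" for d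
    using W_nx[of d] c[of d "[nx d]"] c[of d "[nx d, nx (nx d)]"] tri[of d "[]"] l_nx[of "nx d"] by simp
  have s_nx2: "s (nx (nx d)) = snd (homog (W d [d, nx d]))" for d
    using W_nx[of d] c[of d "[nx d]"] s_nx[of "nx d"] s_rv[of "nx d"] by simp
  have r1: "l (nx (rv d)) = sphere_diff (W d []) (W d [nx (rv d)])"
    and r2: "l (nx (nx (rv d))) = sphere_diff (W d [nx (rv d)]) (W d [d])" for d
  proof -
    note b = bk[of d "[]"] bk[of d "[nx (rv d)]"]
    show "l (nx (rv d)) = sphere_diff (W d []) (W d [nx (rv d)])"
      using l_nx[of "rv d"] c[of d "[rv d]"] c[of d "[rv d, nx (rv d)]"] b by simp
    show "l (nx (nx (rv d))) = sphere_diff (W d [nx (rv d)]) (W d [d])"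
      using l_nx2[of "rv d"] c[of d "[]"] c[of d "[rv d, nx (rv d)]"] b by simp
  qed
  have cr: "X d = - (l (nx (nx d)) * l (nx (nx (rv d)))) / (l (nx (rv d)) * l (nx d))" for d
  proof -
    have "X d = edge_cross_ratio (w (pth (org M d))) (w (pth (org M d) @ [d]))
                (w (pth (org M d) @ [d, nx d])) (w (pth (org M d) @ [nx (rv d)]))"
      using dev pth[of d] unfolding developing_map_def w_def edge_cross_ratio_moebius[OF m] by blast
    also have "\<dots> = edge_cross_ratio (W d []) (W d [d]) (W d [d, nx d]) (W d [nx (rv d)])"
      by (simp add: W_def)
    also have "\<dots> = - (l (nx (nx d)) * l (nx (nx (rv d)))) / (l (nx (rv d)) * l (nx d))"
      unfolding edge_cross_ratio_def l_nx2[of d] l_nx[of d] r1 r2 ..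
    finally show ?thesis .
  qed
  have lnz: "l d \<noteq> 0" for d
    using nz[of "nx (nx d)"] cr[of "nx (nx d)"] by auto
  show ?thesis
  proof (rule that[of l s])
    show "l d \<noteq> 0" for d by (rule lnz)
    show "l (rv d) = - l d" for d unfolding l_rv by (simp add: l_def sphere_diff_def)
    show "X d * l (nx d) * l (nx (rv d)) = - l (nx (nx d)) * l (nx (nx (rv d)))" for d
      using lnz by (subst cr) (simp add: field_simps)
    show "s d = 0 \<or> s d = 1" for d unfolding s_def by (cases "W d []") auto
    show "s (nx d) = s (rv d)" for d by (rule s_nx)
    show "s d \<noteq> 0 \<or> s (rv d) \<noteq> 0" for d
      using lnz[of d] unfolding s_rv unfolding s_def l_def by (auto simp: sphere_diff_def)
    show "l d * s (nx (nx d)) + l (nx d) * s d + l (nx (nx d)) * s (nx d) = 0" for d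
      unfolding l_nx[of d] l_nx2[of d] s_nx[of d] s_rv[of d] s_nx2[of d] unfolding s_def l_def
      by (simp add: sphere_diff_def algebra_simps)
  qed
qed

end

section \<open>Existence of flat sections\<close>

context angled_torus
begin

text \<open>\<open>f\<close> and \<open>f'\<close> are the determinants of a vector of the invariant
  line with the vectors at the origin and target of \<open>d\<close>, up to the factors \<kappa> and
  \<mu>; the last assumption is the Pluecker relation in a triangle. The displayed point is the
  cross ratio of the fixed point with the three vertices.\<close>

lemma flat_of_sections:
  fixes l f f' \<kappa> \<mu> :: "'d \<Rightarrow> complex"
  assumes l: "\<And>d. l d \<noteq> 0" "\<And>d. l (rv d) = - l d"
    and X: "\<And>d. X d * l (nx d) * l (nx (rv d)) = - l (nx (nx d)) * l (nx (nx (rv d)))"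
    and f: "\<And>d. f d \<noteq> 0 \<or> f' d \<noteq> 0"
    and \<kappa>: "\<And>d. \<kappa> d \<noteq> 0" "\<And>d. f (rv d) = \<kappa> d * f' d" "\<And>d. f' (rv d) = \<kappa> d * f d"
    and \<mu>: "\<And>d. \<mu> d \<noteq> 0" "\<And>d. f (nx d) = \<mu> d * f' d"
      "\<And>d. l d * f' (nx d) = - \<mu> d * (l (nx d) * f d + l (nx (nx d)) * f' d)"
  shows "flat X (\<lambda>d. of_homog (- f d * l (nx d), f' d * l (nx (nx d))))"
  unfolding flat_def
proof (intro allI conjI)
  fix d
  let ?P = "\<lambda>d. of_homog (- f d * l (nx d), f' d * l (nx (nx d)))"
  have X0: "X d = - l (nx (nx d)) * l (nx (nx (rv d))) / (l (nx d) * l (nx (rv d)))"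
    using X[of d] l(1)[of "nx d"] l(1)[of "nx (rv d)"] by (simp add: field_simps)
  have P: "?P d = (if f' d = 0 then None else Some (- f d * l (nx d) / (f' d * l (nx (nx d)))))" for d
    using l(1) by (simp add: of_homog_def)
  define g where "g = l (nx d) * f d + l (nx (nx d)) * f' d"
  have fn: "f' (nx d) = - \<mu> d * g / l d"
    using \<mu>(3)[of d] l(1)[of d] by (simp add: g_def field_simps)
  show "?P (nx d) = (case ?P d of None \<Rightarrow> Some 0 | Some z \<Rightarrow> if z = 1 then None else Some (1 / (1 - z)))"
  proof (cases "f' d = 0")
    case True
    then have "f d \<noteq> 0" using f[of d] by simp
    then have "f' (nx d) \<noteq> 0" using True fn l(1) \<mu>(1) by (simp add: g_def)
    then show ?thesis unfolding P using True \<mu>(2)[of d] by simp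
  next
    case False
    let ?z = "- f d * l (nx d) / (f' d * l (nx (nx d)))"
    have z1: "1 - ?z = g / (f' d * l (nx (nx d)))"
      using False l(1) by (simp add: g_def field_simps)
    have "1 - ?z = 0 \<longleftrightarrow> f' (nx d) = 0"
      unfolding z1 fn using False l(1) \<mu>(1) by simp
    then have iff: "?z = 1 \<longleftrightarrow> f' (nx d) = 0" by (metis eq_iff_diff_eq_0)
    have "- f (nx d) * l (nx (nx d)) / (f' (nx d) * l (nx (nx (nx d)))) = 1 / (1 - ?z)" if "f' (nx d) \<noteq> 0"
      using that False l(1) \<mu>(1)[of d] unfolding z1 fn \<mu>(2)[of d] by (simp add: field_simps)
    then show ?thesis unfolding P using False iff by simp
  qed
  show "?P (rv d) = (case ?P d of None \<Rightarrow> Some 0 | Some z \<Rightarrow> if z = 0 then None else Some (-1 / (X d * z)))"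
    unfolding P using \<kappa>[of d] l(1) f[of d] by (auto simp: X0 field_simps)
qed

definition cross_ratio_of :: "('d \<Rightarrow> complex) \<Rightarrow> ('d \<Rightarrow> complex) \<Rightarrow> bool" where
  "cross_ratio_of X l \<longleftrightarrow> (\<forall>d. l d \<noteq> 0 \<and>
     X d * l (nx d) * l (nx (rv d)) = - l (nx (nx d)) * l (nx (nx (rv d))))"

text \<open>\<open>Im (cnj (F d) * F (nx d))\<close> is twice the Euclidean area of the triangle,
  and all triangles are positively oriented.\<close>

lemma pairing_Re_Im_nonzero:
  assumes Q: "\<And>d. 0 < Im (Q d)" and F: "\<And>d. F d \<noteq> 0" "\<And>d. (1 - Q d) * F (nx d) = Q d * F d"
  shows "pairing (\<lambda>d. Re (F d)) (\<lambda>d. Im (F d)) \<noteq> 0"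
proof -
  have "wedge (\<lambda>d. Re (F d)) (\<lambda>d. Im (F d)) d > 0" for d
  proof -
    have "Q d \<noteq> 1" using Q[of d] by auto
    then have q: "1 - Q d \<noteq> 0" by simp
    have "F (nx d) = (1 / (1 - Q d) - 1) * F d"
      using F(2)[of d] q by (simp add: field_simps)
    then have "cnj (F d) * F (nx d) = (1 / (1 - Q d) - 1) * of_real ((cmod (F d))\<^sup>2)"
      by (simp add: complex_norm_square mult_ac del: of_real_power)
    then have "Im (cnj (F d) * F (nx d)) = Im (1 / (1 - Q d)) * (cmod (F d))\<^sup>2"
      by (simp add: Im_divide)
    moreover have "Im (1 / (1 - Q d)) > 0"
      using Im_one_over_one_minus_pos_iff[OF \<open>Q d \<noteq> 1\<close>] Q[of d] by simp
    ultimately have "Im (cnj (F d) * F (nx d)) > 0" using F(1) by simp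
    then show ?thesis by (simp add: wedge_def algebra_simps)
  qed
  then have "pairing (\<lambda>d. Re (F d)) (\<lambda>d. Im (F d)) > 0"
    unfolding pairing_def by (intro sum_pos) auto
  then show ?thesis by simp
qed

text \<open>Translations fix infinity, whose determinants with the vertices are the numbers
  \<open>s\<close>. As the fixed point is never at a vertex, \<open>s = 1\<close> throughout: no
  vertex develops to infinity and \<open>l\<close> is a closed form of edge vectors.\<close>

lemma euclidean_shape:
  assumes X: "has_angles X" and ind: "induces_euclidean_torus M b X"
  obtains Q F where "shape X Q" "cocycle F" "cross_ratio_of X F"
    "pairing (\<lambda>d. Re (F d)) (\<lambda>d. Im (F d)) \<noteq> 0"
proof -
  have nz: "X d \<noteq> 0" for d using X by (simp add: has_angles_def)
  obtain l s :: "'d \<Rightarrow> complex" where l: "\<And>d. l d \<noteq> 0" "\<And>d. l (rv d) = - l d"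
    "\<And>d. X d * l (nx d) * l (nx (rv d)) = - l (nx (nx d)) * l (nx (nx (rv d)))"
    and s: "\<And>d. s d = 0 \<or> s d = 1" "\<And>d. s (nx d) = s (rv d)" "\<And>d. s d \<noteq> 0 \<or> s (rv d) \<noteq> 0"
    "\<And>d. l d * s (nx (nx d)) + l (nx d) * s d + l (nx (nx d)) * s (nx d) = 0"
    using euclidean_torus_data[OF ind nz] by metis
  have "flat X (\<lambda>d. of_homog (- s d * l (nx d), s (rv d) * l (nx (nx d))))"
  proof (rule flat_of_sections[where \<kappa>="\<lambda>_. 1" and \<mu>="\<lambda>_. 1", OF l s(3)])
    show "l d * s (rv (nx d)) = - 1 * (l (nx d) * s d + l (nx (nx d)) * s (rv d))" for d
      using s(4)[of d] s(2)[of d] s(2)[of "nx d"] by (simp add: add_eq_0_iff algebra_simps)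
  qed (simp_all add: s(2))
  from flat_weak_shape[OF X this] obtain Q
    where PQ: "\<And>d. of_homog (- s d * l (nx d), s (rv d) * l (nx (nx d))) = Some (Q d)"
      and Q: "weak_shape X Q" by metis
  have "s (rv d) \<noteq> 0" for d using PQ[of d] by (auto simp: of_homog_def)
  from this[of "rv d" for d] have s1: "s d = 1" for d using s(1)[of d] by simp
  have lc: "l d + l (nx d) + l (nx (nx d)) = 0" for d using s(4)[of d] by (simp add: s1)
  have Qd: "Q d = - l (nx d) / l (nx (nx d))" for d
    using PQ[of d] l(1) by (simp add: s1 of_homog_def)
  have r: "(1 - Q d) * l (nx d) = Q d * l d" for d
  proof -
    have "l (nx (nx d)) = (l d + l (nx d) + l (nx (nx d))) - l d - l (nx d)" by simp
    then have e: "l (nx (nx d)) = - l d - l (nx d)" unfolding lc by simp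
    then have "- l d - l (nx d) \<noteq> 0" using l(1)[of "nx (nx d)"] by simp
    then show ?thesis unfolding Qd e by (simp add: field_simps)
  qed
  have Qs: "shape X Q" by (rule weak_shape_lengths[OF X Q l(1,2) r lc])
  moreover have "cocycle l" using l(2) lc by (simp add: cocycle_def)
  moreover have "cross_ratio_of X l" using l(1,3) by (simp add: cross_ratio_of_def)
  moreover have "pairing (\<lambda>d. Re (l d)) (\<lambda>d. Im (l d)) \<noteq> 0"
    by (rule pairing_Re_Im_nonzero[of Q, OF _ l(1) r]) (use Qs in \<open>simp add: shape_def\<close>)
  ultimately show ?thesis using that by blast
qed

end

section \<open>Surjectivity of Penner's linear map\<close>

context torus
begin

text \<open>The numbers \<open>a\<^sub>i\<^sub>j + a\<^sub>k\<^sub>i - a\<^sub>j\<^sub>k\<close> at the corners are constant around a vertex if \<open>h a = 0\<close>.\<close>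

lemma penner_h_kernel:
  assumes a: "\<And>d. a (rv d) = a d" and h: "penner_h M a = (\<lambda>_. 0)"
  obtains s where "\<And>d e. org M d = org M e \<Longrightarrow> s d = s e" "\<And>d. a d = s d + s (rv d)"
proof -
  define s where "s d = (a d + a (nx (nx d)) - a (nx d)) / 2" for d
  have cw: "s (cw M d) = s d" for d
    using fun_cong[OF h, of d] by (simp add: s_def cw_def penner_h_def a)
  have c: "s d = s e" if "org M d = org M e" for d e
    by (rule const_on_org[of s, OF cw]) (simp add: org_eq_iff that)
  have "a d = s d + s (rv d)" for d
  proof -
    have "s (rv d) = s (nx d)" by (rule c) simp
    moreover have "a d = s d + s (nx d)" by (simp add: s_def field_simps)
    ultimately show ?thesis by simp
  qed
  with c that show ?thesis by blast
qed

lemma penner_h_skew: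
  "(\<Sum>d\<in>UNIV. a d * penner_h M b d) = - (\<Sum>d\<in>UNIV. penner_h M a d * b d)"
  if a: "\<And>d. a (rv d) = a d" and b: "\<And>d. b (rv d) = b d"
proof -
  have e: "(\<Sum>d\<in>UNIV. a d * penner_h M b d) = 2 * (\<Sum>d\<in>UNIV. a d * b (nx (nx d)) - a d * b (nx d))"
    if a: "\<And>d. a (rv d) = a d" for a b
  proof -
    have "(\<Sum>d\<in>UNIV. a d * (b (nx (nx (rv d))) - b (nx (rv d)))) = (\<Sum>d\<in>UNIV. a d * (b (nx (nx d)) - b (nx d)))"
      using sum_rv[of "\<lambda>d. a d * (b (nx (nx d)) - b (nx d))"] by (simp add: a)
    then show ?thesis
      by (simp add: penner_h_def sum.distrib sum_subtractf algebra_simps)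
  qed
  have s: "(\<Sum>d\<in>UNIV. a d * b (nx (nx d))) = (\<Sum>d\<in>UNIV. b d * a (nx d))" for a b :: "'d \<Rightarrow> real"
    using sum_nx[of "\<lambda>d. a d * b (nx (nx d))"] by (simp add: mult.commute)
  have "(\<Sum>d\<in>UNIV. penner_h M a d * b d) = (\<Sum>d\<in>UNIV. b d * penner_h M a d)"
    by (simp add: mult.commute)
  then show ?thesis
    unfolding e[of b a, OF b] e[of a b, OF a] sum_subtractf s[of a b] s[of b a] by simp
qed

lemma penner_h_rv: "(\<And>d. a (rv d) = a d) \<Longrightarrow> penner_h M a (rv d) = penner_h M a d"
  by (simp add: penner_h_def)

text \<open>\<open>penner_h\<close> is skew for the standard inner product, so the part
  \<open>u\<close> of \<open>x\<close> orthogonal to its image lies in its kernel. Kernel elements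
  add up a vertex function over the ends of each edge, hence are orthogonal to every vector with
  vanishing vertex sums. So \<open>u\<close> is orthogonal both to \<open>x\<close> and to the
  image, and \<open>u = 0\<close>.\<close>

lemma penner_h_surj:
  assumes x: "x \<in> Teich_tangent M"
  obtains a where "a \<in> edge_functions M" "penner_h M a = x"
proof -
  define H where "H = {\<chi> d. penner_h M a d |a. \<forall>d. a (rv d) = a d}"
  have "subspace H"
    unfolding subspace_def
  proof (intro conjI ballI allI)
    show "0 \<in> H" unfolding H_def
      by (intro CollectI exI[of _ "\<lambda>_. 0"]) (simp add: penner_h_def vec_eq_iff)
    show "u + v \<in> H" if "u \<in> H" "v \<in> H" for u v
    proof -
      from that obtain a b where "u = (\<chi> d. penner_h M a d)" "v = (\<chi> d. penner_h M b d)"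
        "\<forall>d. a (rv d) = a d" "\<forall>d. b (rv d) = b d" unfolding H_def by blast
      then show ?thesis unfolding H_def
        by (intro CollectI exI[of _ "\<lambda>d. a d + b d"]) (simp add: penner_h_def vec_eq_iff)
    qed
    show "c *\<^sub>R u \<in> H" if "u \<in> H" for c u
    proof -
      from that obtain a where u: "u = (\<chi> d. penner_h M a d)"
        and a: "\<forall>d. a (rv d) = a d" unfolding H_def by blast
      show ?thesis unfolding H_def
      proof (intro CollectI exI[of _ "\<lambda>d. c * a d"])
        have "penner_h M (\<lambda>d. c * a d) d = c * penner_h M a d" for d
          by (simp add: penner_h_def algebra_simps)
        then show "c *\<^sub>R u = (\<chi> d. penner_h M (\<lambda>d. c * a d) d) \<and> (\<forall>d. c * a (rv d) = c * a d)"
          using a by (simp add: u vec_eq_iff)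
      qed
    qed
  qed
  obtain y z where y: "y \<in> span H" and z: "\<And>w. w \<in> span H \<Longrightarrow> orthogonal z w"
    and xyz: "(\<chi> d. x d) = y + z"
    using orthogonal_subspace_decomp_exists[of H "\<chi> d. x d"] by metis
  from y \<open>subspace H\<close> have yH: "y \<in> H" by (metis span_eq_iff)
  then obtain a where a: "\<And>d. a (rv d) = a d" and ya: "y = (\<chi> d. penner_h M a d)"
    unfolding H_def by blast
  have xs: "x (rv d) = x d" "(\<Sum>e\<in>org M d. x e) = 0" for d
    using x by (auto simp: Teich_tangent_def edge_functions_def verts_def)
  define u where "u d = z $ d" for d
  have u: "u d = x d - penner_h M a d" for d
    using arg_cong[OF xyz, of "\<lambda>v. v $ d"] by (simp add: u_def ya)
  have u_rv: "u (rv d) = u d" for d by (simp add: u xs penner_h_rv[of a, OF a])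
  have "(\<Sum>d\<in>UNIV. u d * penner_h M v d) = 0" if v: "\<And>d. v (rv d) = v d" for v
  proof -
    have "(\<chi> d. penner_h M v d) \<in> span H" using v by (intro span_base) (auto simp: H_def)
    from z[OF this] show ?thesis by (simp add: orthogonal_def inner_vec_def u_def)
  qed
  then have k: "(\<Sum>d\<in>UNIV. penner_h M u d * v d) = 0" if v: "\<And>d. v (rv d) = v d" for v
    using penner_h_skew[of u v, OF u_rv v] v by simp
  have "(\<Sum>d\<in>UNIV. penner_h M u d * penner_h M u d) = 0"
    by (rule k) (rule penner_h_rv[of u, OF u_rv])
  then have "penner_h M u = (\<lambda>_. 0)"
    by (subst (asm) sum_nonneg_eq_0_iff) auto
  from penner_h_kernel[OF u_rv this] obtain s
    where s: "\<And>d e. org M d = org M e \<Longrightarrow> s d = s e" "\<And>d. u d = s d + s (rv d)" by metis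
  have "(\<Sum>d\<in>UNIV. u d * x d) = 2 * (\<Sum>d\<in>UNIV. s d * x d)"
    using sum_rv[of "\<lambda>d. s d * x d"] by (simp add: s(2) distrib_right sum.distrib xs)
  also have "(\<Sum>d\<in>UNIV. s d * x d) = (\<Sum>v\<in>verts M. \<Sum>d\<in>v. s d * x d)"
    by (rule sum_verts[symmetric])
  also have "\<dots> = 0"
  proof (rule sum.neutral, rule ballI)
    fix v assume "v \<in> verts M"
    then obtain e where v: "v = org M e" by (auto simp: verts_def)
    have "(\<Sum>d\<in>v. s d * x d) = (\<Sum>d\<in>v. s e * x d)"
      by (rule sum.cong) (auto simp: v org_eq_iff intro: s(1))
    then show "(\<Sum>d\<in>v. s d * x d) = 0" by (simp add: v sum_distrib_left[symmetric] xs)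
  qed
  finally have ux: "(\<Sum>d\<in>UNIV. u d * x d) = 0" by simp
  have "orthogonal z y" by (rule z[OF y])
  then have "(\<Sum>d\<in>UNIV. u d * penner_h M a d) = 0"
    by (simp add: orthogonal_def inner_vec_def u_def ya)
  moreover have "(\<Sum>d\<in>UNIV. u d * u d) = (\<Sum>d\<in>UNIV. u d * x d) - (\<Sum>d\<in>UNIV. u d * penner_h M a d)"
    unfolding sum_subtractf[symmetric] right_diff_distrib[symmetric] u[symmetric] ..
  ultimately have "(\<Sum>d\<in>UNIV. u d * u d) = 0" using ux by simp
  then have "u d = 0" for d by (subst (asm) sum_nonneg_eq_0_iff) auto
  then have "penner_h M a = x" using u by auto
  moreover have "a \<in> edge_functions M" using a by (simp add: edge_functions_def)
  ultimately show ?thesis using that by blast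
qed

end

section \<open>Common eigenvectors of commuting linear maps\<close>

definition cscale :: "complex \<Rightarrow> complex \<times> complex \<Rightarrow> complex \<times> complex" where
  "cscale c u = (c * fst u, c * snd u)"

text \<open>The group is written additively, with \<open>f + g\<close> for \<open>f\<close> followed by \<open>g\<close>, to match \<^const>\<open>sum_list\<close>.\<close>

typedef gl2 = "{f :: complex \<times> complex \<Rightarrow> complex \<times> complex.
    bij f \<and> (\<forall>u v. f (u + v) = f u + f v) \<and> (\<forall>c u. f (cscale c u) = cscale c (f u))}"
  by (rule exI[of _ id]) auto

setup_lifting type_definition_gl2

instantiation gl2 :: group_add
begin

lift_definition zero_gl2 :: gl2 is id by simp
lift_definition plus_gl2 :: "gl2 \<Rightarrow> gl2 \<Rightarrow> gl2" is "\<lambda>f g. g \<circ> f"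
  by (simp add: bij_comp del: split_paired_All)
lift_definition uminus_gl2 :: "gl2 \<Rightarrow> gl2" is inv
proof (intro conjI allI)
  fix f :: "complex \<times> complex \<Rightarrow> complex \<times> complex"
  assume f: "bij f \<and> (\<forall>u v. f (u + v) = f u + f v) \<and> (\<forall>c u. f (cscale c u) = cscale c (f u))"
  then show "bij (inv f)" by (simp add: bij_imp_bij_inv)
  show "inv f (u + v) = inv f u + inv f v" for u v
    using f by (metis bij_inv_eq_iff)
  show "inv f (cscale c u) = cscale c (inv f u)" for c u
    using f by (metis bij_inv_eq_iff)
qed
definition minus_gl2 :: "gl2 \<Rightarrow> gl2 \<Rightarrow> gl2" where "minus_gl2 f g = f + - g"

instance
proof
  fix a b c :: gl2
  show "a + b + c = a + (b + c)" by transfer auto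
  show "0 + a = a" "a + 0 = a" by (transfer, simp)+
  show "- a + a = 0" by transfer (auto simp: bij_is_surj surj_f_inv_f fun_eq_iff)
  show "a + - b = a - b" by (simp add: minus_gl2_def)
qed

end

lemma Rep_gl2_add: "Rep_gl2 (f + g) u = Rep_gl2 g (Rep_gl2 f u)"
  by (simp add: plus_gl2.rep_eq)

lemma Rep_gl2_minus [simp]: "Rep_gl2 (- f) (Rep_gl2 f u) = u" "Rep_gl2 f (Rep_gl2 (- f) u) = u"
  using Rep_gl2_add[of f "- f" u] Rep_gl2_add[of "- f" f u] by (simp_all add: zero_gl2.rep_eq)

lemma Rep_gl2_linear: "Rep_gl2 f (u + v) = Rep_gl2 f u + Rep_gl2 f v"
    "Rep_gl2 f (cscale c u) = cscale c (Rep_gl2 f u)"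
  using Rep_gl2[of f] unfolding mem_Collect_eq by blast+

lemma Rep_gl2_zero: "Rep_gl2 f (0, 0) = (0, 0)"
  using Rep_gl2_linear(2)[of f 0 "(0, 0)"] by (simp add: cscale_def)

lemma Rep_gl2_eq_zero_iff: "Rep_gl2 f u = (0, 0) \<longleftrightarrow> u = (0, 0)"
  by (metis Rep_gl2_minus(1) Rep_gl2_zero)

lemma gl2_coords: "Rep_gl2 f (x, y) = cscale x (Rep_gl2 f (1, 0)) + cscale y (Rep_gl2 f (0, 1))"
proof -
  have "(x, y) = cscale x (1, 0) + cscale y (0, 1)" by (simp add: cscale_def)
  then show ?thesis by (metis Rep_gl2_linear)
qed

lemma gl2_eigenvector:
  obtains k u where "u \<noteq> (0, 0)" "Rep_gl2 f u = cscale k u"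
proof -
  obtain a c where ac: "Rep_gl2 f (1, 0) = (a, c)" by (cases "Rep_gl2 f (1, 0)")
  obtain b d where bd: "Rep_gl2 f (0, 1) = (b, d)" by (cases "Rep_gl2 f (0, 1)")
  show ?thesis
  proof (cases "c = 0")
    case True
    then show ?thesis using that[of "(1, 0)" a] ac by (simp add: cscale_def)
  next
    case False
    define s where "s = csqrt ((a + d)\<^sup>2 - 4 * (a * d - b * c))"
    define k where "k = (a + d + s) / 2"
    have s2: "s * s = (a + d) * (a + d) - 4 * (a * d - b * c)"
      using power2_csqrt[of "(a + d)\<^sup>2 - 4 * (a * d - b * c)"] by (simp add: s_def power2_eq_square)
    have "4 * (k * k) = (a + d) * (a + d) + 2 * (a + d) * s + s * s"
      by (simp add: k_def field_simps)
    also have "\<dots> = 4 * ((a + d) * k - (a * d - b * c))"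
      unfolding s2 by (simp add: k_def field_simps)
    finally have k2: "k * k = (a + d) * k - (a * d - b * c)"
      by (simp only: mult_cancel_left) simp
    have "Rep_gl2 f (k - d, c) = cscale k (k - d, c)"
      unfolding gl2_coords[of f "k - d" c] ac bd using k2 by (simp add: cscale_def algebra_simps)
    then show ?thesis using that[of "(k - d, c)"] False by simp
  qed
qed

text \<open>\<open>g\<close> maps an eigenvector \<open>u\<close> of \<open>f\<close> to one with
  the same eigenvalue. Either this is a multiple of \<open>u\<close>, or the two span C^2 and
  \<open>f\<close> is scalar, so that any eigenvector of \<open>g\<close> serves.\<close>

lemma gl2_common_eigenvector:
  assumes comm: "f + g = g + f"
  obtains u k k' where "u \<noteq> (0, 0)" "Rep_gl2 f u = cscale k u" "Rep_gl2 g u = cscale k' u"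
proof -
  obtain u k where u: "u \<noteq> (0, 0)" and fu: "Rep_gl2 f u = cscale k u" by (rule gl2_eigenvector)
  let ?v = "Rep_gl2 g u"
  have fv: "Rep_gl2 f ?v = cscale k ?v"
    by (metis Rep_gl2_add Rep_gl2_linear(2) comm fu)
  show ?thesis
  proof (cases "fst u * snd ?v = snd u * fst ?v")
    case True
    then have "\<exists>k'. ?v = cscale k' u"
    proof (cases "fst u = 0")
      case f0: True
      then have "snd u \<noteq> 0" using u by (cases u) auto
      then show ?thesis using True f0
        by (intro exI[of _ "snd ?v / snd u"]) (auto simp: cscale_def prod_eq_iff)
    next
      case False
      then show ?thesis using True
        by (intro exI[of _ "fst ?v / fst u"]) (auto simp: cscale_def prod_eq_iff field_simps)
    qed
    then show ?thesis using that u fu by blast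
  next
    case False
    let ?D = "fst u * snd ?v - snd u * fst ?v"
    have D: "?D \<noteq> 0" using False by simp
    have all: "Rep_gl2 f w = cscale k w" for w
    proof -
      define p where "p = (fst w * snd ?v - snd w * fst ?v) / ?D"
      define q where "q = (fst u * snd w - snd u * fst w) / ?D"
      have "p * fst u + q * fst ?v = fst w * ?D / ?D" "p * snd u + q * snd ?v = snd w * ?D / ?D"
        unfolding p_def q_def times_divide_eq_left add_divide_distrib[symmetric]
        by (simp_all add: algebra_simps)
      then have w: "w = cscale p u + cscale q ?v"
        using D by (simp add: prod_eq_iff cscale_def)
      have "Rep_gl2 f w = cscale p (cscale k u) + cscale q (cscale k ?v)"
        by (subst w) (simp only: Rep_gl2_linear fu fv)
      also have "\<dots> = cscale k (cscale p u + cscale q ?v)"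
        by (simp add: cscale_def algebra_simps)
      also have "\<dots> = cscale k w" by (simp only: w[symmetric])
      finally show ?thesis .
    qed
    obtain u' k' where "u' \<noteq> (0, 0)" "Rep_gl2 g u' = cscale k' u'" by (rule gl2_eigenvector)
    then show ?thesis using that all by blast
  qed
qed

section \<open>The flat plane bundle and its invariant line\<close>

context torus
begin

lemma cw_potential:
  fixes t :: "'d \<Rightarrow> complex"
  assumes t: "\<And>d. (\<Sum>j<card (org M d). t ((cw M ^^ j) d)) = 0"
  obtains T where "\<And>d. T (cw M d) = T d + t d"
proof -
  define root where "root v = (SOME d. org M d = v)" for v
  have root: "org M (root (org M d)) = org M d" for d
    unfolding root_def by (rule someI[of _ d]) simp
  define ix where "ix d = (SOME m. m < card (org M d) \<and> (cw M ^^ m) (root (org M d)) = d)" for d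
  have ix: "ix d < card (org M d)" "(cw M ^^ ix d) (root (org M d)) = d" for d
  proof -
    have "d \<in> org M (root (org M d))" using root org_eq_iff by simp
    then have "d \<in> (\<lambda>j. (cw M ^^ j) (root (org M d))) ` {..<card (org M (root (org M d)))}"
      using bij_betw_cw_org[OF torus, of "root (org M d)"] unfolding bij_betw_def by simp
    then have "\<exists>m. m < card (org M d) \<and> (cw M ^^ m) (root (org M d)) = d"
      unfolding root by auto
    from someI_ex[OF this] show "ix d < card (org M d)" "(cw M ^^ ix d) (root (org M d)) = d"
      unfolding ix_def by auto
  qed
  have inj: "i = j" if "(cw M ^^ i) (root (org M d)) = (cw M ^^ j) (root (org M d))"
      "i < card (org M d)" "j < card (org M d)" for i j d
    using bij_betw_cw_org[OF torus, of "root (org M d)"] that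
    unfolding bij_betw_def inj_on_def root by auto
  define T where "T d = (\<Sum>j<ix d. t ((cw M ^^ j) (root (org M d))))" for d
  have "T (cw M d) = T d + t d" for d
  proof -
    let ?r = "root (org M d)" and ?n = "card (org M d)"
    have s: "(cw M ^^ Suc (ix d)) ?r = cw M d" using ix(2)[of d] by simp
    have c: "(cw M ^^ ix (cw M d)) ?r = cw M d" "ix (cw M d) < ?n"
      using ix[of "cw M d"] by simp_all
    have sum: "(\<Sum>j<Suc (ix d). t ((cw M ^^ j) ?r)) = T d + t d"
      using ix(2)[of d] by (simp add: T_def)
    show ?thesis
    proof (cases "Suc (ix d) < ?n")
      case True
      then have "ix (cw M d) = Suc (ix d)" using inj[of "ix (cw M d)" d "Suc (ix d)"] s c by simp
      then show ?thesis using sum unfolding T_def[of "cw M d"] org_cw by (simp only:)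
    next
      \<comment> \<open>The turn around the vertex closes here; the vanishing total matches the
        value 0 at the root.\<close>
      case False
      then have n: "Suc (ix d) = ?n" using ix(1)[of d] by simp
      have "ix (cw M d) = 0"
      proof (rule ccontr)
        assume "ix (cw M d) \<noteq> 0"
        then obtain m where m: "ix (cw M d) = Suc m" by (cases "ix (cw M d)") auto
        then have "cw M ((cw M ^^ m) ?r) = cw M ((cw M ^^ ix d) ?r)" using c(1) s by simp
        then have "(cw M ^^ m) ?r = (cw M ^^ ix d) ?r" using bij_cw by (metis bij_is_inj injD)
        then have "m = ix d" using inj[of m d "ix d"] m c(2) ix(1)[of d] by simp
        then show False using m c(2) n by simp
      qed
      then have "T (cw M d) = 0" by (simp add: T_def)
      also have "\<dots> = T d + t d" using t[of ?r] unfolding root n[symmetric] sum by simp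
      finally show ?thesis .
    qed
  qed
  with that show ?thesis by blast
qed

end

context angled_torus
begin

text \<open>\<open>R d\<close> changes coordinates from a frame at the origin of \<open>d\<close> to
  one at its target, which gives a linear cocycle. A common eigenvector of the two generators spans
  a line preserved by all gauged transition maps, that is, a flat section of the projectivised
  bundle.\<close>

lemma ex_flat:
  assumes X: "cross_ratio_system M X" "has_angles X"
    and l: "cross_ratio_of X l" "\<And>d. l (rv d) = - l d"
    and p: "cocycle p" "cocycle q" "pairing p q \<noteq> 0"
  obtains P where "flat X P"
proof -
  have l0: "l d \<noteq> 0" and Xl: "X d * l (nx d) * l (nx (rv d)) = - l (nx (nx d)) * l (nx (nx (rv d)))" for d
    using l(1) by (auto simp: cross_ratio_of_def)
  have X0: "X d \<noteq> 0" for d using X(2) by (auto simp: has_angles_def)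
  \<comment> \<open>With the origin of \<open>d\<close> at infinity, \<open>t d\<close> is the step
    from the position of its target to that of the next neighbour clockwise, a complex counterpart
    of horocyclic lengths. The second vertex condition makes the steps close up, so that positions
    \<open>T\<close> exist.\<close>
  define t where "t d = l (nx (nx (rv d))) / (l (nx (rv d)) * l d)" for d
  have t_cw: "t (cw M d) = X (cw M d) * t d" for d
  proof -
    let ?e = "nx (rv d)"
    have "X ?e * l (nx ?e) * l (nx (rv ?e)) = l d * l (nx (nx (rv ?e)))"
      using Xl[of ?e] l(2)[of d] by simp
    then show ?thesis
      using l0[of d] l0[of ?e] l0[of "nx (rv ?e)"] l0[of "nx ?e"] by (simp add: t_def cw_def field_simps)
  qed
  have "(\<Sum>j<card (org M d). t ((cw M ^^ j) d)) = 0" for d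
  proof -
    have "X d * t ((cw M ^^ m) d) = t d * (\<Prod>j\<le>m. X ((cw M ^^ j) d))" for m
    proof (induction m)
      case (Suc m)
      have "X d * t ((cw M ^^ Suc m) d) = X ((cw M ^^ Suc m) d) * (X d * t ((cw M ^^ m) d))"
        using t_cw[of "(cw M ^^ m) d"] by simp
      then show ?case unfolding Suc.IH by (simp add: mult_ac)
    qed simp
    then have "X d * (\<Sum>j<card (org M d). t ((cw M ^^ j) d))
        = t d * (\<Sum>m<card (org M d). \<Prod>j\<le>m. X ((cw M ^^ j) d))"
      by (simp add: sum_distrib_left)
    also have "\<dots> = 0" using X(1) by (simp add: cross_ratio_system_def Let_def)
    finally show ?thesis using X0[of d] by simp
  qed
  then obtain T where T: "\<And>d. T (cw M d) = T d + t d" using cw_potential[of t] by metis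
  \<comment> \<open>The first coordinate of \<open>u\<close> is its determinant with the vector of
    the vertex, and \<open>l d * (snd u + T d * fst u)\<close> the one with the vector of the target
    of \<open>d\<close>. The second component is forced by
    \<open>R (rv d) (R d u) = u\<close>.\<close>
  define R where "R d u = (l d * (snd u + T d * fst u), - fst u / l d - T (rv d) * (l d * (snd u + T d * fst u)))"
    for d u
  have R_rv: "R (rv d) (R d u) = u" for d u
    using l0[of d] by (simp add: R_def l(2) prod_eq_iff field_simps)
  have R_rv': "R d (R (rv d) u) = u" for d u using R_rv[of "rv d" u] by simp
  have bij: "bij (R d)" for d
    by (rule o_bij[of "R (rv d)"]) (auto simp: R_rv R_rv')
  have next_coord: "l (nx d) * (snd (R d u) + T (nx d) * fst (R d u)) =
      - (l (nx d) * fst u + l (nx (nx d)) * fst (R d u)) / l d" for d u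
  proof -
    have "T (nx d) = T (rv d) + t (rv d)" using T[of "rv d"] by (simp add: cw_def)
    moreover have "t (rv d) = - l (nx (nx d)) / (l (nx d) * l d)" by (simp add: t_def l(2))
    ultimately have Tn: "T (nx d) = T (rv d) - l (nx (nx d)) / (l (nx d) * l d)" by simp
    have s: "snd (R d u) = - fst u / l d - T (rv d) * fst (R d u)" by (simp add: R_def)
    show ?thesis unfolding Tn s using l0[of d] l0[of "nx d"] by (simp add: field_simps)
  qed
  have R_fst: "fst (R d u) = l d * (snd u + T d * fst u)" for d u by (simp add: R_def)
  have R_face: "R (nx (nx d)) (R (nx d) (R d u)) = u" for d u
  proof -
    define a where "a = fst u"
    define b where "b = fst (R d u)"
    define c where "c = fst (R (nx d) (R d u))"
    define e where "e = fst (R (nx (nx d)) (R (nx d) (R d u)))"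
    define h where "h = fst (R (nx (nx (nx d))) (R (nx (nx d)) (R (nx d) (R d u))))"
    have c': "c = - (l (nx d) * a + l (nx (nx d)) * b) / l d"
      unfolding c_def R_fst[of "nx d"] next_coord by (simp add: a_def b_def)
    have e': "e = - (l (nx (nx d)) * b + l d * c) / l (nx d)"
      unfolding e_def R_fst[of "nx (nx d)"] next_coord by (simp add: b_def c_def)
    have h': "h = - (l d * c + l (nx d) * e) / l (nx (nx d))"
      unfolding h_def R_fst[of "nx (nx (nx d))"] next_coord by (simp add: e_def c_def)
    have ea: "e = a" unfolding e' c' using l0 by (simp add: field_simps)
    have hb: "h = b" unfolding h' ea c' using l0 by (simp add: field_simps)
    let ?w = "R (nx (nx d)) (R (nx d) (R d u))"
    have 1: "fst ?w = fst u" using ea by (simp add: e_def a_def)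
    have "l d * (snd ?w + T d * fst ?w) = l d * (snd u + T d * fst u)"
      using hb R_fst[of d ?w] R_fst[of d u] by (simp only: h_def b_def nx3)
    then have "snd ?w = snd u" unfolding 1 using l0[of d] by simp
    with 1 show ?thesis by (simp add: prod_eq_iff)
  qed
  define \<rho> where "\<rho> d = Abs_gl2 (R d)" for d
  have Rep: "Rep_gl2 (\<rho> d) = R d" for d
    unfolding \<rho>_def
    by (rule Abs_gl2_inverse) (auto simp: bij, auto simp: R_def cscale_def algebra_simps diff_divide_distrib add_divide_distrib)
  have "\<rho> (rv d) = - \<rho> d" for d
  proof -
    have "Rep_gl2 (\<rho> d + \<rho> (rv d)) = Rep_gl2 0"
      by (rule ext) (simp only: Rep_gl2_add Rep R_rv zero_gl2.rep_eq id_apply)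
    then have "\<rho> d + \<rho> (rv d) = 0" by (simp add: Rep_gl2_inject)
    then show ?thesis by (simp add: neg_eq_iff_add_eq_0[symmetric])
  qed
  moreover have "\<rho> d + \<rho> (nx d) + \<rho> (nx (nx d)) = 0" for d
  proof -
    have "Rep_gl2 (\<rho> d + \<rho> (nx d) + \<rho> (nx (nx d))) = Rep_gl2 0"
      by (rule ext) (simp only: Rep_gl2_add Rep R_face zero_gl2.rep_eq id_apply)
    then show ?thesis by (simp add: Rep_gl2_inject)
  qed
  ultimately have \<rho>: "cocycle \<rho>" by (simp add: cocycle_def)
  obtain g a b where comm: "gauge g \<rho> a + gauge g \<rho> b = gauge g \<rho> b + gauge g \<rho> a"
    and gen: "\<And>H d. gauge g \<rho> a \<in> H \<Longrightarrow> gauge g \<rho> b \<in> H \<Longrightarrow> (\<And>x y. x \<in> H \<Longrightarrow> y \<in> H \<Longrightarrow> x + y \<in> H) \<Longrightarrow>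
       (\<And>x. x \<in> H \<Longrightarrow> - x \<in> H) \<Longrightarrow> gauge g \<rho> d \<in> H"
    using commuting_generators[OF \<rho> p] by blast
  obtain u k k' where u: "u \<noteq> (0, 0)" and ku: "Rep_gl2 (gauge g \<rho> a) u = cscale k u"
     "Rep_gl2 (gauge g \<rho> b) u = cscale k' u"
    using gl2_common_eigenvector[OF comm] by blast
  define H where "H = {h. \<exists>c. Rep_gl2 h u = cscale c u}"
  have H: "gauge g \<rho> d \<in> H" for d
  proof (rule gen)
    show "gauge g \<rho> a \<in> H" "gauge g \<rho> b \<in> H" using ku by (auto simp: H_def)
    show "x + y \<in> H" if xy: "x \<in> H" "y \<in> H" for x y
    proof -
      obtain c c' where "Rep_gl2 x u = cscale c u" "Rep_gl2 y u = cscale c' u" using xy by (auto simp: H_def)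
      then have "Rep_gl2 (x + y) u = cscale (c * c') u"
        by (simp add: Rep_gl2_add Rep_gl2_linear) (simp add: cscale_def)
      then show ?thesis by (auto simp: H_def)
    qed
    show "- x \<in> H" if x: "x \<in> H" for x
    proof -
      obtain c where c: "Rep_gl2 x u = cscale c u" using x by (auto simp: H_def)
      have "c \<noteq> 0" using c u Rep_gl2_eq_zero_iff[of x u] by (auto simp: cscale_def)
      have "u = cscale c (Rep_gl2 (- x) u)"
        by (metis Rep_gl2_minus(1) Rep_gl2_linear(2) c)
      then have "cscale (1 / c) u = cscale (1 / c) (cscale c (Rep_gl2 (- x) u))" by simp
      also have "\<dots> = Rep_gl2 (- x) u" using \<open>c \<noteq> 0\<close> by (simp add: cscale_def)
      finally have "Rep_gl2 (- x) u = cscale (1 / c) u" by simp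
      then show ?thesis by (auto simp: H_def)
    qed
  qed
  define v where "v d = Rep_gl2 (g (org M d)) u" for d
  have v0: "v d \<noteq> (0, 0)" for d using u by (simp add: v_def Rep_gl2_eq_zero_iff)
  have "\<exists>c. R d (v d) = cscale c (v (rv d))" for d
  proof -
    obtain c where c: "Rep_gl2 (gauge g \<rho> d) u = cscale c u" using H by (auto simp: H_def)
    have "gauge g \<rho> d + g (org M (rv d)) = g (org M d) + \<rho> d" by (simp add: gauge_def)
    then have "Rep_gl2 (g (org M (rv d))) (Rep_gl2 (gauge g \<rho> d) u) = R d (v d)"
      by (metis Rep Rep_gl2_add v_def)
    then have "R d (v d) = cscale c (v (rv d))" by (simp add: c Rep_gl2_linear v_def)
    then show ?thesis ..
  qed
  then obtain c where c: "\<And>d. R d (v d) = cscale (c d) (v (rv d))" by metis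
  have c0: "c d \<noteq> 0" for d
  proof
    assume "c d = 0"
    then have "R d (v d) = (0, 0)" using c[of d] by (simp add: cscale_def)
    then have "v d = R (rv d) (0, 0)" using R_rv[of d "v d"] by simp
    then show False using v0[of d] by (simp add: R_def)
  qed
  have cc: "c (rv d) * c d = 1" for d
  proof -
    have "v d = R (rv d) (cscale (c d) (v (rv d)))" using R_rv[of d "v d"] by (simp add: c)
    also have "\<dots> = cscale (c d) (R (rv d) (v (rv d)))"
      using Rep_gl2_linear(2)[of "\<rho> (rv d)"] unfolding Rep .
    also have "\<dots> = cscale (c (rv d) * c d) (v d)" by (simp add: c) (simp add: cscale_def)
    finally show ?thesis using v0[of d] by (auto simp: cscale_def prod_eq_iff)
  qed
  define f where "f d = fst (v d)" for d
  define f' where "f' d = l d * (snd (v d) + T d * fst (v d))" for d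
  have f': "f' d = fst (R d (v d))" "f' d = c d * f (rv d)" for d
  proof -
    show "f' d = fst (R d (v d))" by (simp add: f'_def R_fst)
    then show "f' d = c d * f (rv d)" by (simp add: c cscale_def f_def)
  qed
  have vnx: "v (nx d) = v (rv d)" for d by (simp add: v_def)
  have "flat X (\<lambda>d. of_homog (- f d * l (nx d), f' d * l (nx (nx d))))"
  proof (rule flat_of_sections[where \<kappa>="\<lambda>d. 1 / c d" and \<mu>="\<lambda>d. 1 / c d", OF l0 l(2) Xl])
    show "f d \<noteq> 0 \<or> f' d \<noteq> 0" for d
      using v0[of d] l0[of d] by (cases "v d") (auto simp: f_def f'_def)
    show "1 / c d \<noteq> 0" for d using c0 by simp
    then show "1 / c d \<noteq> 0" for d .
    show "f (rv d) = 1 / c d * f' d" for d using c0 by (simp add: f'(2))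
    show "f (nx d) = 1 / c d * f' d" for d using c0 by (simp add: f'(2)) (simp add: f_def vnx)
    show "f' (rv d) = 1 / c d * f d" for d
      using cc[of d] c0[of d] by (simp add: f'(2) field_simps)
    show "l d * f' (nx d) = - (1 / c d) * (l (nx d) * f d + l (nx (nx d)) * f' d)" for d
    proof -
      have "c d * f' (nx d) = l (nx d) * (snd (R d (v d)) + T (nx d) * fst (R d (v d)))"
        by (simp add: f'_def vnx c cscale_def algebra_simps)
      also have "\<dots> = - (l (nx d) * f d + l (nx (nx d)) * f' d) / l d"
        unfolding next_coord f'(1) by (simp add: f_def)
      finally show ?thesis using c0[of d] l0[of d] by (simp add: field_simps)
    qed
  qed
  with that show ?thesis by blast
qed

end

section \<open>Circle patterns and triangle angles\<close>

context angled_torus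
begin

text \<open>By the law of sines, the logarithm of the modulus of the side ratio \<open>Q d\<close>
  in a triangle with angles \<alpha>.\<close>

definition logside :: "('d \<Rightarrow> real) \<Rightarrow> 'd \<Rightarrow> real" where
  "logside \<alpha> d = ln (sin (\<alpha> (nx d))) - ln (sin (\<alpha> (nx (nx d))))"

definition log_modulus :: "('d \<Rightarrow> real) \<Rightarrow> 'd \<Rightarrow> real" where
  "log_modulus \<alpha> d = - (logside \<alpha> d + logside \<alpha> (rv d))"

text \<open>One turn around a vertex does not rescale lengths. Together with the angle sum
  \<open>2 * pi\<close> this says that the affine structure is smooth there.\<close>

definition balanced :: "('d \<Rightarrow> real) \<Rightarrow> bool" where
  "balanced \<alpha> \<longleftrightarrow> (\<forall>d. (\<Sum>e\<in>org M d. logside \<alpha> (nx e)) = 0)"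

definition shape_of :: "('d \<Rightarrow> real) \<Rightarrow> 'd \<Rightarrow> complex" where
  "shape_of \<alpha> d = rcis (exp (logside \<alpha> d)) (\<alpha> d)"

definition pattern_of :: "('d \<Rightarrow> real) \<Rightarrow> 'd \<Rightarrow> complex" where
  "pattern_of \<alpha> d = -1 / (shape_of \<alpha> d * shape_of \<alpha> (rv d))"

lemma triangle_anglesD:
  assumes "triangle_angles \<alpha>"
  shows "0 < \<alpha> d" "\<alpha> d < pi" "\<alpha> d + \<alpha> (rv d) = pi - \<Theta> d" "\<alpha> d + \<alpha> (nx d) + \<alpha> (nx (nx d)) = pi"
    "0 < sin (\<alpha> d)"
proof -
  have p: "0 < \<alpha> d" for d using assms by (simp add: triangle_angles_def)
  show "0 < \<alpha> d" by (rule p)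
  show "\<alpha> d + \<alpha> (rv d) = pi - \<Theta> d" "\<alpha> d + \<alpha> (nx d) + \<alpha> (nx (nx d)) = pi"
    using assms by (simp_all add: triangle_angles_def)
  then show "\<alpha> d < pi" using p[of "nx d"] p[of "nx (nx d)"] by linarith
  then show "0 < sin (\<alpha> d)" using p[of d] by (simp add: sin_gt_zero)
qed

text \<open>The corner angles at a vertex regroup into the terms
  \<open>pi - \<alpha> e - \<alpha> (rv e) = \<Theta> e\<close> of its edges.\<close>

lemma triangle_angles_sum_org:
  assumes "triangle_angles \<alpha>"
  shows "(\<Sum>e\<in>org M d. \<alpha> (nx e)) = 2 * pi"
proof -
  note t = triangle_anglesD[OF assms]
  have "(\<Sum>e\<in>org M d. \<alpha> (nx e)) = (\<Sum>e\<in>org M d. pi - \<alpha> e - \<alpha> (nx (nx e)))"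
    by (rule sum.cong) (use t(4) in \<open>auto simp: algebra_simps\<close>)
  also have "\<dots> = (\<Sum>e\<in>org M d. pi - \<alpha> e) - (\<Sum>e\<in>org M d. \<alpha> (nx (nx e)))"
    by (rule sum_subtractf)
  also have "(\<Sum>e\<in>org M d. \<alpha> (nx (nx e))) = (\<Sum>e\<in>org M d. \<alpha> (rv e))"
    by (rule sum_org_rv[symmetric])
  also have "(\<Sum>e\<in>org M d. pi - \<alpha> e) - (\<Sum>e\<in>org M d. \<alpha> (rv e)) = (\<Sum>e\<in>org M d. \<Theta> e)"
    unfolding sum_subtractf[symmetric] by (rule sum.cong) (use t(3) in \<open>auto simp: algebra_simps\<close>)
  finally show ?thesis by (simp add: Theta_sum)
qed

lemma shape_prod: "shape X Q \<Longrightarrow> Q d * Q (nx d) * Q (nx (nx d)) = -1"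
proof -
  assume Q: "shape X Q"
  have q: "Q (nx d) = 1 / (1 - Q d)" for d using Q by (simp add: shape_def)
  have "Q d \<noteq> 0" "Q d \<noteq> 1" "Q (nx d) \<noteq> 1" for d
    using shape_weak[OF Q] by (simp_all add: weak_shape_def)
  then have "Q d \<noteq> 0" "1 - Q d \<noteq> 0" "1 - 1 / (1 - Q d) \<noteq> 0" unfolding q[symmetric] by simp_all
  then show ?thesis unfolding q[of "nx d"] q[of d] by (simp add: divide_simps)
qed

text \<open>\<open>X e\<close> involves the ratios on both sides of an edge. Rotating one factor
  into the neighbouring triangle, and using that the three ratios of a face multiply to -1, leaves
  the ratio at the corner of the vertex.\<close>

lemma shape_prod_org:
  assumes Q: "shape X Q"
  shows "(\<Prod>e\<in>org M d. X e) = (\<Prod>e\<in>org M d. Q (nx e))"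
proof -
  have nz: "Q d \<noteq> 0" for d using shape_weak[OF Q] by (simp add: weak_shape_def)
  have "X e = -1 / (Q e * Q (rv e))" for e
  proof -
    have "X e * Q e * Q (rv e) = -1" using Q by (simp add: shape_def)
    then show ?thesis using nz[of e] nz[of "rv e"] by (simp add: field_simps)
  qed
  then have "(\<Prod>e\<in>org M d. X e) = (\<Prod>e\<in>org M d. (-1 / Q e) / Q (rv e))" by (simp add: field_simps)
  also have "\<dots> = (\<Prod>e\<in>org M d. -1 / Q e) / (\<Prod>e\<in>org M d. Q (nx (nx e)))"
    by (simp only: prod_dividef prod_org_rv)
  also have "\<dots> = (\<Prod>e\<in>org M d. (-1 / Q e) / Q (nx (nx e)))" by (simp only: prod_dividef)
  also have "\<dots> = (\<Prod>e\<in>org M d. Q (nx e))"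
  proof (rule prod.cong)
    fix e
    show "(-1 / Q e) / Q (nx (nx e)) = Q (nx e)"
      using shape_prod[OF Q, of e] nz[of e] nz[of "nx (nx e)"] by (simp add: field_simps)
  qed simp
  finally show ?thesis .
qed

lemma prod_cw: "(\<Prod>j<card (org M d). f ((cw M ^^ j) d)) = (\<Prod>e\<in>org M d. f e)"
  for f :: "'d \<Rightarrow> complex"
  by (rule prod.reindex_bij_betw[OF bij_betw_cw_org[OF torus]])

text \<open>
  The partial products of the \<open>Q (nx e)\<close> are the positions of the neighbours of a vertex after
  moving it to \<open>\<infinity>\<close>; the second vertex condition says that the polygon formed by them closes up.
\<close>

lemma shape_cross_ratio_system:
  assumes Q: "shape X Q" and sym: "X \<in> edge_functions M"
    and one: "\<And>d. (\<Prod>e\<in>org M d. Q (nx e)) = 1"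
  shows "cross_ratio_system M X"
  unfolding cross_ratio_system_def Let_def
proof (intro conjI sym allI)
  have q: "Q (nx d) = 1 / (1 - Q d)" and xq: "X d * Q d * Q (rv d) = -1" for d
    using Q by (simp_all add: shape_def)
  have nz: "Q d \<noteq> 0" "Q d \<noteq> 1" for d
    using shape_weak[OF Q] by (simp_all add: weak_shape_def)
  fix d
  let ?r = "card (org M d)"
  show "(\<Prod>j<?r. X ((cw M ^^ j) d)) = 1"
    unfolding prod_cw shape_prod_org[OF Q] one ..
  \<comment> \<open>Two consecutive sides of this polygon have ratio \<open>X e\<close>.\<close>
  have id: "Q (nx e) * (Q (nx (cw M e)) - 1) = X e * (Q (nx e) - 1)" for e
  proof -
    have 1: "Q (nx e) - 1 = Q e * Q (nx e)" unfolding q[of e] using nz(2)[of e] by (simp add: field_simps)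
    have 2: "Q (nx (cw M e)) - 1 = -1 / Q (rv e)"
      using q[of "rv e"] nz[of "rv e"] nz(2)[of "nx (rv e)"] unfolding cw_def q[of "nx (rv e)"]
      by (simp add: field_simps)
    have "X e * Q e = -1 / Q (rv e)" using xq[of e] nz(1)[of "rv e"] by (simp add: field_simps)
    then show ?thesis unfolding 1 2 by (metis mult.assoc mult.commute)
  qed
  define W where "W m = (\<Prod>j<m. Q (nx ((cw M ^^ Suc j) d)))" for m
  let ?c = "Q (nx (cw M d)) - 1"
  have step: "X d * (W (Suc m) - W m) = ?c * (\<Prod>j\<le>m. X ((cw M ^^ j) d))" for m
  proof (induction m)
    case (Suc m)
    let ?e = "(cw M ^^ Suc m) d"
    have W1: "W (Suc m) = W m * Q (nx ?e)" by (simp add: W_def)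
    have "W (Suc (Suc m)) = W (Suc m) * Q (nx (cw M ?e))" by (simp add: W_def)
    then have "W (Suc (Suc m)) - W (Suc m) = W m * (Q (nx ?e) * (Q (nx (cw M ?e)) - 1))"
      unfolding W1 by (simp add: algebra_simps)
    also have "\<dots> = X ?e * (W (Suc m) - W m)" unfolding id W1 by (simp add: algebra_simps)
    finally have "X d * (W (Suc (Suc m)) - W (Suc m)) = X ?e * (X d * (W (Suc m) - W m))" by simp
    also have "\<dots> = ?c * (\<Prod>j\<le>Suc m. X ((cw M ^^ j) d))"
      unfolding Suc.IH by (simp add: mult_ac)
    finally show ?case .
  qed (simp add: W_def)
  have "W ?r = (\<Prod>j<card (org M (cw M d)). Q (nx ((cw M ^^ j) (cw M d))))"
    by (simp add: W_def funpow_swap1)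
  also have "\<dots> = 1" unfolding prod_cw[of "\<lambda>e. Q (nx e)"] by (rule one)
  finally have Wr: "W ?r = 1" .
  have "?c * (\<Sum>m<?r. \<Prod>j\<le>m. X ((cw M ^^ j) d)) = X d * (\<Sum>m<?r. W (Suc m) - W m)"
    unfolding sum_distrib_left by (rule sum.cong) (simp_all only: step)
  also have "\<dots> = 0" unfolding sum_lessThan_telescope Wr by (simp add: W_def)
  finally show "(\<Sum>m<?r. \<Prod>j\<le>m. X ((cw M ^^ j) d)) = 0"
    using nz(2)[of "nx (cw M d)"] by simp
qed

lemma shape_of_nx:
  assumes t: "triangle_angles \<alpha>"
  shows "shape_of \<alpha> (nx d) = 1 / (1 - shape_of \<alpha> d)"
proof -
  note t = triangle_anglesD[OF t]
  let ?a = "\<alpha> d" and ?b = "\<alpha> (nx d)" and ?c = "\<alpha> (nx (nx d))"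
  note s = t(5)[of d] t(5)[of "nx d"] t(5)[of "nx (nx d)"]
  have e1: "exp (logside \<alpha> d) = sin ?b / sin ?c" "exp (logside \<alpha> (nx d)) = sin ?c / sin ?a"
    unfolding logside_def using s by (simp_all add: exp_diff)
  have "?c = pi - (?a + ?b)" using t(4)[of d] by linarith
  then have "sin ?c = sin (?a + ?b)" by (simp add: sin_pi_minus)
  then have c: "sin ?c = sin ?a * cos ?b + cos ?a * sin ?b" by (simp add: sin_add)
  have "1 - shape_of \<alpha> d = of_real (sin ?a / sin ?c) * cis (- ?b)"
  proof (rule complex_eqI)
    show "Re (1 - shape_of \<alpha> d) = Re (of_real (sin ?a / sin ?c) * cis (- ?b))"
      unfolding shape_of_def e1 rcis_def using s c by (simp add: field_simps)
    show "Im (1 - shape_of \<alpha> d) = Im (of_real (sin ?a / sin ?c) * cis (- ?b))"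
      unfolding shape_of_def e1 rcis_def by simp
  qed
  then have "(1 - shape_of \<alpha> d) * shape_of \<alpha> (nx d)
      = of_real ((sin ?a / sin ?c) * (sin ?c / sin ?a)) * (cis (- ?b) * cis ?b)"
    by (simp add: shape_of_def e1 rcis_def)
  also have "\<dots> = 1" using s by (simp add: cis_mult)
  finally have "(1 - shape_of \<alpha> d) * shape_of \<alpha> (nx d) = 1" .
  then show ?thesis by (metis mult_zero_left nonzero_mult_div_cancel_left zero_neq_one)
qed

lemma shape_of_shape:
  assumes t: "triangle_angles \<alpha>"
  shows "shape (pattern_of \<alpha>) (shape_of \<alpha>)"
proof -
  have nz: "shape_of \<alpha> d \<noteq> 0" for d by (simp add: shape_of_def)
  have "0 < Im (shape_of \<alpha> d)" for d
    using triangle_anglesD(5)[OF t] by (simp add: shape_of_def)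
  then show ?thesis
    unfolding shape_def using shape_of_nx[OF t] nz by (simp add: pattern_of_def)
qed

lemma pattern_of_rcis:
  assumes t: "triangle_angles \<alpha>"
  shows "pattern_of \<alpha> d = rcis (exp (log_modulus \<alpha> d)) (\<Theta> d)"
proof -
  have "\<alpha> d + \<alpha> (rv d) = pi - \<Theta> d" by (rule triangle_anglesD(3)[OF t])
  then have "shape_of \<alpha> d * shape_of \<alpha> (rv d) = rcis (exp (- log_modulus \<alpha> d)) (pi - \<Theta> d)"
    by (simp add: shape_of_def rcis_mult log_modulus_def exp_add mult.commute)
  also have "\<dots> = - inverse (rcis (exp (log_modulus \<alpha> d)) (\<Theta> d))"
    by (simp add: rcis_inverse exp_minus) (simp add: rcis_def complex_eq_iff power2_eq_square)
  finally show ?thesis by (simp add: pattern_of_def inverse_eq_divide del: rcis_inverse)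
qed

lemma pattern_of_circle_patterns:
  assumes t: "triangle_angles \<alpha>" and b: "balanced \<alpha>"
  shows "pattern_of \<alpha> \<in> circle_patterns M \<Theta>"
proof -
  have "(\<Prod>e\<in>org M d. shape_of \<alpha> (nx e)) = 1" for d
  proof -
    have "(\<Prod>e\<in>org M d. shape_of \<alpha> (nx e))
      = rcis (exp (\<Sum>e\<in>org M d. logside \<alpha> (nx e))) (\<Sum>e\<in>org M d. \<alpha> (nx e))"
    proof -
      have "(\<Prod>e\<in>A. shape_of \<alpha> (nx e)) = rcis (exp (\<Sum>e\<in>A. logside \<alpha> (nx e))) (\<Sum>e\<in>A. \<alpha> (nx e))"
        if "finite A" for A
        using that by induction (simp_all add: shape_of_def rcis_mult exp_add)
      then show ?thesis by simp
    qed
    also have "\<dots> = 1" using b triangle_angles_sum_org[OF t, of d] by (simp add: balanced_def rcis_def)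
    finally show ?thesis .
  qed
  moreover have "pattern_of \<alpha> \<in> edge_functions M"
    by (simp add: edge_functions_def pattern_of_def mult.commute)
  ultimately have "cross_ratio_system M (pattern_of \<alpha>)"
    by (intro shape_cross_ratio_system[OF shape_of_shape[OF t]]) auto
  moreover have "pattern_of \<alpha> d \<noteq> 0 \<and> Im (Ln (pattern_of \<alpha> d)) = \<Theta> d" for d
  proof -
    have nz: "pattern_of \<alpha> d \<noteq> 0" by (simp add: pattern_of_rcis[OF t])
    have "Arg (pattern_of \<alpha> d) = \<Theta> d"
      unfolding pattern_of_rcis[OF t] using Theta_nonneg[of d] Theta_less[of d]
      by (intro Arg_rcis) auto
    then show ?thesis using nz Arg_eq_Im_Ln[OF nz] by simp
  qed
  ultimately show ?thesis by (simp add: circle_patterns_def)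
qed

lemma ln_abs_pattern_of:
  assumes t: "triangle_angles \<alpha>"
  shows "ln (abs_embedding (pattern_of \<alpha>) d) = log_modulus \<alpha> d"
  by (simp add: abs_embedding_def pattern_of_rcis[OF t])

lemma circle_patterns_has_angles: "X \<in> circle_patterns M \<Theta> \<Longrightarrow> has_angles X"
  by (auto simp: circle_patterns_def has_angles_def Arg_eq_Im_Ln)

lemma shape_eq_shape_of:
  assumes Q: "shape X Q"
  shows "Q d = shape_of (\<lambda>d. Arg (Q d)) d"
proof -
  have q: "Q (nx d) = 1 / (1 - Q d)" "0 < Im (Q d)" for d
    using Q by (simp_all add: shape_def)
  have nz: "Q d \<noteq> 0" "Q d \<noteq> 1" for d
    using shape_weak[OF Q] by (simp_all add: weak_shape_def)
  have s: "sin (Arg (Q (nx d))) = Im (Q d) / cmod (1 - Q d)" for d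
    using sin_Arg[OF nz(1)[of "nx d"]] nz(2)[of d] unfolding q(1) Im_one_over_one_minus
    by (simp add: norm_divide power2_eq_square)
  have s2: "sin (Arg (Q (nx (nx d)))) = Im (Q d) / cmod (1 - Q d) / cmod (Q d)" for d
  proof -
    have "1 - Q (nx d) = - Q d * Q (nx d)" unfolding q(1) using nz(2)[of d] by (simp add: field_simps)
    then have "cmod (1 - Q (nx d)) = cmod (Q d) / cmod (1 - Q d)"
      by (simp add: norm_mult q(1) norm_divide)
    moreover have "Im (Q (nx d)) = Im (Q d) / (cmod (1 - Q d))\<^sup>2"
      unfolding q(1) by (rule Im_one_over_one_minus)
    ultimately show ?thesis unfolding s[of "nx d"] using nz by (simp add: power2_eq_square)
  qed
  have c: "0 < cmod (1 - Q d)" "0 < cmod (Q d)" using nz by simp_all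
  have "exp (logside (\<lambda>d. Arg (Q d)) d) = cmod (Q d)"
    unfolding logside_def s[of d] s2[of d] using q(2)[of d] c by (simp add: ln_div ln_mult exp_diff)
  then show ?thesis by (simp add: shape_of_def rcis_cmod_Arg)
qed

text \<open>With its converse \<open>pattern_of_circle_patterns\<close>, this parametrises patterns
  with a strict shape by balanced angles.\<close>

lemma shape_pattern_of:
  assumes X: "X \<in> circle_patterns M \<Theta>" and Q: "shape X Q"
  shows "triangle_angles (\<lambda>d. Arg (Q d))" "balanced (\<lambda>d. Arg (Q d))" "X = pattern_of (\<lambda>d. Arg (Q d))"
proof -
  show t: "triangle_angles (\<lambda>d. Arg (Q d))"
    by (rule shape_triangle_angles[OF circle_patterns_has_angles[OF X] Q])
  have nz: "Q d \<noteq> 0" for d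
    using shape_weak[OF Q] by (simp_all add: weak_shape_def)
  show "X = pattern_of (\<lambda>d. Arg (Q d))"
  proof
    fix d
    have "X d * Q d * Q (rv d) = -1" using Q by (simp add: shape_def)
    then have "X d = -1 / (Q d * Q (rv d))" using nz[of d] nz[of "rv d"] by (simp add: field_simps)
    then show "X d = pattern_of (\<lambda>d. Arg (Q d)) d"
      unfolding pattern_of_def shape_eq_shape_of[OF Q, symmetric] .
  qed
  show "balanced (\<lambda>d. Arg (Q d))"
    unfolding balanced_def
  proof
    fix d
    have "(\<Prod>e\<in>org M d. X e) = 1"
      using X unfolding circle_patterns_def cross_ratio_system_def Let_def prod_cw by simp
    then have "(\<Prod>e\<in>org M d. Q (nx e)) = 1" unfolding shape_prod_org[OF Q] .
    then have "(\<Prod>e\<in>org M d. cmod (Q (nx e))) = 1" by (metis norm_one prod_norm)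
    then have "(\<Sum>e\<in>org M d. ln (cmod (Q (nx e)))) = 0"
      using nz by (subst ln_prod[symmetric]) auto
    moreover have "ln (cmod (Q e)) = logside (\<lambda>d. Arg (Q d)) e" for e
      by (subst shape_eq_shape_of[OF Q]) (simp add: shape_of_def)
    ultimately show "(\<Sum>e\<in>org M d. logside (\<lambda>d. Arg (Q d)) (nx e)) = 0" by simp
  qed
qed

end

section \<open>The Weil-Petersson form and the cotangent energy\<close>

context torus
begin

lemma penner_form_darts: "penner_form M a a' = - 2 * (\<Sum>d\<in>UNIV. a d * (a' (nx d) - a' (nx (nx d))))"
  by (simp add: penner_form_def sum_faces[of "\<lambda>d. a d * (a' (nx d) - a' (nx (nx d)))"])

lemma weil_petersson_eq:
  assumes "x \<in> Teich_tangent M" "x' \<in> Teich_tangent M"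
  obtains a a' where "a \<in> edge_functions M" "penner_h M a = x" "a' \<in> edge_functions M" "penner_h M a' = x'"
    "weil_petersson M x x' = penner_form M a a'"
proof -
  have some: "(SOME a. a \<in> edge_functions M \<and> penner_h M a = x) \<in> edge_functions M \<and>
      penner_h M (SOME a. a \<in> edge_functions M \<and> penner_h M a = x) = x" if x: "x \<in> Teich_tangent M" for x
  proof -
    obtain a where "a \<in> edge_functions M" "penner_h M a = x" by (rule penner_h_surj[OF x])
    then have "a \<in> edge_functions M \<and> penner_h M a = x" by (rule conjI)
    then show ?thesis by (rule someI[where P="\<lambda>a. a \<in> edge_functions M \<and> penner_h M a = x"])
  qed
  show ?thesis
    by (rule that[OF some[OF assms(1), THEN conjunct1] some[OF assms(1), THEN conjunct2]
      some[OF assms(2), THEN conjunct1] some[OF assms(2), THEN conjunct2] weil_petersson_def])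
qed

end

context angled_torus
begin

definition ct :: "('d \<Rightarrow> complex) \<Rightarrow> 'd \<Rightarrow> real" where
  "ct Q d = Re (Q d) / Im (Q d)"

text \<open>Multiplied by \<open>Im (Q d)\<close>, the cotangents of the three angles become
  polynomials in the real and imaginary part of a single ratio, which frees later identities of
  denominators.\<close>

lemma ct_face:
  assumes Q: "shape X Q"
  shows "Im (Q d) * ct Q d = Re (Q d)" "Im (Q d) * ct Q (nx d) = 1 - Re (Q d)"
    "Im (Q d) * ct Q (nx (nx d)) = (Re (Q d))\<^sup>2 + (Im (Q d))\<^sup>2 - Re (Q d)"
proof -
  have q: "Q (nx d) = 1 / (1 - Q d)" "0 < Im (Q d)" for d
    using Q by (simp_all add: shape_def)
  have N: "cmod (1 - Q d) \<noteq> 0" for d using shape_weak[OF Q] by (simp add: weak_shape_def)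
  have Re: "Re (1 / (1 - Q d)) = (1 - Re (Q d)) / (cmod (1 - Q d))\<^sup>2" for d
    by (simp add: Re_divide cmod_power2)
  have ct_nx: "ct Q (nx d) = (1 - Re (Q d)) / Im (Q d)" for d
    unfolding ct_def q(1) Im_one_over_one_minus Re using N[of d] by simp
  show "Im (Q d) * ct Q d = Re (Q d)" using q(2)[of d] by (simp add: ct_def)
  show "Im (Q d) * ct Q (nx d) = 1 - Re (Q d)" using q(2)[of d] by (simp add: ct_nx)
  have "ct Q (nx (nx d)) = ((cmod (1 - Q d))\<^sup>2 - (1 - Re (Q d))) / Im (Q d)"
    unfolding ct_nx[of "nx d"] unfolding q(1)[of d] Im_one_over_one_minus Re
    using N[of d] q(2)[of d] by (simp add: field_simps)
  then have "Im (Q d) * ct Q (nx (nx d)) = (cmod (1 - Q d))\<^sup>2 - (1 - Re (Q d))"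
    using q(2)[of d] by simp
  then show "Im (Q d) * ct Q (nx (nx d)) = (Re (Q d))\<^sup>2 + (Im (Q d))\<^sup>2 - Re (Q d)"
    unfolding cmod_power2 by (simp add: power2_eq_square algebra_simps)
qed

text \<open>
  The cotangent energy of a closed form dominates the area form, with equality for the forms that
  are complex linear on every triangle.
\<close>

lemma energy_identity:
  assumes Q: "shape X Q" and F: "cocycle (F :: 'd \<Rightarrow> complex)"
  shows "(\<Sum>d\<in>UNIV. (cmod (Q d * F d - (1 - Q d) * F (nx d)))\<^sup>2 / Im (Q d))
    = 3 * (\<Sum>d\<in>UNIV. ct Q d * (cmod (F d))\<^sup>2) - 2 * pairing (\<lambda>d. Re (F d)) (\<lambda>d. Im (F d))"
proof -
  have "(cmod (Q d * F d - (1 - Q d) * F (nx d)))\<^sup>2 / Im (Q d) =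
     (ct Q d * (cmod (F d))\<^sup>2 + ct Q (nx d) * (cmod (F (nx d)))\<^sup>2 + ct Q (nx (nx d)) * (cmod (F (nx (nx d))))\<^sup>2)
     - 2 * wedge (\<lambda>d. Re (F d)) (\<lambda>d. Im (F d)) d" for d
  proof -
    have q0: "0 < Im (Q d)" using Q by (simp add: shape_def)
    obtain p q where P: "Q d = Complex p q" by (cases "Q d")
    obtain b1 c1 where F1: "F d = Complex b1 c1" by (cases "F d")
    obtain b2 c2 where F2: "F (nx d) = Complex b2 c2" by (cases "F (nx d)")
    note cocycle_third[OF F, of d]
    then have F3: "F (nx (nx d)) = Complex (- b1 - b2) (- c1 - c2)"
      unfolding F1 F2 by (simp add: complex_eq_iff)
    note ctf = ct_face[OF Q, of d, unfolded P complex.sel]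
    let ?S = "ct Q d * (cmod (F d))\<^sup>2 + ct Q (nx d) * (cmod (F (nx d)))\<^sup>2 + ct Q (nx (nx d)) * (cmod (F (nx (nx d))))\<^sup>2"
    have "q * ?S = (q * ct Q d) * (cmod (F d))\<^sup>2 + (q * ct Q (nx d)) * (cmod (F (nx d)))\<^sup>2
        + (q * ct Q (nx (nx d))) * (cmod (F (nx (nx d))))\<^sup>2"
      by (simp add: algebra_simps)
    also have "\<dots> = (cmod (Q d * F d - (1 - Q d) * F (nx d)))\<^sup>2 + q * (2 * wedge (\<lambda>d. Re (F d)) (\<lambda>d. Im (F d)) d)"
      unfolding ctf unfolding cmod_power2 P F1 F2 F3 wedge_def
      by (simp add: power2_eq_square algebra_simps)
    finally have "(cmod (Q d * F d - (1 - Q d) * F (nx d)))\<^sup>2 = q * (?S - 2 * wedge (\<lambda>d. Re (F d)) (\<lambda>d. Im (F d)) d)"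
      by (simp add: algebra_simps)
    then show ?thesis using q0 unfolding P by simp
  qed
  then show ?thesis unfolding sum_face3 pairing_def by (simp only: sum_subtractf sum_distrib_left)
qed

lemma energy_zero:
  assumes Q: "shape X Q" and F: "cocycle (F :: 'd \<Rightarrow> complex)"
    and le: "3 * (\<Sum>d\<in>UNIV. ct Q d * (cmod (F d))\<^sup>2) \<le> 2 * pairing (\<lambda>d. Re (F d)) (\<lambda>d. Im (F d))"
  shows "(1 - Q d) * F (nx d) = Q d * F d"
proof -
  have q0: "0 < Im (Q d)" for d using Q by (simp add: shape_def)
  let ?s = "\<lambda>d. (cmod (Q d * F d - (1 - Q d) * F (nx d)))\<^sup>2 / Im (Q d)"
  have nn: "0 \<le> ?s d" for d using q0[of d] by simp
  have "(\<Sum>d\<in>UNIV. ?s d) \<le> 0" unfolding energy_identity[OF Q F] using le by simp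
  moreover have "0 \<le> (\<Sum>d\<in>UNIV. ?s d)" by (rule sum_nonneg) (rule nn)
  ultimately have "(\<Sum>d\<in>UNIV. ?s d) = 0" by linarith
  then have "?s d = 0" by (subst (asm) sum_nonneg_eq_0_iff) (auto simp only: nn finite UNIV_I)
  then show ?thesis using q0[of d] by simp
qed

lemma cocycle_of_real: "cocycle s \<Longrightarrow> cocycle (\<lambda>d. complex_of_real (s d))"
  unfolding cocycle_def by (metis of_real_add of_real_minus of_real_0)

text \<open>For a real form the area term vanishes, so nonpositive energy makes it complex linear on
  every triangle, and a real-valued map of this kind is zero.\<close>

lemma energy_pos:
  assumes Q: "shape X Q" and \<beta>: "cocycle \<beta>" and le: "(\<Sum>d\<in>UNIV. ct Q d * (\<beta> d)\<^sup>2) \<le> 0"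
  shows "\<beta> = (\<lambda>_. 0)"
proof -
  let ?F = "\<lambda>d. complex_of_real (\<beta> d)"
  have "pairing (\<lambda>d. Re (?F d)) (\<lambda>d. Im (?F d)) = 0" by (simp add: pairing_def wedge_def)
  then have z: "(1 - Q d) * ?F (nx d) = Q d * ?F d" for d
    using le by (intro energy_zero[OF Q cocycle_of_real[OF \<beta>]]) simp
  have "\<beta> (nx (nx d)) = 0" for d
  proof -
    have "Im (Q d) * (\<beta> d + \<beta> (nx d)) = 0" using arg_cong[OF z[of d], of Im] by (simp add: algebra_simps)
    then have "\<beta> d + \<beta> (nx d) = 0" using Q by (simp add: shape_def less_imp_neq[THEN not_sym])
    then show ?thesis using cocycle_face[OF \<beta>, of d] by simp
  qed
  from this[of "nx d" for d] show ?thesis by auto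
qed

text \<open>The relation with \<open>Q\<close> makes \<open>F\<close> the edge vectors of triangles
  of the prescribed shapes; one nonzero value propagates to all darts.\<close>

lemma euclidean_of_form:
  assumes Q: "shape X Q" and F: "cocycle F" and r: "\<And>d. (1 - Q d) * F (nx d) = Q d * F d"
    and d0: "F d0 \<noteq> 0"
  shows "induces_euclidean_torus M b X"
proof (rule induces_euclidean_torusI[OF F])
  have nz: "Q d \<noteq> 0" "Q d \<noteq> 1" for d
    using shape_weak[OF Q] by (simp_all add: weak_shape_def)
  show "F d \<noteq> 0" for d
  proof (rule dart_induct[where K="\<lambda>d. F d \<noteq> 0", OF d0])
    show "F (nx d) \<noteq> 0" if "F d \<noteq> 0" for d using r[of d] that nz(1)[of d] by auto
    show "F (rv d) \<noteq> 0" if "F d \<noteq> 0" for d using that by (simp add: cocycle_rv[OF F])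
  qed
  have e: "F (nx d) = - Q d * F (nx (nx d))" for d
  proof -
    note e = cocycle_third[OF F, of d]
    have "- Q d * F (nx (nx d)) = Q d * F d + Q d * F (nx d)" unfolding e by (simp add: algebra_simps)
    also have "\<dots> = F (nx d)" unfolding r[symmetric] by (simp add: algebra_simps)
    finally show ?thesis ..
  qed
  show "X d * F (nx d) * F (nx (rv d)) = - F (nx (nx d)) * F (nx (nx (rv d)))" for d
  proof -
    have "X d * Q d * Q (rv d) = -1" using Q by (simp add: shape_def)
    moreover have "X d * F (nx d) * F (nx (rv d))
       = (X d * Q d * Q (rv d)) * (F (nx (nx d)) * F (nx (nx (rv d))))"
      unfolding e[of d] e[of "rv d"] by (simp add: mult_ac)
    ultimately show ?thesis by simp
  qed
qed

text \<open>The logarithm of the modulus is \<open>penner_h\<close> applied to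
  \<open>ln (sin \<alpha>)\<close>, whose derivative is \<open>cot \<alpha>\<close> times the
  variation \<beta> of the angle.\<close>

definition modulus_variation :: "('d \<Rightarrow> complex) \<Rightarrow> ('d \<Rightarrow> real) \<Rightarrow> 'd \<Rightarrow> real" where
  "modulus_variation Q \<beta> = penner_h M (\<lambda>d. ct Q d * \<beta> d)"

text \<open>
  If the moduli of the cross ratios do not change, then the logarithmic derivative of \<open>Q\<close> is a
  closed form that is complex linear on every triangle.
\<close>

lemma modulus_variation_inj:
  assumes Q: "shape X Q" and \<beta>: "cocycle \<beta>" and z: "modulus_variation Q \<beta> = (\<lambda>_. 0)"
    and ne: "\<not> induces_euclidean_torus M b X"
  shows "\<beta> = (\<lambda>_. 0)"
proof -
  define y where "y d = ct Q (nx d) * \<beta> (nx d) - ct Q (nx (nx d)) * \<beta> (nx (nx d))" for d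
  define \<xi> where "\<xi> d = Complex (y d) (\<beta> d)" for d
  have "y (rv d) = - y d" for d
    using fun_cong[OF z, of d] by (simp add: modulus_variation_def penner_h_def y_def)
  moreover have "y d + y (nx d) + y (nx (nx d)) = 0" for d by (simp add: y_def)
  ultimately have \<xi>: "cocycle \<xi>"
    using cocycle_rv[OF \<beta>] cocycle_face[OF \<beta>] by (simp add: cocycle_def \<xi>_def complex_eq_iff)
  have r: "(1 - Q d) * \<xi> (nx d) = Q d * \<xi> d" for d
  proof -
    have q0: "0 < Im (Q d)" using Q by (simp add: shape_def)
    define p q b1 b2 where "p = Re (Q d)" "q = Im (Q d)" "b1 = \<beta> d" "b2 = \<beta> (nx d)"
    note defs = this
    have b3: "\<beta> (nx (nx d)) = - b1 - b2" by (simp add: defs cocycle_third[OF \<beta>])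
    note ctf = ct_face[OF Q, of d, folded defs]
    have q: "q \<noteq> 0" using q0 by (simp add: defs)
    have ct: "ct Q d = p / q" "ct Q (nx d) = (1 - p) / q" "ct Q (nx (nx d)) = (p\<^sup>2 + q\<^sup>2 - p) / q"
      using ctf q by (simp_all add: field_simps)
    have y1: "q * y d = (1 - p) * b2 + (p\<^sup>2 + q\<^sup>2 - p) * (b1 + b2)"
      and y2: "q * y (nx d) = - (p\<^sup>2 + q\<^sup>2 - p) * (b1 + b2) - p * b1"
      using q unfolding y_def nx3 ct b3 by (simp_all add: defs(3,4)[symmetric] field_simps)
    have "q * Re ((1 - Q d) * \<xi> (nx d)) = (1 - p) * (q * y (nx d)) + q * q * b2"
      by (simp add: \<xi>_def defs algebra_simps)
    also have "\<dots> = p * (q * y d) - q * q * b1"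
      unfolding y1 y2 by (simp add: algebra_simps power2_eq_square)
    also have "\<dots> = q * Re (Q d * \<xi> d)" by (simp add: \<xi>_def defs algebra_simps)
    finally have re: "Re ((1 - Q d) * \<xi> (nx d)) = Re (Q d * \<xi> d)" using q by simp
    have "Im ((1 - Q d) * \<xi> (nx d)) = (1 - p) * b2 - q * y (nx d)"
      by (simp add: \<xi>_def defs algebra_simps)
    also have "\<dots> = p * b1 + q * y d"
      unfolding y1 y2 by (simp add: algebra_simps)
    also have "\<dots> = Im (Q d * \<xi> d)" by (simp add: \<xi>_def defs algebra_simps)
    finally show ?thesis using re by (simp add: complex_eq_iff)
  qed
  have "\<xi> d = 0" for d using euclidean_of_form[OF Q \<xi> r] ne by blast
  then show ?thesis by (auto simp: \<xi>_def complex_eq_iff)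
qed

lemma sum_ct_face:
  assumes Q: "shape X Q"
  shows "ct Q d * ct Q (nx d) + ct Q (nx d) * ct Q (nx (nx d)) + ct Q (nx (nx d)) * ct Q d = 1"
proof -
  have q0: "Im (Q d) \<noteq> 0" using Q by (simp add: shape_def less_imp_neq[THEN not_sym])
  have "(Im (Q d))\<^sup>2 * (ct Q d * ct Q (nx d) + ct Q (nx d) * ct Q (nx (nx d)) + ct Q (nx (nx d)) * ct Q d)
    = (Im (Q d) * ct Q d) * (Im (Q d) * ct Q (nx d)) + (Im (Q d) * ct Q (nx d)) * (Im (Q d) * ct Q (nx (nx d)))
     + (Im (Q d) * ct Q (nx (nx d))) * (Im (Q d) * ct Q d)"
    by (simp add: power2_eq_square algebra_simps)
  also have "\<dots> = (Im (Q d))\<^sup>2 * 1"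
    unfolding ct_face[OF Q] by (simp add: power2_eq_square algebra_simps)
  finally show ?thesis using q0 by simp
qed

text \<open>
  \<open>\<sigma>\<close> is the differential of a function \<open>s\<close> on the vertices of the universal cover: the logarithmic
  length of the edge \<open>ij\<close> varies by \<open>a\<^sub>i\<^sub>j + s\<^sub>i + s\<^sub>j\<close>.
\<close>

lemma scale_form:
  assumes Q: "shape X Q" and \<beta>: "cocycle \<beta>" and a: "a \<in> edge_functions M"
    and h: "penner_h M a = modulus_variation Q \<beta>"
  defines "r \<equiv> \<lambda>d. ct Q d * \<beta> d - a d"
  defines "\<sigma> \<equiv> \<lambda>d. r (nx d) - r (nx (nx d))"
  shows "cocycle \<sigma>"
proof -
  have "\<sigma> (rv d) = - \<sigma> d" for d
    using fun_cong[OF h, of d] by (simp add: modulus_variation_def penner_h_def \<sigma>_def r_def)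
  then show ?thesis by (simp add: cocycle_def \<sigma>_def)
qed

lemma sum_nx_prod: "(\<Sum>d\<in>UNIV. u d * v (nx (nx d))) = (\<Sum>d\<in>UNIV. u (nx d) * v d)" for u v :: "'d \<Rightarrow> real"
  using sum_nx[of "\<lambda>d. u d * v (nx (nx d))"] by simp

lemma sum_sym_antisym:
  fixes u v :: "'d \<Rightarrow> real"
  assumes "\<And>d. u (rv d) = u d" "\<And>d. v (rv d) = - v d"
  shows "(\<Sum>d\<in>UNIV. u d * v d) = 0"
proof -
  have "(\<Sum>d\<in>UNIV. u d * v d) = (\<Sum>d\<in>UNIV. u (rv d) * v (rv d))" by (rule sum_rv[symmetric])
  also have "\<dots> = - (\<Sum>d\<in>UNIV. u d * v d)" by (simp add: assms sum_negf)
  finally show ?thesis by simp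
qed

lemma pairing_potential:
  fixes r :: "'d \<Rightarrow> real"
  assumes t: "cocycle t"
  shows "pairing (\<lambda>d. r (nx d) - r (nx (nx d))) t = 3 * (\<Sum>d\<in>UNIV. r d * t d)"
proof -
  have "wedge (\<lambda>d. r (nx d) - r (nx (nx d))) t d = r d * t d + r (nx d) * t (nx d) + r (nx (nx d)) * t (nx (nx d))" for d
    unfolding cocycle_third[OF t] by (simp add: wedge_def algebra_simps)
  then show ?thesis unfolding pairing_def sum_face3 by simp
qed

text \<open>The symmetric \<open>a\<close> drops out against the antisymmetric
  \<open>\<beta>'\<close>.\<close>

lemma energy_pairing:
  assumes Q: "shape X Q" and \<beta>: "cocycle \<beta>" and a: "a \<in> edge_functions M" and \<beta>': "cocycle \<beta>'"
  shows "pairing (\<lambda>d. (ct Q (nx d) * \<beta> (nx d) - a (nx d)) - (ct Q (nx (nx d)) * \<beta> (nx (nx d)) - a (nx (nx d)))) \<beta>'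
    = 3 * (\<Sum>d\<in>UNIV. ct Q d * \<beta> d * \<beta>' d)"
proof -
  have "(\<Sum>d\<in>UNIV. a d * \<beta>' d) = 0"
    using a by (intro sum_sym_antisym) (auto simp: edge_functions_def cocycle_rv[OF \<beta>'])
  then show ?thesis
    unfolding pairing_potential[OF \<beta>', of "\<lambda>d. ct Q d * \<beta> d - a d"]
    by (simp add: left_diff_distrib sum_subtractf)
qed

text \<open>Write \<open>a = \<kappa> - r\<close>, with \<kappa> the variation of
  \<open>ln (sin \<alpha>)\<close>. The \<kappa>-part gives the pairing of the \<beta>'s, because
  the products of two cotangents in a triangle add up to 1; the \<open>r\<close>-part gives that of
  the \<sigma>'s. Mixed terms pair the symmetric \<open>a\<close> with an antisymmetric \<sigma> and
  vanish.\<close>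

lemma penner_form_pairing:
  assumes Q: "shape X Q" and \<beta>: "cocycle \<beta>" and a: "a \<in> edge_functions M"
    and h: "penner_h M a = modulus_variation Q \<beta>"
    and \<beta>': "cocycle \<beta>'" and a': "a' \<in> edge_functions M"
    and h': "penner_h M a' = modulus_variation Q \<beta>'"
  defines "\<sigma> \<equiv> \<lambda>d. (ct Q (nx d) * \<beta> (nx d) - a (nx d)) - (ct Q (nx (nx d)) * \<beta> (nx (nx d)) - a (nx (nx d)))"
  defines "\<sigma>' \<equiv> \<lambda>d. (ct Q (nx d) * \<beta>' (nx d) - a' (nx d)) - (ct Q (nx (nx d)) * \<beta>' (nx (nx d)) - a' (nx (nx d)))"
  shows "3 * penner_form M a a' = - 2 * (pairing \<beta> \<beta>' - pairing \<sigma> \<sigma>')"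
proof -
  note \<sigma> = scale_form[OF Q \<beta> a h, folded \<sigma>_def] and \<sigma>' = scale_form[OF Q \<beta>' a' h', folded \<sigma>'_def]
  define \<phi> where "\<phi> u v = (\<Sum>d\<in>UNIV. u d * (v (nx d) - v (nx (nx d))))" for u v :: "'d \<Rightarrow> real"
  define \<kappa> where "\<kappa> d = ct Q d * \<beta> d" for d
  define \<kappa>' where "\<kappa>' d = ct Q d * \<beta>' d" for d
  define r where "r d = \<kappa> d - a d" for d
  define r' where "r' d = \<kappa>' d - a' d" for d
  have skew: "\<phi> v u = - \<phi> u v" for u v
    using sum_nx_prod[of u v] sum_nx_prod[of v u]
    by (simp add: \<phi>_def right_diff_distrib sum_subtractf mult.commute)
  have 1: "3 * \<phi> \<kappa> \<kappa>' = pairing \<beta> \<beta>'"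
  proof -
    have "\<phi> \<kappa> \<kappa>' = (\<Sum>d\<in>UNIV. ct Q d * ct Q (nx d) * wedge \<beta> \<beta>' d)"
    proof -
      have "\<phi> \<kappa> \<kappa>' = (\<Sum>d\<in>UNIV. \<kappa> d * \<kappa>' (nx d)) - (\<Sum>d\<in>UNIV. \<kappa> (nx d) * \<kappa>' d)"
        unfolding \<phi>_def right_diff_distrib sum_subtractf sum_nx_prod ..
      then show ?thesis
        unfolding sum_subtractf[symmetric] by (simp add: \<kappa>_def \<kappa>'_def wedge_def algebra_simps)
    qed
    then have "3 * \<phi> \<kappa> \<kappa>' = (\<Sum>d\<in>UNIV. (ct Q d * ct Q (nx d) + ct Q (nx d) * ct Q (nx (nx d))
        + ct Q (nx (nx d)) * ct Q d) * wedge \<beta> \<beta>' d)"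
      by (simp add: sum_face3 wedge_nx[OF \<beta> \<beta>'] distrib_right)
    then show ?thesis by (simp add: sum_ct_face[OF Q] pairing_def)
  qed
  have 2: "3 * \<phi> r r' = pairing \<sigma> \<sigma>'"
  proof -
    have s': "\<sigma>' d = r' (nx d) - r' (nx (nx d))" for d by (simp add: \<sigma>'_def r'_def \<kappa>'_def)
    have s: "\<sigma> = (\<lambda>d. r (nx d) - r (nx (nx d)))" by (simp add: \<sigma>_def r_def \<kappa>_def)
    show ?thesis unfolding s pairing_potential[OF \<sigma>'] by (simp add: \<phi>_def s')
  qed
  have 3: "\<phi> u r' = 0" if "\<And>d. u (rv d) = u d" for u
  proof -
    have s': "\<sigma>' d = r' (nx d) - r' (nx (nx d))" for d by (simp add: \<sigma>'_def r'_def \<kappa>'_def)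
    show ?thesis unfolding \<phi>_def s'[symmetric] by (rule sum_sym_antisym) (simp_all add: that cocycle_rv[OF \<sigma>'])
  qed
  have 4: "\<phi> u r = 0" if "\<And>d. u (rv d) = u d" for u
  proof -
    have s': "\<sigma> d = r (nx d) - r (nx (nx d))" for d by (simp add: \<sigma>_def r_def \<kappa>_def)
    show ?thesis unfolding \<phi>_def s'[symmetric] by (rule sum_sym_antisym) (simp_all add: that cocycle_rv[OF \<sigma>])
  qed
  have "\<phi> \<kappa> \<kappa>' = \<phi> a a' + \<phi> a r' + \<phi> r a' + \<phi> r r'"
    unfolding \<phi>_def sum.distrib[symmetric] r_def r'_def by (rule sum.cong) (simp_all add: algebra_simps)
  moreover have "\<phi> a r' = 0" using a by (intro 3) (simp add: edge_functions_def)
  moreover have "\<phi> r a' = 0" using a' skew[of a' r] 4[of a'] by (simp add: edge_functions_def)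
  moreover have "penner_form M a a' = - 2 * \<phi> a a'" by (simp add: penner_form_darts \<phi>_def)
  ultimately show ?thesis using 1 2 by simp
qed

text \<open>
  By the Pluecker relation, \<open>\<omega> = 0\<close> turns the area inequality for the span of \<open>\<beta>\<close> and \<open>\<beta>'\<close> into an
  equality; after an orthonormalisation \<open>\<beta>\<close> and \<open>\<beta>'\<close> become the real and imaginary part of a form
  that is complex linear on every triangle.
\<close>

lemma degenerate_imp_euclidean:
  assumes Q: "shape X Q" and \<beta>: "cocycle \<beta>" "\<beta> d0 \<noteq> 0" and \<beta>': "cocycle \<beta>'"
    and indep: "\<And>k. \<beta>' \<noteq> (\<lambda>d. k * \<beta> d)"
    and x: "modulus_variation Q \<beta> \<in> Teich_tangent M" "modulus_variation Q \<beta>' \<in> Teich_tangent M"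
    and \<omega>: "weil_petersson M (modulus_variation Q \<beta>) (modulus_variation Q \<beta>') = 0"
  shows "induces_euclidean_torus M b X"
proof -
  obtain a a' where a: "a \<in> edge_functions M" "penner_h M a = modulus_variation Q \<beta>"
    and a': "a' \<in> edge_functions M" "penner_h M a' = modulus_variation Q \<beta>'"
    and "weil_petersson M (modulus_variation Q \<beta>) (modulus_variation Q \<beta>') = penner_form M a a'"
    using weil_petersson_eq[OF x] by metis
  with \<omega> have pf: "penner_form M a a' = 0" by simp
  define \<sigma> where "\<sigma> = (\<lambda>d. (ct Q (nx d) * \<beta> (nx d) - a (nx d)) - (ct Q (nx (nx d)) * \<beta> (nx (nx d)) - a (nx (nx d))))"
  define \<sigma>' where "\<sigma>' = (\<lambda>d. (ct Q (nx d) * \<beta>' (nx d) - a' (nx d)) - (ct Q (nx (nx d)) * \<beta>' (nx (nx d)) - a' (nx (nx d))))"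
  note \<sigma> = scale_form[OF Q \<beta>(1) a, folded \<sigma>_def] and \<sigma>' = scale_form[OF Q \<beta>' a', folded \<sigma>'_def]
  define E where "E s t = (\<Sum>d\<in>UNIV. ct Q d * s d * t d)" for s t :: "'d \<Rightarrow> real"
  have E_sym: "E s t = E t s" for s t by (simp add: E_def mult_ac)
  have E_add: "E (\<lambda>d. k * s d + m * t d) u = k * E s u + m * E t u" for k m s t u
    unfolding E_def sum_distrib_left sum.distrib[symmetric] by (rule sum.cong) (simp_all add: algebra_simps)
  have \<sigma>E: "pairing \<sigma> t = 3 * E \<beta> t" "pairing \<sigma>' t = 3 * E \<beta>' t" if "cocycle t" for t
    unfolding \<sigma>_def \<sigma>'_def E_def using energy_pairing[OF Q \<beta>(1) a(1) that] energy_pairing[OF Q \<beta>' a'(1) that] by auto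
  have eq: "pairing \<sigma> \<sigma>' = pairing \<beta> \<beta>'"
    using penner_form_pairing[OF Q \<beta>(1) a \<beta>' a', folded \<sigma>_def \<sigma>'_def] pf by simp
  have "pairing \<sigma> \<sigma>' * pairing \<beta> \<beta>' = pairing \<sigma> \<beta> * pairing \<sigma>' \<beta>' - pairing \<sigma> \<beta>' * pairing \<sigma>' \<beta>"
    using pairing_pluecker[OF \<sigma> \<sigma>' \<beta>(1) \<beta>'] by simp
  then have gram: "(pairing \<beta> \<beta>')\<^sup>2 = 9 * (E \<beta> \<beta> * E \<beta>' \<beta>' - E \<beta> \<beta>' * E \<beta> \<beta>')"
    unfolding eq \<sigma>E[OF \<beta>(1)] \<sigma>E[OF \<beta>'] by (simp add: power2_eq_square E_sym[of \<beta>' \<beta>])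
  have E_pos: "0 < E s s" if "cocycle s" "s \<noteq> (\<lambda>_. 0)" for s
    using energy_pos[OF Q that(1)] that(2) unfolding E_def by (force simp: power2_eq_square mult.assoc)
  have Eb: "0 < E \<beta> \<beta>" using \<beta> by (intro E_pos) auto
  have comb: "cocycle (\<lambda>d. k * \<beta> d + m * \<beta>' d)" for k m
  proof -
    have "k * \<beta> d + m * \<beta>' d + (k * \<beta> (nx d) + m * \<beta>' (nx d)) + (k * \<beta> (nx (nx d)) + m * \<beta>' (nx (nx d)))
      = k * (\<beta> d + \<beta> (nx d) + \<beta> (nx (nx d))) + m * (\<beta>' d + \<beta>' (nx d) + \<beta>' (nx (nx d)))" for d
      by (simp add: algebra_simps)
    then show ?thesis
      by (simp add: cocycle_def cocycle_rv[OF \<beta>(1)] cocycle_rv[OF \<beta>'] cocycle_face[OF \<beta>(1)] cocycle_face[OF \<beta>'])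
  qed
  have EE: "E (\<lambda>d. k * \<beta> d + m * \<beta>' d) (\<lambda>d. k * \<beta> d + m * \<beta>' d)
      = k * k * E \<beta> \<beta> + 2 * k * m * E \<beta> \<beta>' + m * m * E \<beta>' \<beta>'" for k m
    unfolding E_add E_sym[of _ "\<lambda>d. k * \<beta> d + m * \<beta>' d"] E_sym[of \<beta>' \<beta>] by (simp add: algebra_simps)
  have "0 < E (\<lambda>d. (- E \<beta> \<beta>') * \<beta> d + E \<beta> \<beta> * \<beta>' d) (\<lambda>d. (- E \<beta> \<beta>') * \<beta> d + E \<beta> \<beta> * \<beta>' d)"
  proof (rule E_pos[OF comb], rule notI)
    assume z: "(\<lambda>d. (- E \<beta> \<beta>') * \<beta> d + E \<beta> \<beta> * \<beta>' d) = (\<lambda>_. 0)"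
    have "\<beta>' d = (E \<beta> \<beta>' / E \<beta> \<beta>) * \<beta> d" for d
      using fun_cong[OF z, of d] Eb by (simp add: field_simps)
    then show False using indep by blast
  qed
  then have "0 < E \<beta> \<beta> * (E \<beta> \<beta> * E \<beta>' \<beta>' - E \<beta> \<beta>' * E \<beta> \<beta>')"
    unfolding EE by (simp add: algebra_simps)
  then have G: "0 < E \<beta> \<beta> * E \<beta>' \<beta>' - E \<beta> \<beta>' * E \<beta> \<beta>'" using Eb by (simp add: zero_less_mult_iff)
  define D where "D = pairing \<beta> \<beta>'"
  have D: "D \<noteq> 0" "D\<^sup>2 = 9 * (E \<beta> \<beta> * E \<beta>' \<beta>' - E \<beta> \<beta>' * E \<beta> \<beta>')"
    using gram G by (auto simp: D_def)
  \<comment> \<open>\<eta> is the part of \<open>\<beta>'\<close> orthogonal to \<beta> for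
    \<open>E\<close>, scaled so that \<open>E \<eta> \<eta> = E \<beta> \<beta>\<close>, since
    \<open>D\<^sup>2\<close> is nine times the Gram determinant. The sign of \<open>D\<close>
    orients it so that \<open>pairing \<beta> \<eta>\<close> is positive.\<close>
  define m where "m = 3 * E \<beta> \<beta> / D"
  define k where "k = - 3 * E \<beta> \<beta>' / D"
  define \<eta> where "\<eta> d = k * \<beta> d + m * \<beta>' d" for d
  define F where "F d = Complex (\<beta> d) (\<eta> d)" for d
  have \<eta>: "cocycle \<eta>" unfolding \<eta>_def by (rule comb)
  have F: "cocycle F"
    using \<beta>(1) \<eta> by (simp add: cocycle_def F_def complex_eq_iff)
  have pair: "pairing \<beta> \<eta> = 3 * E \<beta> \<beta>"
  proof -
    have "pairing \<eta> \<beta> = k * pairing \<beta> \<beta> + m * pairing \<beta>' \<beta>"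
      unfolding \<eta>_def pairing_add_left pairing_scale_left ..
    then show ?thesis
      using D(1) pairing_skew[of \<beta> \<eta>] pairing_skew[of \<beta> \<beta>'] by (simp add: m_def D_def[symmetric])
  qed
  have "D\<^sup>2 * E \<eta> \<eta> = (D * k) * (D * k) * E \<beta> \<beta> + 2 * (D * k) * (D * m) * E \<beta> \<beta>' + (D * m) * (D * m) * E \<beta>' \<beta>'"
    unfolding \<eta>_def EE by (simp add: power2_eq_square algebra_simps)
  also have "\<dots> = E \<beta> \<beta> * (9 * (E \<beta> \<beta> * E \<beta>' \<beta>' - E \<beta> \<beta>' * E \<beta> \<beta>'))"
    using D(1) by (simp add: k_def m_def algebra_simps)
  finally have E\<eta>: "E \<eta> \<eta> = E \<beta> \<beta>" unfolding D(2)[symmetric] using D(1) by simp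
  have "ct Q d * (cmod (F d))\<^sup>2 = ct Q d * \<beta> d * \<beta> d + ct Q d * \<eta> d * \<eta> d" for d
    unfolding F_def cmod_power2 complex.sel by (simp add: power2_eq_square algebra_simps)
  then have "(\<Sum>d\<in>UNIV. ct Q d * (cmod (F d))\<^sup>2) = E \<beta> \<beta> + E \<eta> \<eta>"
    unfolding E_def sum.distrib[symmetric] by simp
  then have "3 * (\<Sum>d\<in>UNIV. ct Q d * (cmod (F d))\<^sup>2) \<le> 2 * pairing (\<lambda>d. Re (F d)) (\<lambda>d. Im (F d))"
    by (simp add: F_def pair E\<eta>)
  from energy_zero[OF Q F this] show ?thesis
    by (rule euclidean_of_form[OF Q F, of d0]) (use \<beta>(2) in \<open>simp add: F_def complex_eq_iff\<close>)
qed

end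

section \<open>Tangent vectors and harmonic forms\<close>

lemma ex_orthogonal_projection:
  fixes S :: "'a::euclidean_space set"
  assumes S: "subspace S"
  obtains p where "linear p" "\<And>x. p x \<in> S" "\<And>x y. y \<in> S \<Longrightarrow> (x - p x) \<bullet> y = 0"
proof -
  obtain B where B: "B \<subseteq> S" "pairwise orthogonal B" "\<And>x. x \<in> B \<Longrightarrow> norm x = 1"
    "independent B" "span B = S"
    using orthonormal_basis_subspace[OF S] by metis
  have fin: "finite B" using B(4) by (rule independent_imp_finite)
  define p where "p x = (\<Sum>b\<in>B. (x \<bullet> b) *\<^sub>R b)" for x
  have "linear p"
    by (rule linearI) (simp_all add: p_def inner_add_left scaleR_left.sum algebra_simps sum.distrib scaleR_right.sum)
  moreover have "p x \<in> S" for x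
    unfolding p_def using B(1) S by (intro subspace_sum subspace_scale) auto
  moreover have "(x - p x) \<bullet> y = 0" if "y \<in> S" for x y
  proof -
    have "orthogonal (x - p x) b" if b: "b \<in> B" for b
    proof -
      have "p x \<bullet> b = (\<Sum>c\<in>B. (x \<bullet> c) * (c \<bullet> b))" by (simp add: p_def inner_sum_left)
      also have "\<dots> = (\<Sum>c\<in>B. if c = b then x \<bullet> b else 0)"
        using B(2,3) b by (intro sum.cong) (auto simp: pairwise_def orthogonal_def norm_eq_1)
      also have "\<dots> = x \<bullet> b" using fin b by simp
      finally show ?thesis by (simp add: orthogonal_def inner_diff_left)
    qed
    then show ?thesis using orthogonal_to_span[of y B "x - p x"] that B(5) by (simp add: orthogonal_def)
  qed
  ultimately show ?thesis using that by blast
qed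

lemma orthogonal_split:
  fixes S :: "'a::euclidean_space set"
  assumes S: "subspace S" and w: "w \<in> S" and v: "\<And>y. y \<in> S \<Longrightarrow> v \<bullet> y = 0" "\<And>y. y \<in> S \<Longrightarrow> v' \<bullet> y = 0"
    and eq: "w + v = v'"
  shows "w = 0" "v = v'"
proof -
  have "w = v' - v" using eq by (simp add: algebra_simps)
  then have "w \<bullet> w = (v' - v) \<bullet> w" by simp
  also have "\<dots> = 0" using v w by (simp add: inner_diff_left)
  finally show "w = 0" by simp
  then show "v = v'" using eq by simp
qed

text \<open>A chain rule for sequences: the points \<open>\<delta> n\<close> need not lie on a
  differentiable curve, only a limiting direction is required.\<close>

lemma secant_tendsto:
  fixes f :: "'a::real_normed_vector \<Rightarrow> 'b::real_normed_vector"
  assumes D: "(f has_derivative D) (at 0)"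
    and \<delta>: "\<delta> \<longlonglongrightarrow> 0" and t: "\<And>n. 0 < t n" and w: "(\<lambda>n. \<delta> n /\<^sub>R t n) \<longlonglongrightarrow> w"
  shows "(\<lambda>n. (f (\<delta> n) - f 0) /\<^sub>R t n) \<longlonglongrightarrow> D w"
proof -
  have bl: "bounded_linear D" using D by (rule has_derivative_bounded_linear)
  define err where "err h = f h - f 0 - D h" for h
  have "(\<lambda>n. err (\<delta> n) /\<^sub>R t n) \<longlonglongrightarrow> 0"
  proof (rule tendstoI)
    fix e :: real assume e: "0 < e"
    obtain K where K: "0 < K" "\<And>n. norm (\<delta> n /\<^sub>R t n) \<le> K"
      using convergent_imp_Bseq[OF convergentI[OF w]] unfolding Bseq_def by blast
    have "0 < e / (2 * K)" using e K by simp
    then obtain d where d: "0 < d" "\<And>h. norm h < d \<Longrightarrow> norm (err h) \<le> e / (2 * K) * norm h"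
      using D unfolding has_derivative_at_alt err_def by auto
    have "\<forall>\<^sub>F n in sequentially. norm (\<delta> n) < d"
      using tendstoD[OF \<delta> d(1)] by (simp add: dist_norm)
    then show "\<forall>\<^sub>F n in sequentially. dist (err (\<delta> n) /\<^sub>R t n) 0 < e"
    proof eventually_elim
      case (elim n)
      have "norm (err (\<delta> n) /\<^sub>R t n) = norm (err (\<delta> n)) / t n"
        using t[of n] by (simp add: divide_inverse_commute)
      also have "\<dots> \<le> (e / (2 * K) * norm (\<delta> n)) / t n"
        by (rule divide_right_mono[OF d(2)[OF elim]]) (simp add: t less_imp_le)
      also have "\<dots> = e / (2 * K) * norm (\<delta> n /\<^sub>R t n)"
      proof -
        have "norm (\<delta> n /\<^sub>R t n) = norm (\<delta> n) / t n"
          using t[of n] by (simp add: divide_inverse_commute)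
        then show ?thesis by (simp only: times_divide_eq_right)
      qed
      also have "\<dots> \<le> e / (2 * K) * K" using K(2)[of n] e K(1) by (intro mult_left_mono) auto
      also have "\<dots> < e" using e K(1) by simp
      finally show ?case by simp
    qed
  qed
  moreover have "(\<lambda>n. D (\<delta> n /\<^sub>R t n)) \<longlonglongrightarrow> D w" by (rule bounded_linear.tendsto[OF bl w])
  ultimately have "(\<lambda>n. D (\<delta> n /\<^sub>R t n) + err (\<delta> n) /\<^sub>R t n) \<longlonglongrightarrow> D w + 0" by (intro tendsto_add)
  moreover have "D (\<delta> n /\<^sub>R t n) + err (\<delta> n) /\<^sub>R t n = (f (\<delta> n) - f 0) /\<^sub>R t n" for n
    using linear_scale[OF bounded_linear.linear[OF bl], of "inverse (t n)" "\<delta> n"]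
    by (simp add: err_def scaleR_diff_right)
  ultimately show ?thesis by simp
qed

text \<open>Injectivity of \<open>D\<close> on \<open>S\<close> bounds \<open>\<delta> n\<close> by
  the increments of \<open>f\<close>, hence by \<open>t n\<close>; so the quotients are eventually
  bounded and a subsequence converges.\<close>

lemma secant_subsequence:
  fixes f :: "'a::euclidean_space \<Rightarrow> 'b::euclidean_space"
  assumes D: "(f has_derivative D) (at 0)" and S: "subspace S"
    and inj: "\<And>u. u \<in> S \<Longrightarrow> D u = 0 \<Longrightarrow> u = 0"
    and \<delta>: "\<And>n. \<delta> n \<in> S" "\<delta> \<longlonglongrightarrow> 0" and t: "\<And>n. 0 < t n"
    and x: "(\<lambda>n. (f (\<delta> n) - f 0) /\<^sub>R t n) \<longlonglongrightarrow> x"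
  obtains w r where "w \<in> S" "strict_mono (r :: nat \<Rightarrow> nat)" "(\<lambda>n. \<delta> (r n) /\<^sub>R t (r n)) \<longlonglongrightarrow> w" "D w = x"
proof -
  have bl: "bounded_linear D" using D by (rule has_derivative_bounded_linear)
  obtain c where c: "0 < c" "\<And>u. u \<in> S \<Longrightarrow> c * norm u \<le> norm (D u)"
    using injective_imp_isometric[OF closed_subspace[OF S] S bl] inj by (auto simp: mult.commute)
  obtain K where K: "0 < K" "\<And>n. norm ((f (\<delta> n) - f 0) /\<^sub>R t n) \<le> K"
    using convergent_imp_Bseq[OF convergentI[OF x]] unfolding Bseq_def by blast
  obtain d where d: "0 < d" "\<And>h. norm h < d \<Longrightarrow> norm (f h - f 0 - D h) \<le> c / 2 * norm h"
    using D c(1) unfolding has_derivative_at_alt by (auto dest: spec[of _ "c / 2"])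
  obtain N where N: "\<And>n. n \<ge> N \<Longrightarrow> norm (\<delta> n) < d"
    using \<delta>(2) d(1) unfolding lim_sequentially dist_norm by auto
  have bd: "norm (\<delta> (n + N) /\<^sub>R t (n + N)) \<le> 2 * K / c" for n
  proof -
    let ?n = "n + N"
    have "c * norm (\<delta> ?n) \<le> norm (D (\<delta> ?n))" by (rule c(2)[OF \<delta>(1)])
    also have "\<dots> \<le> norm (f (\<delta> ?n) - f 0) + norm (f (\<delta> ?n) - f 0 - D (\<delta> ?n))"
      using norm_triangle_ineq4[of "f (\<delta> ?n) - f 0" "f (\<delta> ?n) - f 0 - D (\<delta> ?n)"] by simp
    also have "norm (f (\<delta> ?n) - f 0 - D (\<delta> ?n)) \<le> c / 2 * norm (\<delta> ?n)" by (rule d(2)) (simp add: N)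
    finally have "c / 2 * norm (\<delta> ?n) \<le> norm (f (\<delta> ?n) - f 0)" by simp
    moreover have "norm (f (\<delta> ?n) - f 0) \<le> K * t ?n"
      using K(2)[of ?n] t[of ?n] by (simp add: divide_simps)
    ultimately have "c * norm (\<delta> ?n) \<le> 2 * K * t ?n" by linarith
    then show ?thesis using c(1) t[of ?n] by (simp add: divide_simps mult_ac)
  qed
  have "bounded (range (\<lambda>n. \<delta> (n + N) /\<^sub>R t (n + N)))"
    using bd by (auto simp: bounded_iff)
  then obtain w r where r: "strict_mono (r :: nat \<Rightarrow> nat)"
    "((\<lambda>n. \<delta> (n + N) /\<^sub>R t (n + N)) \<circ> r) \<longlonglongrightarrow> w"
    using bounded_imp_convergent_subsequence by metis
  define r' where "r' n = r n + N" for n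
  have r': "strict_mono r'" using r(1) by (simp add: strict_mono_def r'_def)
  have w: "(\<lambda>n. \<delta> (r' n) /\<^sub>R t (r' n)) \<longlonglongrightarrow> w" using r(2) by (simp add: o_def r'_def)
  have "w \<in> S"
    by (rule closed_sequentially[OF closed_subspace[OF S] _ w]) (simp add: subspace_scale[OF S] \<delta>(1))
  moreover have "D w = x"
  proof (rule LIMSEQ_unique)
    show "(\<lambda>n. (f (\<delta> (r' n)) - f 0) /\<^sub>R t (r' n)) \<longlonglongrightarrow> D w"
      by (rule secant_tendsto[OF D _ _ w]) (use LIMSEQ_subseq_LIMSEQ[OF \<delta>(2) r'] t in \<open>auto simp: o_def\<close>)
    show "(\<lambda>n. (f (\<delta> (r' n)) - f 0) /\<^sub>R t (r' n)) \<longlonglongrightarrow> x"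
      using LIMSEQ_subseq_LIMSEQ[OF x r'] by (simp add: o_def)
  qed
  ultimately show ?thesis using that r' w by blast
qed

lemma complex_sphere_subsequence:
  fixes s :: "nat \<Rightarrow> complex"
  obtains r where "strict_mono (r :: nat \<Rightarrow> nat)"
    "(\<exists>z. (\<lambda>n. s (r n)) \<longlonglongrightarrow> z) \<or> filterlim (\<lambda>n. s (r n)) at_infinity sequentially"
proof (cases "\<exists>B. infinite {n. cmod (s n) \<le> B}")
  case True
  then obtain B where "infinite {n. cmod (s n) \<le> B}" by blast
  then obtain r where r: "strict_mono (r :: nat \<Rightarrow> nat)" "\<And>n. cmod (s (r n)) \<le> B"
    using infinite_enumerate[of "{n. cmod (s n) \<le> B}"] by auto
  then have "bounded (range (s \<circ> r))" by (auto simp: bounded_iff)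
  then obtain z r' where r': "strict_mono (r' :: nat \<Rightarrow> nat)" "((s \<circ> r) \<circ> r') \<longlonglongrightarrow> z"
    using bounded_imp_convergent_subsequence by metis
  then show ?thesis
    using that[of "r \<circ> r'"] strict_mono_o[OF r(1) r'(1)] by (auto simp: o_def)
next
  case False
  have "filterlim (\<lambda>n. s n) at_infinity sequentially"
    unfolding filterlim_at_infinity_conv_norm_at_top filterlim_at_top
  proof
    fix Z
    have "finite {n. cmod (s n) \<le> Z}" using False by blast
    then show "\<forall>\<^sub>F n in sequentially. Z \<le> cmod (s n)"
      unfolding cofinite_eq_sequentially[symmetric] eventually_cofinite
      by (rule rev_finite_subset) auto
  qed
  then show ?thesis using that[of "\<lambda>n. n"] by (simp add: strict_mono_def)
qed

lemma sphere_subsequence: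
  fixes s :: "nat \<Rightarrow> 'd::finite \<Rightarrow> complex"
  obtains r where "strict_mono (r :: nat \<Rightarrow> nat)"
    "\<And>d. (\<exists>z. (\<lambda>n. s (r n) d) \<longlonglongrightarrow> z) \<or> filterlim (\<lambda>n. s (r n) d) at_infinity sequentially"
proof -
  have "\<exists>r. strict_mono (r :: nat \<Rightarrow> nat) \<and>
    (\<forall>d\<in>A. (\<exists>z. (\<lambda>n. s (r n) d) \<longlonglongrightarrow> z) \<or> filterlim (\<lambda>n. s (r n) d) at_infinity sequentially)"
    if "finite A" for A
    using that
  proof induction
    case empty
    show ?case by (rule exI[of _ "\<lambda>n. n"]) (simp add: strict_mono_def)
  next
    case (insert d A)
    then obtain r where r: "strict_mono (r :: nat \<Rightarrow> nat)"
      "\<And>d. d \<in> A \<Longrightarrow> (\<exists>z. (\<lambda>n. s (r n) d) \<longlonglongrightarrow> z) \<or> filterlim (\<lambda>n. s (r n) d) at_infinity sequentially"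
      by blast
    obtain r' where r': "strict_mono (r' :: nat \<Rightarrow> nat)"
      "(\<exists>z. (\<lambda>n. s (r (r' n)) d) \<longlonglongrightarrow> z) \<or> filterlim (\<lambda>n. s (r (r' n)) d) at_infinity sequentially"
      using complex_sphere_subsequence[of "\<lambda>n. s (r n) d"] by blast
    have "(\<exists>z. (\<lambda>n. s (r (r' n)) e) \<longlonglongrightarrow> z) \<or> filterlim (\<lambda>n. s (r (r' n)) e) at_infinity sequentially"
      if "e \<in> A" for e
      using r(2)[OF that]
    proof
      assume "\<exists>z. (\<lambda>n. s (r n) e) \<longlonglongrightarrow> z"
      then obtain z where "(\<lambda>n. s (r n) e) \<longlonglongrightarrow> z" by blast
      from LIMSEQ_subseq_LIMSEQ[OF this r'(1)] show ?thesis by (auto simp: o_def)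
    next
      assume "filterlim (\<lambda>n. s (r n) e) at_infinity sequentially"
      from filterlim_compose[OF this filterlim_subseq[OF r'(1)]] show ?thesis by simp
    qed
    then show ?case
      using r' strict_mono_o[OF r(1) r'(1)] by (intro exI[of _ "r \<circ> r'"]) (auto simp: o_def)
  qed
  from this[of UNIV] show ?thesis using that by auto
qed

lemma vec_nth_vec_lambda [simp]: "($) (vec_lambda f) = f"
  by (rule ext) simp

section \<open>Exact, closed and harmonic forms\<close>

context angled_torus
begin

definition exact :: "('d set \<Rightarrow> real) \<Rightarrow> 'd \<Rightarrow> real" where
  "exact \<phi> d = \<phi> (org M (rv d)) - \<phi> (org M d)"

definition exact_forms :: "(real^'d) set" where
  "exact_forms = range (\<lambda>\<phi>. \<chi> d. exact \<phi> d)"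

definition closed_forms :: "(real^'d) set" where
  "closed_forms = {u. cocycle (($) u)}"

text \<open>The linearisation of \<open>balanced\<close> at the angles of \<open>Q\<close>.\<close>

definition harmonic :: "('d \<Rightarrow> complex) \<Rightarrow> ('d \<Rightarrow> real) \<Rightarrow> bool" where
  "harmonic Q \<beta> \<longleftrightarrow> (\<forall>\<phi>. (\<Sum>d\<in>UNIV. ct Q d * \<beta> d * exact \<phi> d) = 0)"

lemma cocycle_exact: "cocycle (exact \<phi>)"
  by (simp add: cocycle_def exact_def)

lemma cocycle_add: "cocycle s \<Longrightarrow> cocycle t \<Longrightarrow> cocycle (\<lambda>d. s d + t d)" for s t :: "'d \<Rightarrow> real"
proof -
  assume s: "cocycle s" and t: "cocycle t"
  have "s d + t d + (s (nx d) + t (nx d)) + (s (nx (nx d)) + t (nx (nx d)))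
    = (s d + s (nx d) + s (nx (nx d))) + (t d + t (nx d) + t (nx (nx d)))" for d by simp
  then show ?thesis
    by (simp add: cocycle_def cocycle_rv[OF s] cocycle_rv[OF t] cocycle_face[OF s] cocycle_face[OF t])
qed

lemma cocycle_scale: "cocycle s \<Longrightarrow> cocycle (\<lambda>d. k * s d)" for s :: "'d \<Rightarrow> real"
  unfolding cocycle_def by (metis distrib_left mult_minus_right mult_zero_right)

lemma subspace_closed_forms: "subspace closed_forms"
  unfolding subspace_def closed_forms_def
  using cocycle_add cocycle_scale by (auto simp: cocycle_def)

lemma subspace_exact_forms: "subspace exact_forms"
  unfolding subspace_def exact_forms_def
proof (intro conjI ballI allI)
  show "0 \<in> range (\<lambda>\<phi>. \<chi> d. exact \<phi> d)"
    by (rule image_eqI[of _ _ "\<lambda>_. 0"]) (simp_all add: exact_def vec_eq_iff)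
  show "x + y \<in> range (\<lambda>\<phi>. \<chi> d. exact \<phi> d)" if xy: "x \<in> range (\<lambda>\<phi>. \<chi> d. exact \<phi> d)" "y \<in> range (\<lambda>\<phi>. \<chi> d. exact \<phi> d)" for x y
  proof -
    from xy obtain \<phi> \<psi> where e: "x = (\<chi> d. exact \<phi> d)" "y = (\<chi> d. exact \<psi> d)" by blast
    show ?thesis
      by (rule image_eqI[of _ _ "\<lambda>v. \<phi> v + \<psi> v"]) (simp_all add: e exact_def vec_eq_iff)
  qed
  show "c *\<^sub>R x \<in> range (\<lambda>\<phi>. \<chi> d. exact \<phi> d)" if x: "x \<in> range (\<lambda>\<phi>. \<chi> d. exact \<phi> d)" for c x
  proof -
    from x obtain \<phi> where e: "x = (\<chi> d. exact \<phi> d)" by blast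
    show ?thesis
      by (rule image_eqI[of _ _ "\<lambda>v. c * \<phi> v"]) (simp_all add: e exact_def vec_eq_iff right_diff_distrib)
  qed
qed

lemma exact_closed: "exact_forms \<subseteq> closed_forms"
  by (auto simp: exact_forms_def closed_forms_def cocycle_exact)

lemma sum_exact:
  "(\<Sum>d\<in>UNIV. ln (sin (\<alpha> d)) * exact \<phi> d) = (\<Sum>v\<in>verts M. \<phi> v * (\<Sum>e\<in>v. logside \<alpha> (nx e)))"
proof -
  let ?l = "\<lambda>d. ln (sin (\<alpha> d))"
  have "(\<Sum>d\<in>UNIV. ?l d * exact \<phi> d) = (\<Sum>d\<in>UNIV. ?l d * \<phi> (org M (rv d))) - (\<Sum>d\<in>UNIV. ?l d * \<phi> (org M d))"
    by (simp add: exact_def right_diff_distrib sum_subtractf)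
  also have "(\<Sum>d\<in>UNIV. ?l d * \<phi> (org M (rv d))) = (\<Sum>d\<in>UNIV. ?l (nx (nx d)) * \<phi> (org M (rv (nx (nx d)))))"
    using sum_nx[of "\<lambda>d. ?l d * \<phi> (org M (rv d))"] sum_nx[of "\<lambda>d. ?l (nx d) * \<phi> (org M (rv (nx d)))"] by (simp only:)
  also have "\<dots> = (\<Sum>d\<in>UNIV. ?l (nx (nx d)) * \<phi> (org M d))" by simp
  finally have "(\<Sum>d\<in>UNIV. ?l d * exact \<phi> d) = (\<Sum>d\<in>UNIV. \<phi> (org M d) * logside \<alpha> (nx d))"
    by (simp add: logside_def right_diff_distrib sum_subtractf mult.commute)
  also have "\<dots> = (\<Sum>v\<in>verts M. \<Sum>d\<in>v. \<phi> (org M d) * logside \<alpha> (nx d))" by (rule sum_verts[symmetric])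
  also have "\<dots> = (\<Sum>v\<in>verts M. \<phi> v * (\<Sum>e\<in>v. logside \<alpha> (nx e)))"
  proof (rule sum.cong)
    fix v assume "v \<in> verts M"
    then obtain e where v: "v = org M e" by (auto simp: verts_def)
    show "(\<Sum>d\<in>v. \<phi> (org M d) * logside \<alpha> (nx d)) = \<phi> v * (\<Sum>e\<in>v. logside \<alpha> (nx e))"
      unfolding sum_distrib_left by (rule sum.cong) (auto simp: v org_eq_iff)
  qed simp
  finally show ?thesis .
qed

text \<open>Testing the vertex equations against functions on the vertices turns them into
  orthogonality of \<open>ln (sin \<alpha>)\<close> to the exact forms.\<close>

lemma balanced_iff: "balanced \<alpha> \<longleftrightarrow> (\<forall>\<phi>. (\<Sum>d\<in>UNIV. ln (sin (\<alpha> d)) * exact \<phi> d) = 0)"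
proof
  assume b: "balanced \<alpha>"
  then have "(\<Sum>e\<in>v. logside \<alpha> (nx e)) = 0" if "v \<in> verts M" for v
    using that by (auto simp: balanced_def verts_def)
  then show "\<forall>\<phi>. (\<Sum>d\<in>UNIV. ln (sin (\<alpha> d)) * exact \<phi> d) = 0" unfolding sum_exact by simp
next
  assume z: "\<forall>\<phi>. (\<Sum>d\<in>UNIV. ln (sin (\<alpha> d)) * exact \<phi> d) = 0"
  show "balanced \<alpha>"
    unfolding balanced_def
  proof
    fix d
    have "(\<Sum>v\<in>verts M. of_bool (v = org M d) * (\<Sum>e\<in>v. logside \<alpha> (nx e))) = 0"
      using z[rule_format, of "\<lambda>v. of_bool (v = org M d)"] unfolding sum_exact .
    moreover have "(\<Sum>v\<in>verts M. of_bool (v = org M d) * (\<Sum>e\<in>v. logside \<alpha> (nx e)))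
      = (\<Sum>v\<in>{org M d}. of_bool (v = org M d) * (\<Sum>e\<in>v. logside \<alpha> (nx e)))"
      by (rule sum.mono_neutral_right) (auto simp: verts_def)
    ultimately show "(\<Sum>e\<in>org M d. logside \<alpha> (nx e)) = 0" by simp
  qed
qed

lemma log_modulus_penner: "log_modulus \<alpha> d = penner_h M (\<lambda>d. ln (sin (\<alpha> d))) d"
  by (simp add: log_modulus_def logside_def penner_h_def)

lemma shape_cot:
  assumes Q: "shape X Q" shows "cot (Arg (Q d)) = ct Q d"
proof -
  have nz: "Q d \<noteq> 0" using shape_weak[OF Q] by (simp add: weak_shape_def)
  then show ?thesis by (simp add: cot_def cos_Arg sin_Arg ct_def)
qed

lemma triangle_angles_add:
  assumes "triangle_angles \<alpha>" "cocycle u" "\<And>d. 0 < \<alpha> d + u d"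
  shows "triangle_angles (\<lambda>d. \<alpha> d + u d)"
proof -
  have "\<alpha> d + u d + (\<alpha> (rv d) + u (rv d)) = pi - \<Theta> d" for d
    using triangle_anglesD(3)[OF assms(1), of d] by (simp add: cocycle_rv[OF assms(2)])
  moreover have "\<alpha> d + u d + (\<alpha> (nx d) + u (nx d)) + (\<alpha> (nx (nx d)) + u (nx (nx d))) = pi" for d
    using triangle_anglesD(4)[OF assms(1), of d] cocycle_face[OF assms(2), of d] by linarith
  ultimately show ?thesis using assms(3) by (simp add: triangle_angles_def)
qed

lemma triangle_angles_diff:
  assumes a: "triangle_angles \<alpha>" and b: "triangle_angles \<alpha>'"
  shows "cocycle (\<lambda>d. \<alpha>' d - \<alpha> d)"
proof -
  have "\<alpha>' (rv d) - \<alpha> (rv d) = - (\<alpha>' d - \<alpha> d)" for d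
    using triangle_anglesD(3)[OF a, of d] triangle_anglesD(3)[OF b, of d] by linarith
  moreover have "\<alpha>' d - \<alpha> d + (\<alpha>' (nx d) - \<alpha> (nx d)) + (\<alpha>' (nx (nx d)) - \<alpha> (nx (nx d))) = 0" for d
    using triangle_anglesD(4)[OF a, of d] triangle_anglesD(4)[OF b, of d] by linarith
  ultimately show ?thesis by (simp add: cocycle_def)
qed

lemma inner_exact: "(\<chi> d. f d) \<bullet> (\<chi> d. exact \<phi> d) = (\<Sum>d\<in>UNIV. f d * exact \<phi> d)"
  by (simp add: inner_vec_def)

text \<open>The two summands are orthogonal, so both vanish: \<open>h\<close> is exact and
  orthogonal to \<open>ct Q\<close> times \<open>h\<close>. Its energy is zero, and
  \<open>energy_pos\<close> applies.\<close>

lemma hodge_operator_inj: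
  fixes p :: "real^'d \<Rightarrow> real^'d"
  assumes Q: "shape X Q" and p: "linear p" "\<And>x. p x \<in> exact_forms"
    "\<And>x y. y \<in> exact_forms \<Longrightarrow> (x - p x) \<bullet> y = 0"
    and h: "p (\<chi> d. ct Q d * h $ d) + (h - p h) = 0"
  shows "h = 0"
proof -
  have z: "\<And>y. y \<in> exact_forms \<Longrightarrow> (0 :: real^'d) \<bullet> y = 0" by simp
  note os = orthogonal_split[OF subspace_exact_forms p(2) p(3) z h]
  have w: "p (\<chi> d. ct Q d * h $ d) = 0" and hp: "h - p h = 0" by (rule os; assumption)+
  then have hB: "h \<in> exact_forms" using p(2)[of h] by simp
  then have "(\<chi> d. ct Q d * h $ d) \<bullet> h = 0" using p(3)[of h "\<chi> d. ct Q d * h $ d"] w by simp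
  then have "(\<Sum>d\<in>UNIV. ct Q d * (h $ d)\<^sup>2) = 0"
    by (simp add: inner_vec_def power2_eq_square mult.assoc)
  moreover have "cocycle (($) h)" using hB exact_closed by (auto simp: closed_forms_def)
  ultimately have "($) h = (\<lambda>_. 0)" by (intro energy_pos[OF Q]) simp_all
  then show ?thesis by (simp add: vec_eq_iff fun_eq_iff)
qed

lemma linear_hodge_operator:
  fixes p :: "real^'d \<Rightarrow> real^'d"
  assumes p: "linear p"
  shows "linear (\<lambda>h. p (\<chi> d. ct Q d * h $ d) + (h - p h))"
proof (rule linearI)
  have a: "(\<chi> d. ct Q d * (b + c) $ d) = (\<chi> d. ct Q d * b $ d) + (\<chi> d. ct Q d * c $ d)" for b c :: "real^'d"
    by (simp add: vec_eq_iff algebra_simps)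
  have s: "(\<chi> d. ct Q d * (r *\<^sub>R b) $ d) = r *\<^sub>R (\<chi> d. ct Q d * b $ d)" for r and b :: "real^'d"
    by (simp add: vec_eq_iff)
  show "p (\<chi> d. ct Q d * (b + c) $ d) + (b + c - p (b + c)) =
       p (\<chi> d. ct Q d * b $ d) + (b - p b) + (p (\<chi> d. ct Q d * c $ d) + (c - p c))" for b c
    unfolding a linear_add[OF p] by simp
  show "p (\<chi> d. ct Q d * (r *\<^sub>R b) $ d) + (r *\<^sub>R b - p (r *\<^sub>R b)) =
       r *\<^sub>R (p (\<chi> d. ct Q d * b $ d) + (b - p b))" for r b
    unfolding s linear_scale[OF p] by (simp add: algebra_simps)
qed

text \<open>As the weights may be negative, the representative comes from surjectivity of an
  injective operator instead of an energy projection. The two summands of the operator encode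
  harmonicity of \<open>b\<close> and equality with \<open>z\<close> modulo exact forms.\<close>

lemma ex_harmonic:
  assumes Q: "shape X Q" and z: "cocycle z"
  obtains \<beta> \<phi> where "cocycle \<beta>" "harmonic Q \<beta>" "\<And>d. z d = \<beta> d + exact \<phi> d"
proof -
  obtain p where p: "linear p" "\<And>x. p x \<in> exact_forms" "\<And>x y. y \<in> exact_forms \<Longrightarrow> (x - p x) \<bullet> y = 0"
    using ex_orthogonal_projection[OF subspace_exact_forms] by metis
  let ?D = "\<lambda>h. p (\<chi> d. ct Q d * h $ d) + (h - p h)"
  have lin: "linear ?D" by (rule linear_hodge_operator[OF p(1)])
  have "inj ?D" using hodge_operator_inj[OF Q p] by (subst linear_injective_0[OF lin]) blast
  then have "surj ?D" by (rule linear_injective_imp_surjective[OF lin]) simp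
  define zv :: "real^'d" where "zv = (\<chi> d. z d)"
  obtain b where b: "zv - p zv = ?D b" using \<open>surj ?D\<close> by (meson surjD)
  have w: "p (\<chi> d. ct Q d * b $ d) = 0" and bz: "b - p b = zv - p zv"
    using orthogonal_split[OF subspace_exact_forms p(2) p(3) p(3) b[symmetric]] by auto
  have "zv - b = p zv - p b" using bz by (simp add: algebra_simps)
  also have "\<dots> \<in> exact_forms" by (rule subspace_diff[OF subspace_exact_forms p(2) p(2)])
  finally obtain \<phi> where \<phi>: "zv - b = (\<chi> d. exact \<phi> d)" by (auto simp: exact_forms_def)
  have zd: "z d = b $ d + exact \<phi> d" for d
    using arg_cong[OF \<phi>, of "\<lambda>v. v $ d"] by (simp add: zv_def)
  have "cocycle (\<lambda>d. z d + (-1) * exact \<phi> d)"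
    by (rule cocycle_add[OF z cocycle_scale[OF cocycle_exact]])
  then have "cocycle (($) b)" by (simp add: zd)
  moreover have "harmonic Q (($) b)"
    unfolding harmonic_def
  proof
    fix \<psi>
    have "(\<chi> d. exact \<psi> d) \<in> exact_forms" by (simp add: exact_forms_def)
    then have "((\<chi> d. ct Q d * b $ d) - p (\<chi> d. ct Q d * b $ d)) \<bullet> (\<chi> d. exact \<psi> d) = 0" by (rule p(3))
    then show "(\<Sum>d\<in>UNIV. ct Q d * b $ d * exact \<psi> d) = 0" unfolding w by (simp add: inner_vec_def)
  qed
  ultimately show ?thesis using that zd by blast
qed

lemma has_derivative_ln_sin:
  fixes u :: "real^'d"
  assumes "0 < sin (a + u $ d)"
  shows "((\<lambda>u. ln (sin (a + u $ d))) has_derivative (\<lambda>h. cot (a + u $ d) * h $ d)) (at u)"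
proof -
  have "((\<lambda>u. u $ d) has_derivative (\<lambda>h. h $ d)) (at u)"
    by (rule bounded_linear.has_derivative[OF bounded_linear_vec_nth has_derivative_ident])
  note [derivative_intros] = this
  show ?thesis
    by (rule has_derivative_eq_rhs, (rule derivative_intros assms)+)
       (auto simp: cot_def divide_inverse mult_ac)
qed

text \<open>
  The map \<open>f\<close> completes the equations for balanced angles to a local diffeomorphism: its exact part is
  that of the gradient \<open>ln (sin \<alpha>)\<close> of the volume functional, its part orthogonal to the exact forms
  that of the perturbation itself.
\<close>

lemma harmonic_curve:
  assumes X: "X \<in> circle_patterns M \<Theta>" and Q: "shape X Q" and \<beta>: "cocycle \<beta>" "harmonic Q \<beta>"
  obtains V g where "open V" "0 \<in> V" "g 0 = (0 :: real^'d)"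
    "\<And>t :: real. t \<in> V \<Longrightarrow> triangle_angles (\<lambda>d. Arg (Q d) + g t $ d) \<and> balanced (\<lambda>d. Arg (Q d) + g t $ d)"
    "(g has_vector_derivative (\<chi> d. \<beta> d)) (at 0)"
proof -
  obtain p where p: "linear p" "\<And>x. p x \<in> exact_forms" "\<And>x y. y \<in> exact_forms \<Longrightarrow> (x - p x) \<bullet> y = 0"
    using ex_orthogonal_projection[OF subspace_exact_forms] by metis
  define \<alpha> where "\<alpha> d = Arg (Q d)" for d
  have ta: "triangle_angles \<alpha>" and ba: "balanced \<alpha>"
    using shape_pattern_of[OF X Q] unfolding \<alpha>_def by auto
  have cot\<alpha>: "cot (\<alpha> d) = ct Q d" for d unfolding \<alpha>_def by (rule shape_cot[OF Q])
  let ?D = "\<lambda>h. p (\<chi> d. ct Q d * h $ d) + (h - p h)"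
  have linD: "linear ?D" by (rule linear_hodge_operator[OF p(1)])
  have injD: "inj ?D" using hodge_operator_inj[OF Q p] by (subst linear_injective_0[OF linD]) blast
  \<comment> \<open>Expanding \<open>p\<close> in coordinates writes the derivative of
    \<open>f\<close> as a finite sum of fixed operators with continuous coefficients, which makes it
    continuous in the operator norm.\<close>
  define c where "c d = p (axis d 1)" for d
  have p_sum: "p (\<chi> d. y d) = (\<Sum>d\<in>UNIV. y d *\<^sub>R c d)" for y
  proof -
    have "(\<chi> d. y d) = (\<Sum>d\<in>UNIV. y d *\<^sub>R axis d (1::real))"
      by (simp add: vec_eq_iff axis_def if_distrib cong: if_cong)
    then show ?thesis by (simp add: linear_sum[OF p(1)] linear_scale[OF p(1)] c_def)
  qed
  define U where "U = {u :: real^'d. \<forall>d. 0 < \<alpha> d + u $ d \<and> \<alpha> d + u $ d < pi}"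
  have U_eq: "U = (\<Inter>d. {u. 0 < \<alpha> d + u $ d} \<inter> {u. \<alpha> d + u $ d < pi})" by (auto simp: U_def)
  have oU: "open U"
    unfolding U_eq by (intro open_INT finite ballI open_Int open_Collect_less continuous_intros)
  have U0: "0 \<in> U" using triangle_anglesD(1,2)[OF ta] by (simp add: U_def)
  have sinU: "0 < sin (\<alpha> d + u $ d)" if "u \<in> U" for u d
    using that by (intro sin_gt_zero) (auto simp: U_def)
  define f where "f u = (\<Sum>d\<in>UNIV. ln (sin (\<alpha> d + u $ d)) *\<^sub>R c d) + (u - p u)" for u :: "real^'d"
  have blp: "bounded_linear p" using p(1) by (rule linear_conv_bounded_linear[THEN iffD1])
  define Lb where "Lb d = Blinfun (\<lambda>h :: real^'d. h $ d *\<^sub>R c d)" for d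
  have Lb: "blinfun_apply (Lb d) h = h $ d *\<^sub>R c d" for d h
    unfolding Lb_def by (rule bounded_linear_Blinfun_apply[THEN fun_cong])
      (intro bounded_linear_compose[OF bounded_linear_scaleR_left bounded_linear_vec_nth])
  define L0 where "L0 = Blinfun (\<lambda>h :: real^'d. h - p h)"
  have L0: "blinfun_apply L0 h = h - p h" for h
    unfolding L0_def by (rule bounded_linear_Blinfun_apply[THEN fun_cong])
      (intro bounded_linear_sub bounded_linear_ident blp)
  define f' where "f' u = (\<Sum>d\<in>UNIV. cot (\<alpha> d + u $ d) *\<^sub>R Lb d) + L0" for u :: "real^'d"
  have f'_apply: "blinfun_apply (f' u) h = (\<Sum>d\<in>UNIV. (cot (\<alpha> d + u $ d) * h $ d) *\<^sub>R c d) + (h - p h)" for u h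
    by (simp add: f'_def blinfun.add_left blinfun.sum_left blinfun.scaleR_left Lb L0)
  have f'0: "blinfun_apply (f' 0) = ?D"
    by (rule ext) (simp add: f'_apply p_sum cot\<alpha>)
  have der: "(f has_derivative blinfun_apply (f' u)) (at u)" if u: "u \<in> U" for u
  proof -
    have "((\<lambda>u. \<Sum>d\<in>UNIV. ln (sin (\<alpha> d + u $ d)) *\<^sub>R c d) has_derivative
        (\<lambda>h. \<Sum>d\<in>UNIV. (cot (\<alpha> d + u $ d) * h $ d) *\<^sub>R c d)) (at u)"
      by (intro has_derivative_sum has_derivative_scaleR_left has_derivative_ln_sin sinU u)
    moreover have "((\<lambda>u. u - p u) has_derivative (\<lambda>h. h - p h)) (at u)"
      by (intro has_derivative_diff has_derivative_ident bounded_linear_imp_has_derivative blp)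
    ultimately show ?thesis
      unfolding f_def[abs_def] f'_apply[abs_def] by (rule has_derivative_add)
  qed
  have cont: "continuous_on U f'"
    unfolding f'_def cot_def
    by (intro continuous_intros) (use sinU in \<open>auto simp: less_imp_neq[THEN not_sym]\<close>)
  obtain G where G: "linear G" "G \<circ> ?D = id" using linear_injective_left_inverse[OF linD injD] by blast
  have "Blinfun G o\<^sub>L f' 0 = id_blinfun"
  proof (rule blinfun_eqI)
    fix h
    have "blinfun_apply (Blinfun G) = G"
      using G(1) by (intro bounded_linear_Blinfun_apply) (simp add: linear_conv_bounded_linear)
    then show "blinfun_apply (Blinfun G o\<^sub>L f' 0) h = blinfun_apply id_blinfun h"
      using fun_cong[OF G(2), of h] by (simp add: f'0)
  qed
  from inverse_function_theorem[OF oU der cont U0 this] obtain U' V g g' where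
    V: "open U'" "U' \<subseteq> U" "0 \<in> U'" "open V" "f 0 \<in> V" "homeomorphism U' V f g"
    "\<And>y. y \<in> V \<Longrightarrow> (g has_derivative (g' y)) (at y)"
    "\<And>y. y \<in> V \<Longrightarrow> g' y = inv (blinfun_apply (f' (g y)))"
    by metis
  have gf: "\<And>x. x \<in> U' \<Longrightarrow> g (f x) = x" and fg: "\<And>y. y \<in> V \<Longrightarrow> f (g y) = y" and gV: "\<And>y. y \<in> V \<Longrightarrow> g y \<in> U'"
    using V(6) by (auto simp: homeomorphism_def)
  have grad: "(\<chi> d. ln (sin (\<alpha>' d))) \<bullet> y = 0" if "balanced \<alpha>'" "y \<in> exact_forms" for \<alpha>' y
    using that unfolding balanced_iff exact_forms_def by (auto simp: inner_exact)
  have f0: "f 0 = 0"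
  proof -
    let ?v = "\<chi> d. ln (sin (\<alpha> d))"
    have "p ?v + (?v - p ?v) = ?v" by simp
    from orthogonal_split(1)[OF subspace_exact_forms p(2) p(3) grad[OF ba] this] have "p ?v = 0" by auto
    then show ?thesis by (simp add: f_def p_sum linear_0[OF p(1)])
  qed
  have g0: "g 0 = 0" using gf[OF V(3)] by (simp add: f0)
  define \<beta>v :: "real^'d" where "\<beta>v = (\<chi> d. \<beta> d)"
  \<comment> \<open>Multiples of \<open>\<beta>'\<close> are orthogonal to the exact forms, so their
    preimages under \<open>f\<close> are balanced and differ from them by exact forms. Since \<beta>
    is harmonic, the derivative at 0 sends \<beta> to \<open>\<beta>'\<close>.\<close>
  define \<beta>' where "\<beta>' = \<beta>v - p \<beta>v"
  have "p (\<chi> d. ct Q d * \<beta>v $ d) = 0"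
  proof -
    let ?v = "\<chi> d. ct Q d * \<beta>v $ d"
    have "?v \<bullet> y = 0" if "y \<in> exact_forms" for y
      using that \<beta>(2) unfolding exact_forms_def harmonic_def by (auto simp: inner_vec_def \<beta>v_def)
    moreover have "p ?v + (?v - p ?v) = ?v" by simp
    ultimately show ?thesis using orthogonal_split(1)[OF subspace_exact_forms p(2) p(3)] by blast
  qed
  then have D\<beta>: "?D \<beta>v = \<beta>'" by (simp add: \<beta>'_def)
  have \<beta>'cl: "\<beta>' \<in> closed_forms"
    unfolding \<beta>'_def using p(2)[of \<beta>v] exact_closed \<beta>(1)
    by (intro subspace_diff[OF subspace_closed_forms]) (auto simp: \<beta>v_def closed_forms_def)
  define T where "T = {t. t *\<^sub>R \<beta>' \<in> V}"
  show ?thesis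
  proof (rule that[of T "\<lambda>t. g (t *\<^sub>R \<beta>')"])
    have "T = (\<lambda>t. t *\<^sub>R \<beta>') -` V" by (auto simp: T_def)
    then show "open T" using V(4) by (simp add: open_vimage continuous_intros)
    show "0 \<in> T" using V(5) by (simp add: T_def f0)
    show "g (0 *\<^sub>R \<beta>') = 0" by (simp add: g0)
    show "((\<lambda>t. g (t *\<^sub>R \<beta>')) has_vector_derivative (\<chi> d. \<beta> d)) (at 0)"
    proof -
      have "(g has_derivative g' 0) (at 0)" "g' 0 = inv ?D"
        using V(7)[of 0] V(8)[of 0] V(5) by (simp_all add: f0 g0 f'0)
      then have dg: "(g has_derivative inv ?D) (at (0 *\<^sub>R \<beta>'))" by simp
      have "((\<lambda>t. t *\<^sub>R \<beta>') has_derivative (\<lambda>t. t *\<^sub>R \<beta>')) (at 0)"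
        by (rule bounded_linear_imp_has_derivative[OF bounded_linear_scaleR_left])
      from has_derivative_compose[OF this dg]
      have "((\<lambda>t. g (t *\<^sub>R \<beta>')) has_derivative (\<lambda>t. inv ?D (t *\<^sub>R \<beta>'))) (at 0)" .
      moreover have "inv ?D (t *\<^sub>R \<beta>') = t *\<^sub>R \<beta>v" for t
      proof -
        have "t *\<^sub>R \<beta>' = ?D (t *\<^sub>R \<beta>v)" using linear_scale[OF linD, of t \<beta>v] D\<beta> by simp
        then show ?thesis using inv_f_f[OF injD, of "t *\<^sub>R \<beta>v"] by simp
      qed
      ultimately show ?thesis by (simp add: has_vector_derivative_def \<beta>v_def)
    qed
    show "triangle_angles (\<lambda>d. Arg (Q d) + g (t *\<^sub>R \<beta>') $ d) \<and> balanced (\<lambda>d. Arg (Q d) + g (t *\<^sub>R \<beta>') $ d)"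
      if t: "t \<in> T" for t
    proof -
      define u where "u = g (t *\<^sub>R \<beta>')"
      have tV: "t *\<^sub>R \<beta>' \<in> V" using t by (simp add: T_def)
      have uU: "u \<in> U" using gV[OF tV] V(2) by (auto simp: u_def)
      have eq: "p (\<chi> d. ln (sin (\<alpha> d + u $ d))) + (u - p u) = t *\<^sub>R \<beta>'"
        using fg[OF tV] by (simp add: f_def p_sum u_def)
      have "(t *\<^sub>R \<beta>') \<bullet> y = 0" if "y \<in> exact_forms" for y
        using p(3)[OF that, of \<beta>v] by (simp add: \<beta>'_def)
      from orthogonal_split[OF subspace_exact_forms p(2) p(3) this eq]
      have w: "p (\<chi> d. ln (sin (\<alpha> d + u $ d))) = 0" and up: "u - p u = t *\<^sub>R \<beta>'" by auto
      have "u = t *\<^sub>R \<beta>' + p u" using up by (simp add: algebra_simps)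
      moreover have "t *\<^sub>R \<beta>' + p u \<in> closed_forms"
        using \<beta>'cl p(2)[of u] exact_closed
        by (intro subspace_add[OF subspace_closed_forms] subspace_scale[OF subspace_closed_forms]) auto
      ultimately have "cocycle (($) u)" by (simp add: closed_forms_def)
      then have "triangle_angles (\<lambda>d. \<alpha> d + u $ d)"
        by (rule triangle_angles_add[OF ta]) (use uU in \<open>auto simp: U_def\<close>)
      moreover have "balanced (\<lambda>d. \<alpha> d + u $ d)"
        unfolding balanced_iff
      proof
        fix \<phi>
        have "(\<chi> d. exact \<phi> d) \<in> exact_forms" by (simp add: exact_forms_def)
        from p(3)[OF this, of "\<chi> d. ln (sin (\<alpha> d + u $ d))"]
        show "(\<Sum>d\<in>UNIV. ln (sin (\<alpha> d + u $ d)) * exact \<phi> d) = 0"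
          unfolding w by (simp add: inner_vec_def)
      qed
      ultimately show ?thesis by (simp add: u_def \<alpha>_def)
    qed
  qed
qed

lemma harmonic_pattern_tangent:
  assumes X: "X \<in> circle_patterns M \<Theta>" and Q: "shape X Q" and \<beta>: "cocycle \<beta>" "harmonic Q \<beta>"
  shows "modulus_variation Q \<beta> \<in> pattern_tangent M \<Theta> X"
proof (rule harmonic_curve[OF X Q \<beta>])
  fix V :: "real set" and g :: "real \<Rightarrow> real^'d"
  assume V: "open V" "0 \<in> V" and g0: "g 0 = 0"
    and g: "\<And>t. t \<in> V \<Longrightarrow> triangle_angles (\<lambda>d. Arg (Q d) + g t $ d) \<and> balanced (\<lambda>d. Arg (Q d) + g t $ d)"
    and dg: "(g has_vector_derivative (\<chi> d. \<beta> d)) (at 0)"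
  \<comment> \<open>A tangent vector asks for a curve defined at all times; outside \<open>V\<close>
    the constant \<open>X\<close> serves.\<close>
  define \<gamma> where "\<gamma> t = (if t \<in> V then pattern_of (\<lambda>d. Arg (Q d) + g t $ d) else X)" for t
  have sp: "triangle_angles (\<lambda>d. Arg (Q d))" "X = pattern_of (\<lambda>d. Arg (Q d))"
    using shape_pattern_of[OF X Q] by auto
  have "\<gamma> t \<in> circle_patterns M \<Theta>" for t
    using pattern_of_circle_patterns g[of t] X by (simp add: \<gamma>_def)
  moreover have "\<gamma> 0 = X" using V(2) sp(2) by (simp add: \<gamma>_def g0)
  moreover have "((\<lambda>t. ln (abs_embedding (\<gamma> t) d)) has_real_derivative modulus_variation Q \<beta> d) (at 0)" for d
  proof -
    have gd: "((\<lambda>t. g t $ e) has_real_derivative \<beta> e) (at 0)" for e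
      using has_derivative_compose[OF dg[unfolded has_vector_derivative_def]
        bounded_linear_imp_has_derivative[OF bounded_linear_vec_nth[of e]]]
      by (simp add: has_field_derivative_def mult_commute_abs)
    have ls: "((\<lambda>t. ln (sin (Arg (Q e) + g t $ e))) has_real_derivative ct Q e * \<beta> e) (at 0)" for e
    proof -
      have "0 < sin (Arg (Q e) + g 0 $ e)" using triangle_anglesD(5)[OF sp(1), of e] by (simp add: g0)
      then have "((\<lambda>t. ln (sin (Arg (Q e) + g t $ e))) has_real_derivative
          (cos (Arg (Q e) + g 0 $ e) * \<beta> e) / sin (Arg (Q e) + g 0 $ e)) (at 0)"
        by (auto intro!: derivative_eq_intros gd)
      moreover have "(cos (Arg (Q e) + g 0 $ e) * \<beta> e) / sin (Arg (Q e) + g 0 $ e) = ct Q e * \<beta> e"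
        unfolding shape_cot[OF Q, symmetric] by (simp add: g0 cot_def)
      ultimately show ?thesis by simp
    qed
    have "((\<lambda>t. penner_h M (\<lambda>e. ln (sin (Arg (Q e) + g t $ e))) d) has_real_derivative modulus_variation Q \<beta> d) (at 0)"
      unfolding modulus_variation_def penner_h_def by (intro DERIV_add DERIV_diff ls)
    then show ?thesis
    proof (rule has_field_derivative_transform_within_open[OF _ V])
      fix t assume "t \<in> V"
      then show "penner_h M (\<lambda>e. ln (sin (Arg (Q e) + g t $ e))) d = ln (abs_embedding (\<gamma> t) d)"
        using g ln_abs_pattern_of[of "\<lambda>d. Arg (Q d) + g t $ d" d] by (simp add: \<gamma>_def log_modulus_penner)
    qed
  qed
  ultimately show ?thesis unfolding pattern_tangent_def by blast
qed

end

lemma has_derivative_vecI: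
  fixes f :: "'a::real_normed_vector \<Rightarrow> real^'n"
  assumes "\<And>i. ((\<lambda>x. f x $ i) has_derivative (\<lambda>h. f' h $ i)) (at a)"
  shows "(f has_derivative f') (at a)"
  unfolding has_derivative_componentwise_within[of f f' a UNIV]
proof
  fix b :: "real^'n" assume "b \<in> Basis"
  then obtain i where "b = axis i 1" by (auto simp: Basis_vec_def)
  then show "((\<lambda>x. f x \<bullet> b) has_derivative (\<lambda>h. f' h \<bullet> b)) (at a)"
    using assms[of i] by (simp add: inner_axis)
qed

section \<open>Limits of flat sections and the tangent space\<close>

context angled_torus
begin

text \<open>The rules defining \<open>flat\<close> are continuous on the sphere, also in the
  coefficient as its limit \<open>X d\<close> is nonzero; \<open>None\<close> records a sequence
  tending to infinity.\<close>

lemma limit_flat: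
  assumes Y: "\<And>d. (\<lambda>n. Y n d) \<longlonglongrightarrow> X d" "\<And>d. X d \<noteq> 0" and sh: "\<And>n. shape (Y n) (q n)"
    and lim: "\<And>d. (\<exists>z. (\<lambda>n. q n d) \<longlonglongrightarrow> z) \<or> filterlim (\<lambda>n. q n d) at_infinity sequentially"
  obtains P where "flat X P" "\<And>d z. P d = Some z \<Longrightarrow> (\<lambda>n. q n d) \<longlonglongrightarrow> z"
proof -
  define P where "P d = (if \<exists>z. (\<lambda>n. q n d) \<longlonglongrightarrow> z then Some (SOME z. (\<lambda>n. q n d) \<longlonglongrightarrow> z) else None)" for d
  have c1: "(\<lambda>n. q n d) \<longlonglongrightarrow> z" if "P d = Some z" for d z
    using that someI_ex[of "\<lambda>z. (\<lambda>n. q n d) \<longlonglongrightarrow> z"] by (auto simp: P_def split: if_splits)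
  have c2: "filterlim (\<lambda>n. q n d) at_infinity sequentially" if "P d = None" for d
    using that lim[of d] by (auto simp: P_def split: if_splits)
  have c3: "P d = Some z" if z: "(\<lambda>n. q n d) \<longlonglongrightarrow> z" for d z
  proof -
    have "\<exists>w. P d = Some w" using z by (auto simp: P_def)
    then obtain w where w: "P d = Some w" ..
    then show ?thesis using LIMSEQ_unique[OF z c1[OF w]] by simp
  qed
  have c4: "P d = None" if inf: "filterlim (\<lambda>n. q n d) at_infinity sequentially" for d
  proof (cases "P d")
    case (Some z)
    then show ?thesis
      using not_tendsto_and_filterlim_at_infinity[OF sequentially_bot c1[OF Some] inf] by blast
  qed
  have q1: "q n (nx d) = inverse (1 - q n d)" and q2: "Y n d * q n d * q n (rv d) = -1" for n d
    using sh[of n] by (simp_all add: shape_def divide_inverse)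
  have nz: "q n d \<noteq> 0" "q n d \<noteq> 1" for n d
    using shape_weak[OF sh[of n]] by (simp_all add: weak_shape_def)
  have Ynz: "Y n d \<noteq> 0" for n d using q2[of n d] by auto
  have q3: "q n (rv d) = - inverse (Y n d * q n d)" for n d
    using q2[of n d] nz[of n d] Ynz[of n d] by (simp add: field_simps)
  have inv0: "(\<lambda>n. inverse (s n)) \<longlonglongrightarrow> 0" if "filterlim s at_infinity sequentially" for s :: "nat \<Rightarrow> complex"
    by (rule filterlim_compose[OF tendsto_inverse_0 that])
  have invinf: "filterlim (\<lambda>n. inverse (s n)) at_infinity sequentially"
    if "s \<longlonglongrightarrow> 0" "\<And>n. s n \<noteq> 0" for s :: "nat \<Rightarrow> complex"
    by (rule filterlim_compose[OF filterlim_inverse_at_infinity]) (use that in \<open>auto intro!: filterlim_atI\<close>)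
  have uminf: "filterlim (\<lambda>n. - s n) at_infinity sequentially" if "filterlim s at_infinity sequentially"
    for s :: "nat \<Rightarrow> complex"
    using that by (simp add: filterlim_at_infinity_conv_norm_at_top)
  have "flat X P"
    unfolding flat_def
  proof (intro allI conjI)
    fix d
    show "P (nx d) = (case P d of None \<Rightarrow> Some 0 | Some z \<Rightarrow> if z = 1 then None else Some (1 / (1 - z)))"
    proof (cases "P d")
      case None
      have "filterlim (\<lambda>n. 1 + - q n d) at_infinity sequentially"
        by (rule tendsto_add_filterlim_at_infinity[OF tendsto_const uminf[OF c2[OF None]]])
      then have "(\<lambda>n. q n (nx d)) \<longlonglongrightarrow> 0" unfolding q1 using inv0 by simp
      then show ?thesis using None c3 by simp
    next
      case (Some z)
      have l: "(\<lambda>n. 1 - q n d) \<longlonglongrightarrow> 1 - z" by (intro tendsto_intros c1[OF Some])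
      show ?thesis
      proof (cases "z = 1")
        case True
        have "filterlim (\<lambda>n. q n (nx d)) at_infinity sequentially"
          unfolding q1 by (rule invinf) (use l True nz in auto)
        then show ?thesis using True Some c4 by simp
      next
        case False
        then have "(\<lambda>n. q n (nx d)) \<longlonglongrightarrow> inverse (1 - z)"
          unfolding q1 by (intro tendsto_inverse l) simp
        then show ?thesis using False Some c3 by (simp add: divide_inverse)
      qed
    qed
    show "P (rv d) = (case P d of None \<Rightarrow> Some 0 | Some z \<Rightarrow> if z = 0 then None else Some (-1 / (X d * z)))"
    proof (cases "P d")
      case None
      have "filterlim (\<lambda>n. Y n d * q n d) at_infinity sequentially"
        by (rule tendsto_mult_filterlim_at_infinity[OF Y(1) Y(2) c2[OF None]])
      then have "(\<lambda>n. q n (rv d)) \<longlonglongrightarrow> - 0" unfolding q3 by (intro tendsto_minus inv0)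
      then show ?thesis using None c3 by simp
    next
      case (Some z)
      have l: "(\<lambda>n. Y n d * q n d) \<longlonglongrightarrow> X d * z" by (intro tendsto_intros c1[OF Some] Y(1))
      show ?thesis
      proof (cases "z = 0")
        case True
        have "filterlim (\<lambda>n. q n (rv d)) at_infinity sequentially"
          unfolding q3 by (rule uminf, rule invinf) (use l True nz Ynz in auto)
        then show ?thesis using True Some c4 by simp
      next
        case False
        then have "(\<lambda>n. q n (rv d)) \<longlonglongrightarrow> - inverse (X d * z)"
          unfolding q3 by (intro tendsto_minus tendsto_inverse l) (simp add: Y(2))
        then show ?thesis using False Some c3 by (simp add: divide_inverse)
      qed
    qed
  qed
  then show ?thesis using that c1 by blast
qed

text \<open>
  The flat sections along a curve in \<open>P(\<Theta>)\<close> accumulate at a section for the initial point, whose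
  angles then vary to first order by a harmonic form.
\<close>

lemma pattern_tangent_harmonic:
  assumes shapes: "\<And>Y. Y \<in> circle_patterns M \<Theta> \<Longrightarrow> \<exists>q. shape Y q" and \<alpha>0: "triangle_angles \<alpha>0"
    and X: "X \<in> circle_patterns M \<Theta>" and ne: "\<not> induces_euclidean_torus M b X"
    and x: "x \<in> pattern_tangent M \<Theta> X"
  obtains Q \<beta> where "shape X Q" "cocycle \<beta>" "harmonic Q \<beta>" "x = modulus_variation Q \<beta>"
proof -
  obtain \<gamma> where \<gamma>: "\<And>t :: real. \<gamma> t \<in> circle_patterns M \<Theta>" "\<gamma> 0 = X"
    and dx: "\<And>d. ((\<lambda>t. ln (abs_embedding (\<gamma> t) d)) has_real_derivative x d) (at 0)"
    using x unfolding pattern_tangent_def by blast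
  define t where "t n = inverse (real (Suc n))" for n
  have t: "0 < t n" for n by (simp add: t_def)
  have t0: "t \<longlonglongrightarrow> 0" unfolding t_def by (rule LIMSEQ_inverse_real_of_nat)
  define Y where "Y n = \<gamma> (t n)" for n
  have Yc: "Y n \<in> circle_patterns M \<Theta>" for n by (simp add: Y_def \<gamma>(1))
  define L where "L Y d = ln (abs_embedding Y d)" for Y :: "'d \<Rightarrow> complex" and d
  have quot: "(\<lambda>n. (L (Y n) d - L X d) / t n) \<longlonglongrightarrow> x d" for d
  proof -
    have "((\<lambda>h. (L (\<gamma> (0 + h)) d - L (\<gamma> 0) d) / h) \<longlongrightarrow> x d) (at 0)"
      using dx[of d] unfolding DERIV_def L_def .
    moreover have "filterlim t (at 0) sequentially"
      using t0 t by (intro filterlim_atI) (auto simp: less_imp_neq[THEN not_sym])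
    ultimately show ?thesis
      using filterlim_compose[of "\<lambda>h. (L (\<gamma> (0 + h)) d - L (\<gamma> 0) d) / h" "nhds (x d)" "at 0" t sequentially]
      by (simp add: Y_def \<gamma>(2))
  qed
  have nz: "Z d \<noteq> 0" "Arg (Z d) = \<Theta> d" if "Z \<in> circle_patterns M \<Theta>" for Z d
    using circle_patterns_has_angles[OF that] by (auto simp: has_angles_def)
  have rc: "Z d = rcis (exp (L Z d)) (\<Theta> d)" if "Z \<in> circle_patterns M \<Theta>" for Z d
  proof -
    have "rcis (cmod (Z d)) (Arg (Z d)) = Z d" by (rule rcis_cmod_Arg)
    then show ?thesis using nz[OF that, of d] by (simp add: L_def abs_embedding_def)
  qed
  have Ylim: "(\<lambda>n. Y n d) \<longlonglongrightarrow> X d" for d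
  proof -
    have "(\<lambda>n. (L (Y n) d - L X d) / t n * t n + L X d) \<longlonglongrightarrow> x d * 0 + L X d"
      by (intro tendsto_intros quot t0)
    moreover have "(L (Y n) d - L X d) / t n * t n + L X d = L (Y n) d" for n
      using t[of n] by simp
    ultimately have "(\<lambda>n. L (Y n) d) \<longlonglongrightarrow> L X d" by simp
    then have "(\<lambda>n. rcis (exp (L (Y n) d)) (\<Theta> d)) \<longlonglongrightarrow> rcis (exp (L X d)) (\<Theta> d)"
      unfolding rcis_def by (intro tendsto_intros)
    then show ?thesis using rc[OF Yc, of _ d] rc[OF X, of d] by simp
  qed
  have "\<exists>q. \<forall>n. shape (Y n) (q n)" using shapes[OF Yc] by (intro choice) blast
  then obtain q where q: "\<And>n. shape (Y n) (q n)" by blast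
  obtain r where r: "strict_mono (r :: nat \<Rightarrow> nat)"
    "\<And>d. (\<exists>z. (\<lambda>n. q (r n) d) \<longlonglongrightarrow> z) \<or> filterlim (\<lambda>n. q (r n) d) at_infinity sequentially"
    by (rule sphere_subsequence[of q]) (rule that, assumption, blast)
  have Ylim': "(\<lambda>n. Y (r n) d) \<longlonglongrightarrow> X d" for d
    using LIMSEQ_subseq_LIMSEQ[OF Ylim r(1)] by (simp add: o_def)
  obtain P where P: "flat X P" "\<And>d z. P d = Some z \<Longrightarrow> (\<lambda>n. q (r n) d) \<longlonglongrightarrow> z"
    by (rule limit_flat[OF Ylim' nz(1)[OF X] q r(2)]) (rule that, assumption, blast)
  obtain Q where PQ: "\<And>d. P d = Some (Q d)" and wQ: "weak_shape X Q"
    by (rule flat_weak_shape[OF circle_patterns_has_angles[OF X] P(1)]) (rule that, blast)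
  have Q: "shape X Q" by (rule weak_shape_shape[OF circle_patterns_has_angles[OF X] wQ \<alpha>0])
  have ta: "triangle_angles (\<lambda>d. Arg (Q d))" and ba: "balanced (\<lambda>d. Arg (Q d))"
    and XQ: "X = pattern_of (\<lambda>d. Arg (Q d))"
    using shape_pattern_of[OF X Q] by auto
  have tn: "triangle_angles (\<lambda>d. Arg (q n d))" and bn: "balanced (\<lambda>d. Arg (q n d))"
    and Yn: "Y n = pattern_of (\<lambda>d. Arg (q n d))" for n
    using shape_pattern_of[OF Yc q, of n] by auto
  define \<delta> :: "nat \<Rightarrow> real^'d" where "\<delta> n = (\<chi> d. Arg (q (r n) d) - Arg (Q d))" for n
  have \<delta>cl: "\<delta> n \<in> closed_forms" for n
    using triangle_angles_diff[OF ta tn] by (simp add: closed_forms_def \<delta>_def)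
  have \<delta>0: "\<delta> \<longlonglongrightarrow> 0"
  proof (rule vec_tendstoI)
    fix d
    have "0 < Im (Q d)" using Q by (simp add: shape_def)
    then have "Q d \<notin> \<real>\<^sub>\<le>\<^sub>0" by (auto simp: complex_nonpos_Reals_iff)
    moreover have "(\<lambda>n. q (r n) d) \<longlonglongrightarrow> Q d" by (rule P(2)[OF PQ])
    ultimately have "(\<lambda>n. Arg (q (r n) d)) \<longlonglongrightarrow> Arg (Q d)" by (intro tendsto_Arg)
    then have "(\<lambda>n. Arg (q (r n) d) - Arg (Q d)) \<longlonglongrightarrow> Arg (Q d) - Arg (Q d)" by (rule tendsto_diff[OF _ tendsto_const])
    then show "(\<lambda>n. \<delta> n $ d) \<longlonglongrightarrow> 0 $ d" by (simp add: \<delta>_def)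
  qed
  have sin_pos: "0 < sin (Arg (Q d) + (0 :: real^'d) $ d)" for d
    using triangle_anglesD(5)[OF ta, of d] by simp
  have dls: "((\<lambda>u :: real^'d. ln (sin (Arg (Q d) + u $ d))) has_derivative (\<lambda>h. ct Q d * h $ d)) (at 0)" for d
    using has_derivative_ln_sin[OF sin_pos[of d]] shape_cot[OF Q, of d] by simp
  define K where "K u = (\<chi> d. penner_h M (\<lambda>e. ln (sin (Arg (Q e) + u $ e))) d)" for u :: "real^'d"
  define DK where "DK h = (\<chi> d. modulus_variation Q (($) h) d)" for h :: "real^'d"
  have dK: "(K has_derivative DK) (at 0)"
  proof (rule has_derivative_vecI)
    show "((\<lambda>u. K u $ d) has_derivative (\<lambda>h. DK h $ d)) (at 0)" for d
      unfolding K_def DK_def modulus_variation_def penner_h_def vec_lambda_beta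
      by (intro has_derivative_add has_derivative_diff dls)
  qed
  \<comment> \<open>This bounds the variation of the angles by that of the moduli; here it matters
    that \<open>X\<close> is not Euclidean.\<close>
  have inj: "u = 0" if u: "u \<in> closed_forms" "DK u = 0" for u
  proof -
    have "modulus_variation Q (($) u) = (\<lambda>_. 0)"
      using u(2) by (simp add: DK_def vec_eq_iff fun_eq_iff)
    then have "($) u = (\<lambda>_. 0)"
      using modulus_variation_inj[OF Q _ _ ne] u(1) by (simp add: closed_forms_def)
    then show ?thesis by (simp add: vec_eq_iff fun_eq_iff)
  qed
  have K\<delta>: "K (\<delta> n) $ d = L (Y (r n)) d" for n d
    unfolding L_def Yn ln_abs_pattern_of[OF tn] log_modulus_penner by (simp add: K_def \<delta>_def)
  have K0: "K 0 $ d = L X d" for d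
    unfolding L_def XQ ln_abs_pattern_of[OF ta] log_modulus_penner by (simp add: K_def)
  have secant: "(\<lambda>n. (K (\<delta> n) - K 0) /\<^sub>R t (r n)) \<longlonglongrightarrow> (\<chi> d. x d)"
  proof (rule vec_tendstoI)
    fix d
    show "(\<lambda>n. ((K (\<delta> n) - K 0) /\<^sub>R t (r n)) $ d) \<longlonglongrightarrow> (\<chi> d. x d) $ d"
      using LIMSEQ_subseq_LIMSEQ[OF quot[of d] r(1)]
      by (simp add: o_def K\<delta> K0 divide_inverse_commute)
  qed
  obtain w r2 where w: "w \<in> closed_forms" "strict_mono (r2 :: nat \<Rightarrow> nat)"
    "(\<lambda>n. \<delta> (r2 n) /\<^sub>R t (r (r2 n))) \<longlonglongrightarrow> w" "DK w = (\<chi> d. x d)"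
    by (rule secant_subsequence[OF dK subspace_closed_forms inj \<delta>cl \<delta>0 t secant])
  have "harmonic Q (($) w)"
    unfolding harmonic_def
  proof
    fix \<phi>
    \<comment> \<open>\<open>G\<close> vanishes along the sequence by balancedness, so its
      derivative vanishes in the limiting direction \<open>w\<close>.\<close>
    define G where "G u = (\<Sum>d\<in>UNIV. ln (sin (Arg (Q d) + u $ d)) * exact \<phi> d)" for u :: "real^'d"
    have "(G has_derivative (\<lambda>h. \<Sum>d\<in>UNIV. (ct Q d * h $ d) * exact \<phi> d)) (at 0)"
      unfolding G_def by (intro has_derivative_sum has_derivative_mult_left dls)
    moreover have "(\<lambda>n. \<delta> (r2 n)) \<longlonglongrightarrow> 0"
      using LIMSEQ_subseq_LIMSEQ[OF \<delta>0 w(2)] by (simp add: o_def)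
    ultimately have "(\<lambda>n. (G (\<delta> (r2 n)) - G 0) /\<^sub>R t (r (r2 n))) \<longlonglongrightarrow> (\<Sum>d\<in>UNIV. (ct Q d * w $ d) * exact \<phi> d)"
      using t w(3) by (rule secant_tendsto)
    moreover have "G (\<delta> n) = 0" for n using bn[of "r n"] by (simp add: balanced_iff G_def \<delta>_def)
    moreover have "G 0 = 0" using ba by (simp add: balanced_iff G_def)
    ultimately have "(\<lambda>n. 0) \<longlonglongrightarrow> (\<Sum>d\<in>UNIV. (ct Q d * w $ d) * exact \<phi> d)" by simp
    then show "(\<Sum>d\<in>UNIV. ct Q d * w $ d * exact \<phi> d) = 0"
      using LIMSEQ_unique[OF _ tendsto_const] by blast
  qed
  moreover have "x = modulus_variation Q (($) w)"
    using w(4) by (simp add: DK_def vec_eq_iff fun_eq_iff)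
  ultimately show ?thesis using that[OF Q] w(1) by (simp add: closed_forms_def)
qed

section \<open>Existence of shapes and non-degeneracy\<close>

lemma cocycle_Re_Im:
  assumes "cocycle F" shows "cocycle (\<lambda>d. Re (F d))" "cocycle (\<lambda>d. Im (F d))"
  using assms unfolding cocycle_def by (metis plus_complex.sel uminus_complex.sel zero_complex.sel)+

lemma ex_shape:
  assumes X0: "X0 \<in> circle_patterns M \<Theta>" and F: "cocycle F" "cross_ratio_of X0 F"
    and pr: "pairing (\<lambda>d. Re (F d)) (\<lambda>d. Im (F d)) \<noteq> 0"
    and \<alpha>0: "triangle_angles \<alpha>0" and Y: "Y \<in> circle_patterns M \<Theta>"
  shows "\<exists>q. shape Y q"
proof -
  note hY = circle_patterns_has_angles[OF Y] and hX = circle_patterns_has_angles[OF X0]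
  define x where "x d = ln (cmod (Y d)) - ln (cmod (X0 d))" for d
  have T: "abs_embedding Z \<in> Teich M" if "Z \<in> circle_patterns M \<Theta>" for Z
    by (rule abs_embedding_in_Teich[OF torus that])
  have s0: "(\<Sum>d\<in>v. ln (cmod (Z d))) = 0" if Z: "Z \<in> circle_patterns M \<Theta>" and v: "v \<in> verts M" for Z v
    using T[OF Z] v circle_patterns_has_angles[OF Z]
    by (subst ln_prod[symmetric]) (auto simp: Teich_def abs_embedding_def has_angles_def)
  have sym: "cmod (Z (rv d)) = cmod (Z d)" if Z: "Z \<in> circle_patterns M \<Theta>" for Z d
    using T[OF Z] by (simp add: Teich_def edge_functions_def abs_embedding_def)
  have "x \<in> Teich_tangent M"
    by (auto simp: Teich_tangent_def edge_functions_def x_def sym[OF X0] sym[OF Y] sum_subtractf s0[OF X0] s0[OF Y])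
  then obtain a where a: "a \<in> edge_functions M" "penner_h M a = x" by (rule penner_h_surj)
  \<comment> \<open>Rescaling lengths by \<open>exp a\<close> multiplies cross ratios by
    \<open>exp (penner_h M a)\<close>, and \<open>a\<close> is chosen to turn \<open>X0\<close> into
    \<open>Y\<close>. As \<open>a\<close> is symmetric, \<open>l\<close> stays
    antisymmetric.\<close>
  define l where "l d = F d * of_real (exp (a d))" for d
  have YX: "Y d = X0 d * of_real (exp (x d))" for d
  proof -
    have nz: "cmod (Y d) > 0" "cmod (X0 d) > 0" using hX hY by (simp_all add: has_angles_def)
    have "Y d = rcis (cmod (Y d)) (\<Theta> d)" "X0 d = rcis (cmod (X0 d)) (\<Theta> d)"
      using hX hY rcis_cmod_Arg[of "Y d"] rcis_cmod_Arg[of "X0 d"] by (simp_all add: has_angles_def)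
    moreover have "exp (x d) = cmod (Y d) / cmod (X0 d)" using nz by (simp add: x_def exp_diff)
    ultimately show ?thesis using nz by (metis mult.commute mult.left_commute rcis_def of_real_mult nonzero_mult_div_cancel_left
        times_divide_eq_right less_irrefl)
  qed
  have F0: "F d \<noteq> 0" and Fx: "X0 d * F (nx d) * F (nx (rv d)) = - F (nx (nx d)) * F (nx (nx (rv d)))" for d
    using F(2) by (auto simp: cross_ratio_of_def)
  have "cross_ratio_of Y l"
    unfolding cross_ratio_of_def
  proof (intro allI conjI)
    fix d
    show "l d \<noteq> 0" using F0 by (simp add: l_def)
    have "x d + a (nx d) + a (nx (rv d)) = a (nx (nx d)) + a (nx (nx (rv d)))"
      using fun_cong[OF a(2), of d] by (simp add: penner_h_def)
    then have "exp (x d) * exp (a (nx d)) * exp (a (nx (rv d))) = exp (a (nx (nx d))) * exp (a (nx (nx (rv d))))"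
      by (simp add: exp_add[symmetric])
    then have e: "complex_of_real (exp (x d)) * of_real (exp (a (nx d))) * of_real (exp (a (nx (rv d))))
        = of_real (exp (a (nx (nx d)))) * of_real (exp (a (nx (nx (rv d)))))"
      by (simp only: of_real_mult[symmetric])
    have "Y d * l (nx d) * l (nx (rv d)) = (X0 d * F (nx d) * F (nx (rv d)))
        * (of_real (exp (x d)) * of_real (exp (a (nx d))) * of_real (exp (a (nx (rv d)))))"
      by (simp add: YX l_def mult_ac)
    also have "\<dots> = - l (nx (nx d)) * l (nx (nx (rv d)))"
      unfolding e Fx by (simp add: l_def mult_ac)
    finally show "Y d * l (nx d) * l (nx (rv d)) = - l (nx (nx d)) * l (nx (nx (rv d)))" .
  qed
  moreover have "l (rv d) = - l d" for d
    using a(1) by (simp add: l_def cocycle_rv[OF F(1)] edge_functions_def)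
  moreover have "cross_ratio_system M Y" using Y by (simp add: circle_patterns_def)
  moreover have "cocycle (\<lambda>d. Re (F d))" "cocycle (\<lambda>d. Im (F d))"
    using cocycle_Re_Im[OF F(1)] by auto
  ultimately obtain P where "flat Y P" using ex_flat[OF _ hY _ _ _ _ pr] by blast
  then obtain q where "weak_shape Y q" using flat_weak_shape[OF hY] by blast
  then show ?thesis using weak_shape_shape[OF hY _ \<alpha>0] by blast
qed

lemma pattern_tangent_nondegenerate:
  assumes X0: "X0 \<in> circle_patterns M \<Theta>" "induces_euclidean_torus M b X0"
    and X: "X \<in> circle_patterns M \<Theta>" and ne: "\<not> induces_euclidean_torus M b X"
  shows "nondegenerate_on (pattern_tangent M \<Theta> X) (weil_petersson M)"
proof -
  obtain Q0 F where Q0: "shape X0 Q0" and F: "cocycle F" "cross_ratio_of X0 F"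
    and pr: "pairing (\<lambda>d. Re (F d)) (\<lambda>d. Im (F d)) \<noteq> 0"
    by (rule euclidean_shape[OF circle_patterns_has_angles[OF X0(1)] X0(2)])
  note \<alpha>0 = shape_triangle_angles[OF circle_patterns_has_angles[OF X0(1)] Q0]
  note shapes = ex_shape[OF X0(1) F pr \<alpha>0]
  have cF: "cocycle (\<lambda>d. Re (F d))" "cocycle (\<lambda>d. Im (F d))"
    using cocycle_Re_Im[OF F(1)] by auto
  show ?thesis
    unfolding nondegenerate_on_def
  proof (intro ballI impI, rule ccontr)
    fix x assume x: "x \<in> pattern_tangent M \<Theta> X"
      and deg: "\<forall>y\<in>pattern_tangent M \<Theta> X. weil_petersson M x y = 0" and x0: "x \<noteq> (\<lambda>_. 0)"
    obtain Q \<beta> where Q: "shape X Q" and \<beta>: "cocycle \<beta>" and xb: "x = modulus_variation Q \<beta>"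
      using pattern_tangent_harmonic[OF shapes \<alpha>0 X ne x] by metis
    have "\<beta> \<noteq> (\<lambda>_. 0)" using x0 by (auto simp: xb modulus_variation_def penner_h_def)
    then obtain d0 where d0: "\<beta> d0 \<noteq> 0" by auto
    obtain \<beta>1 \<phi>1 where 1: "cocycle \<beta>1" "harmonic Q \<beta>1" "\<And>d. Re (F d) = \<beta>1 d + exact \<phi>1 d"
      using ex_harmonic[OF Q cF(1)] by metis
    obtain \<beta>2 \<phi>2 where 2: "cocycle \<beta>2" "harmonic Q \<beta>2" "\<And>d. Im (F d) = \<beta>2 d + exact \<phi>2 d"
      using ex_harmonic[OF Q cF(2)] by metis
    have ex0: "pairing (exact \<phi>) s = 0" if "cocycle s" for \<phi> s
      using pairing_exact[OF that, of \<phi>] unfolding exact_def[abs_def] .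
    have "pairing (\<lambda>d. Re (F d)) (\<lambda>d. Im (F d)) = pairing \<beta>1 \<beta>2"
    proof -
      have "pairing (\<lambda>d. Re (F d)) (\<lambda>d. Im (F d)) = pairing \<beta>1 (\<lambda>d. Im (F d))"
        unfolding 1(3) pairing_add_left ex0[OF cF(2)] by simp
      also have "\<dots> = - pairing (\<lambda>d. Im (F d)) \<beta>1" by (rule pairing_skew)
      also have "\<dots> = - pairing \<beta>2 \<beta>1" unfolding 2(3) pairing_add_left ex0[OF 1(1)] by simp
      finally show ?thesis by (simp add: pairing_skew[of \<beta>2 \<beta>1])
    qed
    then have pr12: "pairing \<beta>1 \<beta>2 \<noteq> 0" using pr by simp
    \<comment> \<open>The harmonic parts of the Euclidean edge coordinates keep their nonzero
      pairing, so they cannot both be multiples of \<beta>.\<close>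
    have "\<exists>\<beta>'. cocycle \<beta>' \<and> harmonic Q \<beta>' \<and> (\<forall>k. \<beta>' \<noteq> (\<lambda>d. k * \<beta> d))"
    proof (rule ccontr)
      assume "\<not> ?thesis"
      then obtain k1 k2 where k: "\<beta>1 = (\<lambda>d. k1 * \<beta> d)" "\<beta>2 = (\<lambda>d. k2 * \<beta> d)" using 1(1,2) 2(1,2) by blast
      have "pairing \<beta>1 \<beta>2 = 0"
        unfolding k pairing_scale_left using pairing_skew[of \<beta> "\<lambda>d. k2 * \<beta> d"] by (simp add: pairing_scale_left)
      with pr12 show False by simp
    qed
    then obtain \<beta>' where \<beta>': "cocycle \<beta>'" "harmonic Q \<beta>'" "\<And>k. \<beta>' \<noteq> (\<lambda>d. k * \<beta> d)" by blast
    \<comment> \<open>The second tangent vector uses the same \<open>Q\<close> as \<open>x\<close>,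
      so that both forms refer to the same cotangent weights.\<close>
    have y: "modulus_variation Q \<beta>' \<in> pattern_tangent M \<Theta> X"
      by (rule harmonic_pattern_tangent[OF X Q \<beta>'(1,2)])
    have "weil_petersson M (modulus_variation Q \<beta>) (modulus_variation Q \<beta>') = 0"
      using deg y unfolding xb by blast
    moreover have "modulus_variation Q \<beta> \<in> Teich_tangent M" "modulus_variation Q \<beta>' \<in> Teich_tangent M"
      using pattern_tangent_subset[OF torus] x y unfolding xb by blast+
    ultimately have "induces_euclidean_torus M b X"
      by (intro degenerate_imp_euclidean[OF Q \<beta> d0 \<beta>'(1,3)])
    with ne show False ..
  qed
qed

end

theorem theorem1p5:
  fixes M :: "'d::finite dart_map" and b :: 'd
    and \<Theta> :: "'d \<Rightarrow> real" and X\<^sub>0 :: "'d \<Rightarrow> complex"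
  assumes "torus_triangulation M"
    and "delaunay_angle_structure M b \<Theta>"
    and "is_euclidean_point M b \<Theta> X\<^sub>0"
  shows "\<forall>X \<in> circle_patterns M \<Theta> - {X\<^sub>0}.
           nondegenerate_on (pattern_tangent M \<Theta> X) (weil_petersson M)"
proof
  fix X assume X: "X \<in> circle_patterns M \<Theta> - {X\<^sub>0}"
  interpret angled_torus M \<Theta>
    using assms(1,2)
    by unfold_locales (auto simp: delaunay_angle_structure_def edge_functions_def verts_def)
  have "\<not> induces_euclidean_torus M b X"
    using assms(3) X by (auto simp: is_euclidean_point_def)
  then show "nondegenerate_on (pattern_tangent M \<Theta> X) (weil_petersson M)"
    using assms(3) X by (intro pattern_tangent_nondegenerate[of X\<^sub>0 b]) (auto simp: is_euclidean_point_def)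
qed

end
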